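(* Let $\mathsf H$ be a quaternionic Hilbert space, let $T:D(T)\to\mathsf H$ be a closed normal operator with dense domain, let $\imath\in\mathbb S$ and let $\mathcal Q=(Q,\mathcal L)$ be an iqPVM over $\mathbb C_\imath^+$ in $\mathsf H$ such that $T=\int_{\mathbb C_\imath^+}\mathit{id}\,d\mathcal Q$, where $\mathit{id}:\mathbb C_\imath^+\hookrightarrow\mathbb H$ is the inclusion. Write $L_q=\mathcal L(q)$ for $q\in\mathbb H$. Then $$\rho_{\mathcal L}(T)=\{q\in\mathbb H: T-L_q:D(T)\to\mathsf H\text{ is bijective and }(T-L_q)^{-1}\text{ is bounded}\},$$ $$(T-L_q)^{-1}=\int_{\mathbb C_\imath^+}(z-q)^{-1}\,d\mathcal Q(z)\quad\text{if }q\in\rho_{\mathcal L}(T),$$ and $$\sigma_{\mathcal L}(T)=\sigma_S(T)\cap\mathbb C_\imath^+,\quad \sigma_{p\mathcal L}(T)=\sigma_{pS}(T)\cap\mathbb C_\imath^+,\quad \sigma_{r\mathcal L}(T)=\sigma_{rS}(T)=\emptyset,\quad \sigma_{c\mathcal L}(T)=\sigma_{cS}(T)\cap\mathbb C_\imath^+.$$ In particular, if $\psi:\mathbb C_\imath\to\mathbb C$ is the isomorphism $\alpha+\imath\beta\mapsto\alpha+i\beta$, then $\sigma_S(T)=\Omega_{\psi(\sigma_{\mathcal L}(T))}$, $\sigma_{pS}(T)=\Omega_{\psi(\sigma_{p\mathcal L}(T))}$ and $\sigma_{cS}(T)=\Omega_{\psi(\sigma_{c\mathcal L}(T))}$. Moreover,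 setting $\mathsf H_q:=Q(\{q\})(\mathsf H)$ for $q\in\mathbb C_\imath^+$: (a) $\mathsf H_q=\mathrm{Ker}(T-L_q)=\mathrm{Ker}(\Delta_q(T))$ if $q\in\mathbb C_\imath^+$, and $\mathrm{Ker}(T-L_q)=\{0\}$ if $q\in\mathbb H\setminus\mathbb C_\imath^+$. (b) Write each $u\in\mathsf H$ as $u=u_++u_-$ according to the decomposition $\mathsf H=\mathsf H_+^{L_\imath\imath}\oplus\mathsf H_-^{L_\imath\imath}$. If $q\in\mathbb C_\imath^+$, then $\mathsf H_q=\{u\in D(T): Tu_+=u_+q,\ Tu_-=u_-\overline q\}$. (c) For every $q\in\sigma_{p\mathcal L}(T)$, one has $\{u\in D(T): Tu=uq\}\subset\mathrm{Ker}(T-L_q)$. In particular, if $u$ is a (right) eigenvector of $T$ associated with $q\in\mathbb C_\imath^+$ (i.e. $u\ne0$, $Tu=uq$), then $uq=L_qu$. The inclusion is an equality if and only if $q\in\mathbb R$. (d) For every $q\in\sigma_{c\mathcal L}(T)$ and every real $\epsilon>0$, there exists $u_\epsilon\in D(T)$ such that $\|u_\epsilon\|=1$ and $\|Tu_\epsilon-L_qu_\epsilon\|<\epsilon$.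
   Context: $\mathbb H$ denotes the quaternions, $\mathbb S=\{q\in\mathbb H: q^2=-1\}$. For $\imath\in\mathbb S$: $\mathbb C_\imath=\{\alpha+\imath\beta:\alpha,\beta\in\mathbb R\}$, $\mathbb C_\imath^+=\{\alpha+\imath\beta:\alpha,\beta\in\mathbb R,\ \beta\ge0\}$, with Euclidean topology and Borel $\sigma$-algebra $\mathscr B(\mathbb C_\imath^+)$. For $E\subset\mathbb C$, the circularization is $\Omega_E=\{c+\kappa d\in\mathbb H: c,d\in\mathbb R,\ c+id\in E,\ \kappa\in\mathbb S\}$. A quaternionic Hilbert space $\mathsf H$ is a non-zero right $\mathbb H$-module with an additive $\mathbb H$-valued product satisfying $\langle u|vp+wq\rangle=\langle u|v\rangle p+\langle u|w\rangle q$, $\langle u|v\rangle=\overline{\langle v|u\rangle}$, $\langle u|u\rangle\ge0$, such that $\|u\|=\sqrt{\langle u|u\rangle}$ is a complete norm. An operator $T:D(T)\to\mathsf H$ is a right $\mathbb H$-linear map on a right $\mathbb H$-linear subspace; sums and compositions have natural domains; $T$ is normal if $TT^*=T^*T$. $\mathfrak B(\mathsf H)$ is the set of bounded operators $\mathsf H\to\mathsf H$. Left scalar multiplication of $\mathsf H$: a map $\mathcal L:\mathbb H\to\mathfrak B(\mathsf H)$, $\mathcal L(q)=L_q$, of the form $L_qu=\sum_{z\in N}zq\langle z|u\rangle$ for some Hilbert (orthonormal, total) basis $N$. $\mathsf H_\pm^{L_\imath\imath}=\{u\in\mathsf H: L_\imath u=\pm u\imath\}$ (so $u_\pm=\frac12(u\mp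 L_\imath u\,\imath)$). qPVM over $\mathbb C_\imath^+$ in $\mathsf H$: a map $Q:\mathscr B(\mathbb C_\imath^+)\to\mathfrak B(\mathsf H)$ with $Q(E)\ge0$, $Q(\mathbb C_\imath^+)=I$, $Q(E)Q(E')=Q(E\cap E')$, and $\sum_nQ(E_n)u=Q(\bigcup_nE_n)u$ for all $u$ and all countable families of pairwise disjoint Borel sets. An iqPVM is a pair $\mathcal Q=(Q,\mathcal L)$ with $Q$ a qPVM and $\mathcal L$ a left scalar multiplication with $Q(E)L_q=L_qQ(E)$ for all $E,q$. Integral: for simple $s=\sum_\ell S_\ell\chi_{E_\ell}$ ($S_\ell\in\mathbb H$, $E_\ell$ disjoint Borel), $\int s\,d\mathcal Q=\sum_\ell L_{S_\ell}Q(E_\ell)$; for bounded Borel $\varphi:\mathbb C_\imath^+\to\mathbb H$, $\int\varphi\,d\mathcal Q\in\mathfrak B(\mathsf H)$ is the norm limit of $\int s_n\,d\mathcal Q$, $s_n$ simple, $s_n\to\varphi$ uniformly. For arbitrary Borel $f:\mathbb C_\imath^+\to\mathbb H$, $\int f\,d\mathcal Q$ is the operator with domain $D_f=\{u\in\mathsf H:\int|f|^2d\mu_u<\infty\}$, $\mu_u(E)=\langle u|Q(E)u\rangle$, given by $\int f\,d\mathcal Q\,u=\lim_n\int f_n\,d\mathcal Q\,u$, with $f_n=f$ where $|f|\le n$ and $f_n=0$ elsewhere. The integrand $(z-q)^{-1}$ is given the value $0$ at $z=q$. Left spectrum: $\rho_{\mathcal L}(T)$ is the set of $q\in\mathbb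 H$ with $\mathrm{Ker}(T-L_q)=\{0\}$, $\mathrm{Ran}(T-L_q)$ dense in $\mathsf H$ and $(T-L_q)^{-1}:\mathrm{Ran}(T-L_q)\to D(T)$ bounded; $\sigma_{\mathcal L}(T)=\mathbb H\setminus\rho_{\mathcal L}(T)$. $\sigma_{p\mathcal L}(T)$: $\mathrm{Ker}(T-L_q)\ne\{0\}$; $\sigma_{r\mathcal L}(T)$: $\mathrm{Ker}(T-L_q)=\{0\}$ and $\mathrm{Ran}(T-L_q)$ not dense; $\sigma_{c\mathcal L}(T)$: $\mathrm{Ker}(T-L_q)=\{0\}$, $\mathrm{Ran}(T-L_q)$ dense and $(T-L_q)^{-1}$ not bounded. Spherical spectrum: for $q\in\mathbb H$, $\Delta_q(T)=T^2-T(2\mathrm{Re}(q))+I|q|^2$ on $D(T^2)$. The spherical resolvent set, $\sigma_S(T)$, $\sigma_{pS}(T)$, $\sigma_{rS}(T)$, $\sigma_{cS}(T)$ are defined exactly as $\rho_{\mathcal L}(T),\sigma_{\mathcal L}(T),\sigma_{p\mathcal L}(T),\sigma_{r\mathcal L}(T),\sigma_{c\mathcal L}(T)$ with $T-L_q$ replaced by $\Delta_q(T)$ and $D(T)$ by $D(T^2)$. *)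

theory Defs
  imports "HOL-Analysis.Analysis" "HOL-Library.Nonpos_Ints"
begin

section \<open>Quaternions\<close>

datatype quat = Quat (qRe: real) (qI: real) (qJ: real) (qK: real)

lemma quat_eq_iff: "x = y \<longleftrightarrow> qRe x = qRe y \<and> qI x = qI y \<and> qJ x = qJ y \<and> qK x = qK y"
  by (cases x; cases y) auto

definition qcnj :: "quat \<Rightarrow> quat" where
  "qcnj x = Quat (qRe x) (- qI x) (- qJ x) (- qK x)"

lemma qcnj_sel [simp]:
  "qRe (qcnj x) = qRe x" "qI (qcnj x) = - qI x" "qJ (qcnj x) = - qJ x" "qK (qcnj x) = - qK x"
  by (simp_all add: qcnj_def)

instantiation quat :: ring_1
begin

definition "0 = Quat 0 0 0 0"
definition "1 = Quat 1 0 0 0"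
definition "x + y = Quat (qRe x + qRe y) (qI x + qI y) (qJ x + qJ y) (qK x + qK y)"
definition "x - y = Quat (qRe x - qRe y) (qI x - qI y) (qJ x - qJ y) (qK x - qK y)"
definition "- x = Quat (- qRe x) (- qI x) (- qJ x) (- qK x)"
definition "x * y = Quat
  (qRe x * qRe y - qI x * qI y - qJ x * qJ y - qK x * qK y)
  (qRe x * qI y + qI x * qRe y + qJ x * qK y - qK x * qJ y)
  (qRe x * qJ y - qI x * qK y + qJ x * qRe y + qK x * qI y)
  (qRe x * qK y + qI x * qJ y - qJ x * qI y + qK x * qRe y)"

lemma quat_zero_sel [simp]: "qRe 0 = 0" "qI 0 = 0" "qJ 0 = 0" "qK 0 = 0"
  by (simp_all add: zero_quat_def)
lemma quat_one_sel [simp]: "qRe 1 = 1" "qI 1 = 0" "qJ 1 = 0" "qK 1 = 0"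
  by (simp_all add: one_quat_def)
lemma quat_add_sel [simp]: "qRe (x + y) = qRe x + qRe y" "qI (x + y) = qI x + qI y"
  "qJ (x + y) = qJ x + qJ y" "qK (x + y) = qK x + qK y"
  by (simp_all add: plus_quat_def)
lemma quat_diff_sel [simp]: "qRe (x - y) = qRe x - qRe y" "qI (x - y) = qI x - qI y"
  "qJ (x - y) = qJ x - qJ y" "qK (x - y) = qK x - qK y"
  by (simp_all add: minus_quat_def)
lemma quat_uminus_sel [simp]: "qRe (- x) = - qRe x" "qI (- x) = - qI x"
  "qJ (- x) = - qJ x" "qK (- x) = - qK x"
  by (simp_all add: uminus_quat_def)
lemma quat_mult_sel [simp]:
  "qRe (x * y) = qRe x * qRe y - qI x * qI y - qJ x * qJ y - qK x * qK y"
  "qI (x * y) = qRe x * qI y + qI x * qRe y + qJ x * qK y - qK x * qJ y"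
  "qJ (x * y) = qRe x * qJ y - qI x * qK y + qJ x * qRe y + qK x * qI y"
  "qK (x * y) = qRe x * qK y + qI x * qJ y - qJ x * qI y + qK x * qRe y"
  by (simp_all add: times_quat_def)

instance
  by standard (simp_all add: quat_eq_iff algebra_simps)

end

instantiation quat :: real_vector
begin

definition "r *\<^sub>R x = Quat (r * qRe x) (r * qI x) (r * qJ x) (r * qK x)"

lemma quat_scaleR_sel [simp]: "qRe (r *\<^sub>R x) = r * qRe x" "qI (r *\<^sub>R x) = r * qI x"
  "qJ (r *\<^sub>R x) = r * qJ x" "qK (r *\<^sub>R x) = r * qK x"
  by (simp_all add: scaleR_quat_def)

instance
  by standard (simp_all add: quat_eq_iff algebra_simps)

end

instantiation quat :: real_inner
begin

definition "inner x y = qRe x * qRe y + qI x * qI y + qJ x * qJ y + qK x * qK y"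
definition "norm (x::quat) = sqrt (inner x x)"
definition "sgn (x::quat) = x /\<^sub>R norm x"
definition "dist (x::quat) y = norm (x - y)"
definition [code del]:
  "(uniformity :: (quat \<times> quat) filter) = (INF e\<in>{0 <..}. principal {(x, y). dist x y < e})"
definition [code del]:
  "open (U :: quat set) \<longleftrightarrow> (\<forall>x\<in>U. eventually (\<lambda>(x', y). x' = x \<longrightarrow> y \<in> U) uniformity)"

instance
proof
  fix x y z :: quat and r :: real and U :: "quat set"
  show "inner x x = 0 \<longleftrightarrow> x = 0"
    by (simp add: inner_quat_def quat_eq_iff add_nonneg_eq_0_iff)
  show "open U \<longleftrightarrow> (\<forall>x\<in>U. eventually (\<lambda>(x', y). x' = x \<longrightarrow> y \<in> U) uniformity)"
    by (fact open_quat_def)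
  show "uniformity = (INF e\<in>{0 <..}. principal {(x::quat, y). dist x y < e})"
    by (fact uniformity_quat_def)
qed (simp_all add: quat_eq_iff algebra_simps inner_quat_def norm_quat_def sgn_quat_def
      dist_quat_def)

end

instantiation quat :: real_normed_div_algebra
begin

definition "inverse (x::quat) = qcnj x /\<^sub>R inner x x"
definition "x div (y::quat) = x * inverse y"

instance
proof
  fix x y :: quat and r :: real
  show "inverse 0 = (0::quat)"
    by (simp add: inverse_quat_def quat_eq_iff)
  show "norm (x * y) = norm x * norm y"
    unfolding norm_quat_def real_sqrt_mult [symmetric]
    by (simp add: inner_quat_def algebra_simps)
  assume "x \<noteq> 0"
  then have n: "inner x x \<noteq> 0" by simp
  have "x * qcnj x = inner x x *\<^sub>R 1" "qcnj x * x = inner x x *\<^sub>R 1"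
    by (simp_all add: quat_eq_iff inner_quat_def algebra_simps)
  moreover have "x * (r *\<^sub>R y) = r *\<^sub>R (x * y)" "(r *\<^sub>R x) * y = r *\<^sub>R (x * y)" for r and x y :: quat
    by (simp_all add: quat_eq_iff algebra_simps)
  ultimately show "inverse x * x = 1" "x * inverse x = 1"
    using n by (simp_all add: inverse_quat_def)
qed (simp_all add: divide_quat_def quat_eq_iff algebra_simps)

end

instantiation quat :: euclidean_space
begin

definition "Basis = {Quat 1 0 0 0, Quat 0 1 0 0, Quat 0 0 1 0, Quat 0 0 0 1}"

instance
proof
  fix u v x :: quat
  show "(Basis :: quat set) \<noteq> {}" "finite (Basis :: quat set)"
    by (simp_all add: Basis_quat_def)
  show "(\<forall>u\<in>Basis. inner x u = 0) \<longleftrightarrow> x = 0"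
    by (simp add: Basis_quat_def inner_quat_def quat_eq_iff [of x 0])
  assume "u \<in> Basis" "v \<in> Basis"
  then show "inner u v = (if u = v then 1 else 0)"
    unfolding Basis_quat_def inner_quat_def insert_iff empty_iff
    by (elim disjE) simp_all
qed

end

definition qS :: "quat set" where
  "qS = {q. q^2 = - 1}"

definition Cslice_pos :: "quat \<Rightarrow> quat set" where
  "Cslice_pos \<iota> = {of_real \<alpha> + \<iota> * of_real \<beta> | \<alpha> \<beta>. \<beta> \<ge> 0}"

definition slice_iso :: "quat \<Rightarrow> quat \<Rightarrow> complex" where
  "slice_iso \<iota> q = (THE w. q = of_real (Re w) + \<iota> * of_real (Im w))"

definition circularization :: "complex set \<Rightarrow> quat set" where
  "circularization E = {of_real c + \<kappa> * of_real d | c d \<kappa>. Complex c d \<in> E \<and> \<kappa> \<in> qS}"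


section \<open>Quaternionic Hilbert spaces\<close>

text \<open>The real inner product carried by the class is the real part of the quaternionic product,
  so that the norm is the quaternionic one, \<open>sqrt \<langle>u|u\<rangle>\<close>; completeness and
  the topology are those of this norm.\<close>

class quat_hilbert_space = real_inner + complete_space +
  fixes scaleQ :: "'a \<Rightarrow> quat \<Rightarrow> 'a"  (infixl "*\<^sub>q" 75)
    and qinner :: "'a \<Rightarrow> 'a \<Rightarrow> quat"
  assumes scaleQ_add_left: "(u + v) *\<^sub>q p = u *\<^sub>q p + v *\<^sub>q p"
    and scaleQ_add_right: "u *\<^sub>q (p + q) = u *\<^sub>q p + u *\<^sub>q q"
    and scaleQ_mult: "u *\<^sub>q (p * q) = (u *\<^sub>q p) *\<^sub>q q"
    and scaleQ_one: "u *\<^sub>q 1 = u"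
    and scaleR_eq_scaleQ: "r *\<^sub>R u = u *\<^sub>q of_real r"
    and qinner_linear: "qinner u (v *\<^sub>q p + w *\<^sub>q q) = qinner u v * p + qinner u w * q"
    and qinner_cnj: "qinner u v = qcnj (qinner v u)"
    and qinner_nonneg: "qinner u u \<in> \<real>\<^sub>\<ge>\<^sub>0"
    and inner_eq_qinner: "inner u v = qRe (qinner u v)"
    and nontrivial: "\<exists>u. u \<noteq> 0"


lemma norm_eq_sqrt_qinner: "norm (u::'h::quat_hilbert_space) = sqrt (qRe (qinner u u))"
  by (simp add: norm_eq_sqrt_inner inner_eq_qinner)


section \<open>Operators\<close>

text \<open>A (partially defined) operator is a partial function, so that equality of operators
  includes equality of domains and \<open>\<circ>\<^sub>m\<close> is composition with its natural domain.\<close>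

type_synonym 'h op = "'h \<Rightarrow> 'h option"

definition operator :: "'h::quat_hilbert_space op \<Rightarrow> bool" where
  "operator T \<longleftrightarrow> 0 \<in> dom T \<and>
     (\<forall>u\<in>dom T. \<forall>v\<in>dom T. \<forall>p q.
        T (u *\<^sub>q p + v *\<^sub>q q) = Some (the (T u) *\<^sub>q p + the (T v) *\<^sub>q q))"

definition op_add :: "'h::quat_hilbert_space op \<Rightarrow> 'h op \<Rightarrow> 'h op" where
  "op_add S T = (\<lambda>u. if u \<in> dom S \<inter> dom T then Some (the (S u) + the (T u)) else None)"

definition op_diff :: "'h::quat_hilbert_space op \<Rightarrow> 'h op \<Rightarrow> 'h op" where
  "op_diff S T = (\<lambda>u. if u \<in> dom S \<inter> dom T then Some (the (S u) - the (T u)) else None)"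

definition op_scalar :: "quat \<Rightarrow> 'h::quat_hilbert_space op" where
  "op_scalar q = (\<lambda>u. Some (u *\<^sub>q q))"

definition op_ker :: "'h::quat_hilbert_space op \<Rightarrow> 'h set" where
  "op_ker T = {u. T u = Some 0}"

text \<open>Only meaningful for injective \<open>T\<close>; the domain is the range of \<open>T\<close>.\<close>

definition op_inv :: "'h::quat_hilbert_space op \<Rightarrow> 'h op" where
  "op_inv T = (\<lambda>v. if v \<in> ran T then Some (THE u. T u = Some v) else None)"

definition op_bounded :: "'h::quat_hilbert_space op \<Rightarrow> bool" where
  "op_bounded T \<longleftrightarrow> (\<exists>K. \<forall>u\<in>dom T. norm (the (T u)) \<le> K * norm u)"

definition op_closed :: "'h::quat_hilbert_space op \<Rightarrow> bool" where
  "op_closed T \<longleftrightarrow> closed {(u, v). T u = Some v}"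

text \<open>The vector \<open>w\<close> is unique when \<open>dom T\<close> is dense.\<close>

definition op_adj :: "'h::quat_hilbert_space op \<Rightarrow> 'h op" where
  "op_adj T = (\<lambda>u.
     if \<exists>w. \<forall>v\<in>dom T. qinner u (the (T v)) = qinner w v
     then Some (THE w. \<forall>v\<in>dom T. qinner u (the (T v)) = qinner w v)
     else None)"

definition op_normal :: "'h::quat_hilbert_space op \<Rightarrow> bool" where
  "op_normal T \<longleftrightarrow> T \<circ>\<^sub>m op_adj T = op_adj T \<circ>\<^sub>m T"

text \<open>Everywhere defined bounded operators are plain functions.\<close>

definition bounded_qlinear :: "('h::quat_hilbert_space \<Rightarrow> 'h) \<Rightarrow> bool" where
  "bounded_qlinear A \<longleftrightarrow> bounded_linear A \<and> (\<forall>u q. A (u *\<^sub>q q) = A u *\<^sub>q q)"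


section \<open>Left scalar multiplications\<close>

definition hilbert_basis :: "'h::quat_hilbert_space set \<Rightarrow> bool" where
  "hilbert_basis N \<longleftrightarrow>
     (\<forall>z\<in>N. \<forall>z'\<in>N. qinner z z' = (if z = z' then 1 else 0)) \<and>
     closure {\<Sum>z\<in>F. z *\<^sub>q c z | F c. finite F \<and> F \<subseteq> N} = UNIV"

definition left_scalar_mult :: "(quat \<Rightarrow> 'h::quat_hilbert_space \<Rightarrow> 'h) \<Rightarrow> bool" where
  "left_scalar_mult L \<longleftrightarrow> (\<forall>q. bounded_qlinear (L q)) \<and>
     (\<exists>N. hilbert_basis N \<and>
        (\<forall>q u. ((\<lambda>z. z *\<^sub>q q *\<^sub>q qinner z u) has_sum L q u) N))"

definition Hplus :: "(quat \<Rightarrow> 'h::quat_hilbert_space \<Rightarrow> 'h) \<Rightarrow> quat \<Rightarrow> 'h set" where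
  "Hplus L \<iota> = {u. L \<iota> u = u *\<^sub>q \<iota>}"

definition Hminus :: "(quat \<Rightarrow> 'h::quat_hilbert_space \<Rightarrow> 'h) \<Rightarrow> quat \<Rightarrow> 'h set" where
  "Hminus L \<iota> = {u. L \<iota> u = - (u *\<^sub>q \<iota>)}"

definition comp_plus :: "(quat \<Rightarrow> 'h::quat_hilbert_space \<Rightarrow> 'h) \<Rightarrow> quat \<Rightarrow> 'h \<Rightarrow> 'h" where
  "comp_plus L \<iota> u = (u - L \<iota> u *\<^sub>q \<iota>) /\<^sub>R 2"

definition comp_minus :: "(quat \<Rightarrow> 'h::quat_hilbert_space \<Rightarrow> 'h) \<Rightarrow> quat \<Rightarrow> 'h \<Rightarrow> 'h" where
  "comp_minus L \<iota> u = (u + L \<iota> u *\<^sub>q \<iota>) /\<^sub>R 2"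

text \<open>The lemma \<open>slice_decomposition\<close> below shows that these are the components with respect to the direct sum
  of \<open>Hplus L \<iota>\<close> and \<open>Hminus L \<iota>\<close>.\<close>

lemma qinner_bounded_linear: "bounded_linear (qinner (u::'h::quat_hilbert_space))"
proof -
  have add: "qinner u (v + w) = qinner u v + qinner u w" for v w
    using qinner_linear [of u v 1 w 1] by (simp add: scaleQ_one)
  have mult: "qinner u (v *\<^sub>q p) = qinner u v * p" for v p
    using qinner_linear [of u v p v 0] scaleR_eq_scaleQ [of 0 v] by simp
  have norm_scaleQ: "norm (v *\<^sub>q p) = norm v * norm p" for v :: 'h and p
  proof -
    obtain r where r: "qinner v v = of_real r"
      using qinner_nonneg [of v] by (auto simp: nonneg_Reals_def)
    have "qinner (v *\<^sub>q p) v = qcnj (of_real r * p)"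
      using qinner_cnj [of "v *\<^sub>q p" v] qinner_linear [of v v p v 0] scaleR_eq_scaleQ [of 0 v] r
      by simp
    moreover have "qinner (v *\<^sub>q p) (v *\<^sub>q p) = qinner (v *\<^sub>q p) v * p"
      using qinner_linear [of "v *\<^sub>q p" v p v 0] scaleR_eq_scaleQ [of 0 v] by simp
    ultimately have "qRe (qinner (v *\<^sub>q p) (v *\<^sub>q p)) = r * inner p p"
      by (simp add: of_real_def inner_quat_def algebra_simps)
    moreover have "inner v v = r"
      by (simp add: inner_eq_qinner r of_real_def)
    ultimately have "inner (v *\<^sub>q p) (v *\<^sub>q p) = inner v v * inner p p"
      by (simp add: inner_eq_qinner)
    then show ?thesis
      by (simp add: norm_eq_sqrt_inner real_sqrt_mult)
  qed
  have coord: "\<bar>qRe (qinner u v * p)\<bar> \<le> norm u * norm v * norm p" for v p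
    using Cauchy_Schwarz_ineq2 [of u "v *\<^sub>q p"]
    by (simp add: inner_eq_qinner mult norm_scaleQ)
  show ?thesis
  proof (rule bounded_linear_intro)
    show "qinner u (v + w) = qinner u v + qinner u w" for v w by (fact add)
    show "qinner u (r *\<^sub>R v) = r *\<^sub>R qinner u v" for r v
      by (simp add: scaleR_eq_scaleQ mult) (simp add: of_real_def quat_eq_iff)
    show "norm (qinner u v) \<le> norm v * norm u" for v
    proof -
      let ?x = "qinner u v"
      have "(norm ?x)\<^sup>2 = qRe (?x * qcnj ?x)"
        by (simp add: power2_norm_eq_inner inner_quat_def)
      also have "\<dots> \<le> norm u * norm v * norm ?x"
        using coord [of v "qcnj ?x"] by (simp add: norm_quat_def inner_quat_def)
      finally show ?thesis
        by (cases "norm ?x = 0") (simp_all add: power2_eq_square mult.commute mult.left_commute)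
    qed
  qed
qed

lemma left_scalar_mult_square:
  fixes L :: "quat \<Rightarrow> 'h::quat_hilbert_space \<Rightarrow> 'h"
  assumes "left_scalar_mult L" "\<iota> \<in> qS"
  shows "L \<iota> (L \<iota> u) = - u"
proof -
  obtain N where N: "hilbert_basis N"
    and sum: "\<And>q u. ((\<lambda>z. z *\<^sub>q q *\<^sub>q qinner z u) has_sum L q u) N"
    using assms(1) by (auto simp: left_scalar_mult_def)
  have mult: "qinner u (v *\<^sub>q p) = qinner u v * p" for u v :: 'h and p
    using qinner_linear [of u v p v 0] scaleR_eq_scaleQ [of 0 v] by simp
  have coord: "qinner z (L q u) = q * qinner z u" if "z \<in> N" for z q u
  proof -
    have "((qinner z \<circ> (\<lambda>z. z *\<^sub>q q *\<^sub>q qinner z u)) has_sum qinner z (L q u)) N"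
      using has_sum_bounded_linear [OF qinner_bounded_linear sum] by (simp add: o_def)
    moreover have "((qinner z \<circ> (\<lambda>z. z *\<^sub>q q *\<^sub>q qinner z u)) has_sum q * qinner z u) N"
    proof (rule has_sum_finite_neutralI [where B = "{z}"])
      show "(qinner z \<circ> (\<lambda>z. z *\<^sub>q q *\<^sub>q qinner z u)) x = 0" if "x \<in> N - {z}" for x
        using that \<open>z \<in> N\<close> N by (auto simp: hilbert_basis_def mult)
    qed (use \<open>z \<in> N\<close> N in \<open>auto simp: hilbert_basis_def mult\<close>)
    ultimately show ?thesis
      by (rule has_sum_unique)
  qed
  have one: "L 1 u = u" for u
  proof -
    define d where "d = L 1 u - u"
    have "qinner z d = 0" if "z \<in> N" for z
      using coord [OF that, of 1 u] linear_diff [OF bounded_linear.linear [OF qinner_bounded_linear], of z "L 1 u" u]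
      by (simp add: d_def)
    then have "qinner d z = 0" if "z \<in> N" for z
      using that qinner_cnj [of d z] by (simp add: quat_eq_iff)
    then have "inner d (\<Sum>z\<in>F. z *\<^sub>q c z) = 0" if "F \<subseteq> N" for F c
      unfolding inner_sum_right using that by (auto simp: inner_eq_qinner mult intro!: sum.neutral)
    then have "closure {\<Sum>z\<in>F. z *\<^sub>q c z | F c. finite F \<and> F \<subseteq> N} \<subseteq> {w. inner d w = 0}"
      by (intro closure_minimal closed_Collect_eq continuous_intros) auto
    then have "inner d d = 0"
      using N unfolding hilbert_basis_def by blast
    then show ?thesis
      by (simp add: d_def)
  qed
  have "z *\<^sub>q \<iota> *\<^sub>q qinner z (L \<iota> u) = - (z *\<^sub>q 1 *\<^sub>q qinner z u)" if "z \<in> N" for z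
  proof -
    have "\<iota> * (\<iota> * qinner z u) = of_real (- 1) * qinner z u"
      using assms(2) by (simp add: qS_def power2_eq_square flip: mult.assoc)
    then have "z *\<^sub>q \<iota> *\<^sub>q qinner z (L \<iota> u) = z *\<^sub>q of_real (- 1) *\<^sub>q qinner z u"
      by (simp add: coord [OF that] flip: scaleQ_mult)
    also have "\<dots> = z *\<^sub>q qinner z u *\<^sub>q of_real (- 1)"
      by (simp flip: scaleQ_mult)
    also have "\<dots> = - (z *\<^sub>q qinner z u)"
      by (simp only: scaleR_eq_scaleQ [symmetric]) simp
    finally show ?thesis by (simp add: scaleQ_one)
  qed
  then have "((\<lambda>z. - (z *\<^sub>q 1 *\<^sub>q qinner z u)) has_sum L \<iota> (L \<iota> u)) N"
    using sum [of \<iota> "L \<iota> u"] by (simp cong: has_sum_cong)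
  moreover have "((\<lambda>z. - (z *\<^sub>q 1 *\<^sub>q qinner z u)) has_sum - L 1 u) N"
    using sum [of 1 u] by (simp add: has_sum_uminus)
  ultimately show ?thesis
    using has_sum_unique one by metis
qed

lemma slice_decomposition:
  fixes L :: "quat \<Rightarrow> 'h::quat_hilbert_space \<Rightarrow> 'h"
  assumes L: "left_scalar_mult L" and \<iota>: "\<iota> \<in> qS"
  shows "v \<in> Hplus L \<iota> \<and> w \<in> Hminus L \<iota> \<and> u = v + w \<longleftrightarrow>
    v = comp_plus L \<iota> u \<and> w = comp_minus L \<iota> u"
proof -
  interpret bounded_linear "L \<iota>"
    using L by (simp add: left_scalar_mult_def bounded_qlinear_def)
  have right: "L \<iota> (x *\<^sub>q q) = L \<iota> x *\<^sub>q q" for x q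
    using L by (simp add: left_scalar_mult_def bounded_qlinear_def)
  have neg: "(- x) *\<^sub>q q = - (x *\<^sub>q q)" for x :: 'h and q
    using scaleQ_add_left [of x "- x" q, symmetric] scaleQ_add_left [of 0 0 q]
    by (metis add.right_inverse add_left_imp_eq add.right_neutral)
  have sub: "(x - y) *\<^sub>q q = x *\<^sub>q q - y *\<^sub>q q" for x y :: 'h and q
    using scaleQ_add_left [of x "- y" q] by (simp add: neg)
  have half: "(r *\<^sub>R x) *\<^sub>q q = r *\<^sub>R (x *\<^sub>q q)" for x :: 'h and r q
    unfolding scaleR_eq_scaleQ scaleQ_mult [symmetric]
    by (rule arg_cong [of _ _ "scaleQ x"]) (simp add: of_real_def quat_eq_iff)
  have sq: "x *\<^sub>q \<iota> *\<^sub>q \<iota> = - x" for x :: 'h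
    using \<iota> scaleR_eq_scaleQ [of "- 1" x]
    by (simp add: qS_def power2_eq_square flip: scaleQ_mult)
  note LL = left_scalar_mult_square [OF L \<iota>]
  note rules = diff add scaleR right LL neg sub half sq scaleQ_add_left
  have 1: "comp_plus L \<iota> u \<in> Hplus L \<iota>" "comp_minus L \<iota> u \<in> Hminus L \<iota>"
    by (simp_all add: Hplus_def Hminus_def comp_plus_def comp_minus_def rules
        flip: scaleR_minus_right)
  have 2: "u = comp_plus L \<iota> u + comp_minus L \<iota> u"
    by (simp add: comp_plus_def comp_minus_def scaleR_diff_right scaleR_add_right
        flip: scaleR_left_distrib)
  have 3: "v = comp_plus L \<iota> u \<and> w = comp_minus L \<iota> u"
    if "v \<in> Hplus L \<iota>" "w \<in> Hminus L \<iota>" "u = v + w"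
  proof -
    have "L \<iota> u *\<^sub>q \<iota> = w - v"
      using that by (simp add: Hplus_def Hminus_def rules)
    then show ?thesis
      using that(3) by (simp add: comp_plus_def comp_minus_def flip: scaleR_2)
  qed
  show ?thesis using 1 2 3 by blast
qed


section \<open>Projection-valued measures and integrals\<close>

definition borel_slice :: "quat \<Rightarrow> quat measure" where
  "borel_slice \<iota> = restrict_space borel (Cslice_pos \<iota>)"

definition qPVM :: "quat \<Rightarrow> (quat set \<Rightarrow> 'h::quat_hilbert_space \<Rightarrow> 'h) \<Rightarrow> bool" where
  "qPVM \<iota> Q \<longleftrightarrow>
     (\<forall>E\<in>sets (borel_slice \<iota>). bounded_qlinear (Q E) \<and> (\<forall>u. qinner u (Q E u) \<in> \<real>\<^sub>\<ge>\<^sub>0)) \<and>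
     Q (Cslice_pos \<iota>) = id \<and>
     (\<forall>E\<in>sets (borel_slice \<iota>). \<forall>E'\<in>sets (borel_slice \<iota>). Q E \<circ> Q E' = Q (E \<inter> E')) \<and>
     (\<forall>E::nat \<Rightarrow> quat set. range E \<subseteq> sets (borel_slice \<iota>) \<longrightarrow> disjoint_family E \<longrightarrow>
        (\<forall>u. (\<lambda>n. Q (E n) u) sums Q (\<Union>n. E n) u))"

definition iqPVM :: "quat \<Rightarrow> (quat set \<Rightarrow> 'h::quat_hilbert_space \<Rightarrow> 'h) \<Rightarrow>
    (quat \<Rightarrow> 'h \<Rightarrow> 'h) \<Rightarrow> bool" where
  "iqPVM \<iota> Q L \<longleftrightarrow> qPVM \<iota> Q \<and> left_scalar_mult L \<and>
     (\<forall>E\<in>sets (borel_slice \<iota>). \<forall>q. Q E \<circ> L q = L q \<circ> Q E)"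

definition simple_qint :: "quat \<Rightarrow> (quat set \<Rightarrow> 'h::quat_hilbert_space \<Rightarrow> 'h) \<Rightarrow>
    (quat \<Rightarrow> 'h \<Rightarrow> 'h) \<Rightarrow> (quat \<Rightarrow> quat) \<Rightarrow> 'h \<Rightarrow> 'h" where
  "simple_qint \<iota> Q L s u =
     (\<Sum>c\<in>s ` Cslice_pos \<iota>. L c (Q {z\<in>Cslice_pos \<iota>. s z = c} u))"

definition bounded_qint :: "quat \<Rightarrow> (quat set \<Rightarrow> 'h::quat_hilbert_space \<Rightarrow> 'h) \<Rightarrow>
    (quat \<Rightarrow> 'h \<Rightarrow> 'h) \<Rightarrow> (quat \<Rightarrow> quat) \<Rightarrow> 'h \<Rightarrow> 'h" where
  "bounded_qint \<iota> Q L \<phi> = (THE A. bounded_qlinear A \<and>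
     (\<exists>s. (\<forall>n. simple_function (borel_slice \<iota>) (s n)) \<and>
          uniform_limit (Cslice_pos \<iota>) s \<phi> sequentially \<and>
          (\<lambda>n. onorm (\<lambda>u. simple_qint \<iota> Q L (s n) u - A u)) \<longlonglongrightarrow> 0))"

definition spectral_measure :: "quat \<Rightarrow> (quat set \<Rightarrow> 'h::quat_hilbert_space \<Rightarrow> 'h) \<Rightarrow>
    'h \<Rightarrow> quat measure" where
  "spectral_measure \<iota> Q u = measure_of (Cslice_pos \<iota>) (sets (borel_slice \<iota>))
     (\<lambda>E. ennreal (qRe (qinner u (Q E u))))"

definition qint :: "quat \<Rightarrow> (quat set \<Rightarrow> 'h::quat_hilbert_space \<Rightarrow> 'h) \<Rightarrow>
    (quat \<Rightarrow> 'h \<Rightarrow> 'h) \<Rightarrow> (quat \<Rightarrow> quat) \<Rightarrow> 'h op" where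
  "qint \<iota> Q L f = (\<lambda>u.
     if (\<integral>\<^sup>+ z. ennreal ((norm (f z))\<^sup>2) \<partial>spectral_measure \<iota> Q u) < \<infinity>
     then Some (lim (\<lambda>n. bounded_qint \<iota> Q L (\<lambda>z. if norm (f z) \<le> real n then f z else 0) u))
     else None)"


section \<open>Left and spherical spectra\<close>

text \<open>Both families of spectra are instances of the same definitions for a family \<open>A\<close> of operators
  indexed by quaternions.\<close>

definition resolvent_set :: "(quat \<Rightarrow> 'h::quat_hilbert_space op) \<Rightarrow> quat set" where
  "resolvent_set A = {q. op_ker (A q) = {0} \<and> closure (ran (A q)) = UNIV \<and> op_bounded (op_inv (A q))}"

definition spectrum_set :: "(quat \<Rightarrow> 'h::quat_hilbert_space op) \<Rightarrow> quat set" where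
  "spectrum_set A = UNIV - resolvent_set A"

definition point_spectrum :: "(quat \<Rightarrow> 'h::quat_hilbert_space op) \<Rightarrow> quat set" where
  "point_spectrum A = {q. op_ker (A q) \<noteq> {0}}"

definition residual_spectrum :: "(quat \<Rightarrow> 'h::quat_hilbert_space op) \<Rightarrow> quat set" where
  "residual_spectrum A = {q. op_ker (A q) = {0} \<and> closure (ran (A q)) \<noteq> UNIV}"

definition continuous_spectrum :: "(quat \<Rightarrow> 'h::quat_hilbert_space op) \<Rightarrow> quat set" where
  "continuous_spectrum A =
     {q. op_ker (A q) = {0} \<and> closure (ran (A q)) = UNIV \<and> \<not> op_bounded (op_inv (A q))}"

definition left_op :: "(quat \<Rightarrow> 'h::quat_hilbert_space \<Rightarrow> 'h) \<Rightarrow> 'h op \<Rightarrow> quat \<Rightarrow> 'h op" where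
  "left_op L T q = op_diff T (Some \<circ> L q)"

definition spherical_op :: "'h::quat_hilbert_space op \<Rightarrow> quat \<Rightarrow> 'h op" where
  "spherical_op T q =
     op_add (op_diff (T \<circ>\<^sub>m T) (T \<circ>\<^sub>m op_scalar (of_real (2 * qRe q))))
            (op_scalar (of_real ((norm q)\<^sup>2)))"

abbreviation "rho_L L T \<equiv> resolvent_set (left_op L T)"
abbreviation "sigma_L L T \<equiv> spectrum_set (left_op L T)"
abbreviation "sigma_pL L T \<equiv> point_spectrum (left_op L T)"
abbreviation "sigma_rL L T \<equiv> residual_spectrum (left_op L T)"
abbreviation "sigma_cL L T \<equiv> continuous_spectrum (left_op L T)"
abbreviation "sigma_S T \<equiv> spectrum_set (spherical_op T)"
abbreviation "sigma_pS T \<equiv> point_spectrum (spherical_op T)"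
abbreviation "sigma_rS T \<equiv> residual_spectrum (spherical_op T)"
abbreviation "sigma_cS T \<equiv> continuous_spectrum (spherical_op T)"

end

theory Submission
  imports Defs
begin

text \<open>The integral \<open>\<integral> f dQ\<close> of an unbounded \<open>f\<close> is determined by the bounded functional calculus:
  \<open>(\<integral> f dQ) u = v\<close> iff \<open>(\<integral>\<^sub>E f dQ) u = Q(E) v\<close> for every Borel set \<open>E\<close> on which \<open>f\<close> is bounded. Hence
  \<open>\<integral> f dQ\<close> has kernel \<open>ran Q(f = 0)\<close>; if this is trivial, its inverse is \<open>\<integral> f\<^sup>-\<^sup>1 dQ\<close>, its range is
  dense, and its inverse is bounded iff \<open>Q(\<bar>f\<bar> < c) = 0\<close> for some \<open>c > 0\<close>. Both families of operators are
  of this form: \<open>T - L\<^sub>q\<close> for \<open>f z = z - q\<close> and \<open>\<Delta>\<^sub>q(T)\<close> for \<open>f z = z\<^sup>2 - 2 Re(q) z + \<bar>q\<bar>\<^sup>2\<close>, which depends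
  only on the sphere of \<open>q\<close> and has norm \<open>\<bar>z - q\<bar> \<bar>z - qcnj q\<bar>\<close> on the half slice of \<open>q\<close>. There
  \<open>\<bar>z - q\<bar> \<le> \<bar>z - qcnj q\<bar>\<close>, so both integrands have the same zeros and one is bounded below iff the
  other one is, while \<open>z - q\<close> is bounded away from 0 if \<open>q\<close> lies outside the closed half slice.\<close>

section \<open>Quaternionic scalars and left multiplications\<close>

text \<open>The integrands take values in a noncommutative division ring. The calculus is still
  multiplicative, with the order of the factors kept, because every \<open>Q E\<close> commutes with
  every \<open>L q\<close>. Inverses are two-sided, and the convention \<open>inverse 0 = 0\<close>
  agrees with the prescribed value of the inverse of z - q at z = q. It makes pointwise inversion an
  involution that preserves zeros, so an integral and its inverse play symmetric roles. Operators
  are partial functions, so each identity between them contains an identity of domains. The graph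
  criterion handles domains without estimates, except for the spherical operators: their domain is
  that of the square of T, and it has to be recovered from the integrability of the polynomial. This
  is where \<open>norm z\<close> squared is estimated by the norm of the polynomial. The equation T
  u = u q involves right multiplication, whereas \<open>L q u\<close> is a left multiplication. The
  bridge between them is again the spherical operator: its real coefficients act alike from both
  sides, and q is a root of its own polynomial.\<close>

lemma scaleQ_zero_right [simp]: "(u::'h::quat_hilbert_space) *\<^sub>q 0 = 0"
  using scaleR_eq_scaleQ [of 0 u] by simp

lemma scaleQ_scaleR_left: "(r *\<^sub>R (x::'h::quat_hilbert_space)) *\<^sub>q q = r *\<^sub>R (x *\<^sub>q q)"
  unfolding scaleR_eq_scaleQ scaleQ_mult [symmetric]
  by (rule arg_cong [of _ _ "scaleQ x"]) (simp add: of_real_def quat_eq_iff)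

lemma scaleQ_minus_right: "(x::'h::quat_hilbert_space) *\<^sub>q (- q) = - (x *\<^sub>q q)"
  using scaleQ_add_right [of x q "- q"] by (simp add: eq_neg_iff_add_eq_0 add.commute)

lemma scaleQ_diff_right: "(x::'h::quat_hilbert_space) *\<^sub>q (p - q) = x *\<^sub>q p - x *\<^sub>q q"
  using scaleQ_add_right [of x p "- q"] by (simp add: scaleQ_minus_right)

lemma qinner_add_right: "qinner (u::'h::quat_hilbert_space) (v + w) = qinner u v + qinner u w"
  using qinner_linear [of u v 1 w 1] by (simp add: scaleQ_one)

lemma qinner_scaleQ_right: "qinner (u::'h::quat_hilbert_space) (v *\<^sub>q p) = qinner u v * p"
  using qinner_linear [of u v p v 0] by simp

lemma qcnj_mult: "qcnj (p * q) = qcnj q * qcnj p"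
  by (simp add: quat_eq_iff algebra_simps)

lemma qcnj_mult_self: "qcnj p * p = of_real ((norm p)\<^sup>2)"
  by (simp add: quat_eq_iff of_real_def power2_norm_eq_inner inner_quat_def)

lemma qRe_of_real [simp]: "qRe (of_real r) = r" "qI (of_real r) = 0" "qJ (of_real r) = 0" "qK (of_real r) = 0"
  by (simp_all add: of_real_def)

lemma qinner_scaleQ_left: "qinner ((u::'h::quat_hilbert_space) *\<^sub>q p) v = qcnj p * qinner u v"
  by (subst qinner_cnj) (simp add: qinner_scaleQ_right qcnj_mult flip: qinner_cnj)

text \<open>\<open>qinner u u\<close> is real and therefore commutes with \<open>p\<close>, so
  \<open>qcnj p * qinner u u * p\<close> collapses to a product of real numbers.\<close>

lemma norm_scaleQ: "norm ((u::'h::quat_hilbert_space) *\<^sub>q p) = norm u * norm p"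
proof -
  obtain r where r: "qinner u u = of_real r"
    using qinner_nonneg [of u] by (auto simp: nonneg_Reals_def)
  have "inner (u *\<^sub>q p) (u *\<^sub>q p) = inner u u * inner p p"
    by (simp add: inner_eq_qinner qinner_scaleQ_left qinner_scaleQ_right r inner_quat_def algebra_simps)
  then show ?thesis
    by (simp add: norm_eq_sqrt_inner real_sqrt_mult)
qed

lemma bounded_linear_scaleQ: "bounded_linear (\<lambda>u::'h::quat_hilbert_space. u *\<^sub>q p)"
  by (rule bounded_linear_intro [where K = "norm p"])
    (simp_all add: scaleQ_add_left scaleQ_scaleR_left norm_scaleQ)

lemma qinner_zero_right [simp]: "qinner (u::'h::quat_hilbert_space) 0 = 0"
  using linear_0 [OF bounded_linear.linear [OF qinner_bounded_linear]] .

text \<open>In the coordinates \<open>qinner z u\<close> the operator \<open>L q\<close> is left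
  multiplication by \<open>q\<close>, and the coordinates separate vectors. Identities between the
  operators \<open>L q\<close> thereby reduce to identities between quaternions.\<close>

lemma left_scalar_mult_basis:
  fixes L :: "quat \<Rightarrow> 'h::quat_hilbert_space \<Rightarrow> 'h"
  assumes "left_scalar_mult L"
  obtains N where
    "\<And>q u. ((\<lambda>z. z *\<^sub>q q *\<^sub>q qinner z u) has_sum L q u) N"
    "\<And>z q u. z \<in> N \<Longrightarrow> qinner z (L q u) = q * qinner z u"
    "\<And>u v. (\<And>z. z \<in> N \<Longrightarrow> qinner z u = qinner z v) \<Longrightarrow> u = v"
proof -
  obtain N where N: "hilbert_basis N"
    and sum: "\<And>q u. ((\<lambda>z. z *\<^sub>q q *\<^sub>q qinner z u) has_sum L q u) N"
    using assms(1) by (auto simp: left_scalar_mult_def)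
  have coord: "qinner z (L q u) = q * qinner z u" if "z \<in> N" for z q u
  proof -
    have "((qinner z \<circ> (\<lambda>z. z *\<^sub>q q *\<^sub>q qinner z u)) has_sum qinner z (L q u)) N"
      using has_sum_bounded_linear [OF qinner_bounded_linear sum] by (simp add: o_def)
    moreover have "((qinner z \<circ> (\<lambda>z. z *\<^sub>q q *\<^sub>q qinner z u)) has_sum q * qinner z u) N"
      by (rule has_sum_finite_neutralI [where B = "{z}"])
        (use that N in \<open>auto simp: hilbert_basis_def qinner_scaleQ_right\<close>)
    ultimately show ?thesis
      by (rule has_sum_unique)
  qed
  have sep: "u = v" if *: "\<And>z. z \<in> N \<Longrightarrow> qinner z u = qinner z v" for u v
  proof -
    \<comment> \<open>\<open>d\<close> is orthogonal to all finite combinations of basis vectors,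
      which are dense, and hence to itself.\<close>
    define d where "d = u - v"
    have "qinner z d = 0" if "z \<in> N" for z
      using linear_diff [OF bounded_linear.linear [OF qinner_bounded_linear], of z u v] * [OF that]
      by (simp add: d_def)
    then have "qinner d z = 0" if "z \<in> N" for z
      using that qinner_cnj [of d z] by (simp add: quat_eq_iff)
    then have "inner d (\<Sum>z\<in>F. z *\<^sub>q c z) = 0" if "F \<subseteq> N" for F c
      unfolding inner_sum_right using that
      by (auto simp: inner_eq_qinner qinner_scaleQ_right intro!: sum.neutral)
    then have "closure {\<Sum>z\<in>F. z *\<^sub>q c z | F c. finite F \<and> F \<subseteq> N} \<subseteq> {w. inner d w = 0}"
      by (intro closure_minimal closed_Collect_eq continuous_intros) auto
    then have "inner d d = 0"
      using N unfolding hilbert_basis_def by blast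
    then show ?thesis
      by (simp add: d_def)
  qed
  show ?thesis
    by (rule that [OF sum coord sep])
qed

lemma scaleR_quat_eq_mult: "r *\<^sub>R (x::quat) = of_real r * x"
  by (simp add: quat_eq_iff)

section \<open>Algebra of a left scalar multiplication\<close>

locale lsm =
  fixes L :: "quat \<Rightarrow> 'h::quat_hilbert_space \<Rightarrow> 'h"
  assumes lsm: "left_scalar_mult L"
begin

lemma L_bounded_qlinear: "bounded_qlinear (L q)"
  using lsm by (simp add: left_scalar_mult_def)

lemma L_bounded_linear: "bounded_linear (L q)"
  using L_bounded_qlinear by (simp add: bounded_qlinear_def)

lemmas L_add = linear_add [OF bounded_linear.linear [OF L_bounded_linear]]
lemmas L_zero [simp] = linear_0 [OF bounded_linear.linear [OF L_bounded_linear]]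
lemmas L_scaleR = linear_scale [OF bounded_linear.linear [OF L_bounded_linear]]
lemmas L_sum = linear_sum [OF bounded_linear.linear [OF L_bounded_linear]]

lemma L_scaleQ: "L q (u *\<^sub>q p) = L q u *\<^sub>q p"
  using L_bounded_qlinear by (simp add: bounded_qlinear_def)

lemma L_mult: "L (p * q) u = L p (L q u)"
proof -
  obtain N where N: "\<And>z q u. z \<in> N \<Longrightarrow> qinner z (L q u) = q * qinner z u"
    "\<And>u v. (\<And>z. z \<in> N \<Longrightarrow> qinner z u = qinner z v) \<Longrightarrow> u = v"
    by (rule left_scalar_mult_basis [OF lsm]) blast
  show ?thesis by (rule N(2)) (simp add: N(1) mult.assoc)
qed

lemma L_plus: "L (p + q) u = L p u + L q u"
proof -
  obtain N where N: "\<And>z q u. z \<in> N \<Longrightarrow> qinner z (L q u) = q * qinner z u"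
    "\<And>u v. (\<And>z. z \<in> N \<Longrightarrow> qinner z u = qinner z v) \<Longrightarrow> u = v"
    by (rule left_scalar_mult_basis [OF lsm]) blast
  show ?thesis by (rule N(2)) (simp add: N(1) qinner_add_right distrib_right)
qed

lemma L_of_real: "L (of_real r) u = r *\<^sub>R u"
proof -
  obtain N where N: "\<And>z q u. z \<in> N \<Longrightarrow> qinner z (L q u) = q * qinner z u"
    "\<And>u v. (\<And>z. z \<in> N \<Longrightarrow> qinner z u = qinner z v) \<Longrightarrow> u = v"
    by (rule left_scalar_mult_basis [OF lsm]) blast
  show ?thesis
    by (rule N(2)) (simp add: N(1) linear_scale [OF bounded_linear.linear [OF qinner_bounded_linear]]
      scaleR_quat_eq_mult)
qed

lemma L_0 [simp]: "L 0 u = 0" and L_1 [simp]: "L 1 u = u"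
  using L_of_real [of 0 u] L_of_real [of 1 u] by simp_all

lemma L_minus: "L (- q) u = - L q u"
  using L_plus [of q "- q" u] by (simp add: eq_neg_iff_add_eq_0 add.commute)

text \<open>The adjoint relation holds for each summand of the series defining \<open>L q u\<close>,
  and continuity of the inner product carries it over to the sum.\<close>

lemma inner_L_left: "inner (L q u) v = inner u (L (qcnj q) v)"
proof -
  obtain N where sum: "\<And>q u. ((\<lambda>z. z *\<^sub>q q *\<^sub>q qinner z u) has_sum L q u) N"
    by (rule left_scalar_mult_basis [OF lsm]) blast
  have eq: "inner (z *\<^sub>q q *\<^sub>q qinner z u) v = inner u (z *\<^sub>q qcnj q *\<^sub>q qinner z v)" for z
  proof -
    have "inner (z *\<^sub>q q *\<^sub>q qinner z u) v = qRe (qcnj (qinner z u) * (qcnj q * qinner z v))"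
      by (simp add: inner_eq_qinner qinner_scaleQ_left)
    also have "\<dots> = qRe (qinner u z * qcnj q * qinner z v)"
      by (simp only: qinner_cnj [symmetric] mult.assoc)
    also have "\<dots> = inner u (z *\<^sub>q qcnj q *\<^sub>q qinner z v)"
      by (simp add: inner_eq_qinner qinner_scaleQ_right)
    finally show ?thesis .
  qed
  have "((\<lambda>z. inner (z *\<^sub>q q *\<^sub>q qinner z u) v) has_sum inner (L q u) v) N"
    by (rule has_sum_bounded_linear [OF bounded_linear_inner_left sum])
  moreover have "((\<lambda>z. inner u (z *\<^sub>q qcnj q *\<^sub>q qinner z v)) has_sum inner u (L (qcnj q) v)) N"
    by (rule has_sum_bounded_linear [OF bounded_linear_inner_right sum])
  ultimately show ?thesis
    unfolding eq by (rule has_sum_unique)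
qed

lemma norm_L: "norm (L q u) = norm q * norm u"
proof -
  have "inner (L q u) (L q u) = (norm q)\<^sup>2 * inner u u"
    unfolding inner_L_left L_mult [symmetric] qcnj_mult_self L_of_real by simp
  then show ?thesis
    by (simp add: norm_eq_sqrt_inner real_sqrt_mult)
qed

end

section \<open>The projections \<open>Q E\<close> and their scalar measures\<close>

locale iqpvm = lsm L for L :: "quat \<Rightarrow> 'h::quat_hilbert_space \<Rightarrow> 'h" +
  fixes \<iota> :: quat and Q :: "quat set \<Rightarrow> 'h \<Rightarrow> 'h"
  assumes qpvm: "qPVM \<iota> Q"
    and Q_L_comp: "E \<in> sets (borel_slice \<iota>) \<Longrightarrow> Q E \<circ> L q = L q \<circ> Q E"
begin

abbreviation "M \<equiv> borel_slice \<iota>"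
abbreviation "C \<equiv> Cslice_pos \<iota>"

lemma space_M [simp]: "space M = C"
  by (simp add: borel_slice_def space_restrict_space)

lemma Q_L: "E \<in> sets M \<Longrightarrow> Q E (L q u) = L q (Q E u)"
  using Q_L_comp by (metis comp_apply)

lemma Q_bounded_qlinear: "E \<in> sets M \<Longrightarrow> bounded_qlinear (Q E)"
  using qpvm by (simp add: qPVM_def)

lemma Q_bounded_linear: "E \<in> sets M \<Longrightarrow> bounded_linear (Q E)"
  using Q_bounded_qlinear by (simp add: bounded_qlinear_def)

lemmas Q_add = linear_add [OF bounded_linear.linear [OF Q_bounded_linear]]
lemmas Q_diff = linear_diff [OF bounded_linear.linear [OF Q_bounded_linear]]
lemmas Q_zero [simp] = linear_0 [OF bounded_linear.linear [OF Q_bounded_linear]]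
lemmas Q_sum = linear_sum [OF bounded_linear.linear [OF Q_bounded_linear]]
lemmas Q_scaleR = linear_scale [OF bounded_linear.linear [OF Q_bounded_linear]]

lemma Q_scaleQ: "E \<in> sets M \<Longrightarrow> Q E (u *\<^sub>q p) = Q E u *\<^sub>q p"
  using Q_bounded_qlinear by (simp add: bounded_qlinear_def)

lemma Q_space [simp]: "Q C u = u"
  using qpvm by (simp add: qPVM_def)

lemma Q_Int: "E \<in> sets M \<Longrightarrow> F \<in> sets M \<Longrightarrow> Q E (Q F u) = Q (E \<inter> F) u"
  using qpvm unfolding qPVM_def by (metis comp_apply)

lemma Q_sums: "range E \<subseteq> sets M \<Longrightarrow> disjoint_family E \<Longrightarrow> (\<lambda>n. Q (E n) u) sums Q (\<Union>n. E n) u"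
  for E :: "nat \<Rightarrow> quat set"
  using qpvm by (simp add: qPVM_def)

lemma space_in_sets [simp]: "C \<in> sets M"
  using sets.top [of M] by simp

lemma sets_subset: "E \<in> sets M \<Longrightarrow> E \<subseteq> C"
  using sets.sets_into_space [of E M] by simp

text \<open>The constant sequence of empty sets is disjoint, so a series with constant term
  \<open>Q {} u\<close> converges, which forces the term to be 0.\<close>

lemma Q_empty [simp]: "Q {} u = 0"
proof -
  have "(\<lambda>n::nat. Q {} u) sums Q (\<Union>n::nat. {}) u"
    by (rule Q_sums) (auto simp: disjoint_family_on_def)
  then show ?thesis
    using summable_const_iff sums_summable by blast
qed

lemma Q_Un:
  assumes "A \<in> sets M" "B \<in> sets M" "A \<inter> B = {}"
  shows "Q (A \<union> B) u = Q A u + Q B u"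
proof -
  have "(\<lambda>n. Q (binaryset A B n) u) sums Q (\<Union>n. binaryset A B n) u"
    using assms by (intro Q_sums) (auto simp: range_binaryset_eq disjoint_family_on_def binaryset_def)
  moreover have "(\<lambda>n. Q (binaryset A B n) u) sums (Q A u + Q B u)"
    by (rule binaryset_sums) simp
  ultimately show ?thesis
    by (simp add: sums_unique2 UN_binaryset_eq)
qed

lemma Q_UN:
  assumes "finite I" "\<And>i. i \<in> I \<Longrightarrow> A i \<in> sets M" "disjoint_family_on A I"
  shows "Q (\<Union>i\<in>I. A i) u = (\<Sum>i\<in>I. Q (A i) u)"
  using assms
proof (induction I)
  case (insert i I)
  have "Q (\<Union>i\<in>insert i I. A i) u = Q (A i) u + Q (\<Union>i\<in>I. A i) u"
    unfolding UN_insert using insert.prems insert.hyps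
    by (intro Q_Un) (auto simp: disjoint_family_on_def)
  then show ?case
    using insert by (simp add: disjoint_family_on_insert)
qed simp

lemma Q_Diff: "A \<in> sets M \<Longrightarrow> B \<in> sets M \<Longrightarrow> B \<subseteq> A \<Longrightarrow> Q (A - B) u = Q A u - Q B u"
  using Q_Un [of "A - B" B u] by (simp add: Un_absorb2 Int_commute [of _ B])

text \<open>Positivity makes \<open>qinner u (Q E v) - qinner (Q E u) v\<close> real for all \<open>u\<close> and \<open>v\<close>; replacing
  \<open>v\<close> by \<open>v *\<^sub>q i\<close> shows that its real part vanishes.\<close>

lemma inner_Q_left:
  assumes E: "E \<in> sets M"
  shows "inner (Q E u) v = inner u (Q E v)"
proof -
  have real: "qcnj (qinner u (Q E u)) = qinner u (Q E u)" for u
    using qpvm E by (auto simp: qPVM_def nonneg_Reals_def quat_eq_iff)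
  have add_left: "qinner (u + w) v = qinner u v + qinner w v" for u v w :: 'h
    using qinner_cnj [of "u + w" v] qinner_cnj [of u v] qinner_cnj [of w v]
    by (simp add: qinner_add_right quat_eq_iff)
  define d where "d u v = qinner u (Q E v) - qinner (Q E u) v" for u v
  have d: "qcnj (d u v) = d u v" for u v
    using real [of "u + v"] real [of u] real [of v]
      qinner_cnj [of "Q E u" v] qinner_cnj [of "Q E v" u]
    by (simp add: d_def Q_add [OF E] add_left qinner_add_right quat_eq_iff)
  have "d u (v *\<^sub>q Quat 0 1 0 0) = d u v * Quat 0 1 0 0"
    by (simp add: d_def Q_scaleQ [OF E] qinner_scaleQ_right left_diff_distrib)
  with d [of u v] d [of u "v *\<^sub>q Quat 0 1 0 0"] have "qRe (d u v) = 0"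
    by (simp add: quat_eq_iff)
  then show ?thesis
    by (simp add: d_def inner_eq_qinner)
qed

lemma inner_Q_self: "E \<in> sets M \<Longrightarrow> inner u (Q E u) = (norm (Q E u))\<^sup>2"
  by (metis Int_absorb Q_Int inner_Q_left power2_norm_eq_inner)

lemma inner_Q_disjoint:
  "A \<in> sets M \<Longrightarrow> B \<in> sets M \<Longrightarrow> A \<inter> B = {} \<Longrightarrow> inner (Q A u) (Q B v) = 0"
  by (simp add: inner_Q_left Q_Int)

abbreviation "\<mu> u \<equiv> spectral_measure \<iota> Q u"

lemma space_mu [simp]: "space (\<mu> u) = C" and sets_mu [simp, measurable_cong]: "sets (\<mu> u) = sets M"
  using sets.space_closed [of M] sets.sets_measure_of_eq [of M]
  by (auto simp: spectral_measure_def space_measure_of_conv)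

text \<open>\<open>measure_of\<close> takes the intended values only once countable additivity is
  known; here it comes from the strong additivity of \<open>Q\<close>, paired with \<open>u\<close>.
  The values are squared norms because \<open>Q E\<close> is a symmetric idempotent.\<close>

lemma emeasure_mu:
  assumes "E \<in> sets M"
  shows "emeasure (\<mu> u) E = ennreal ((norm (Q E u))\<^sup>2)"
proof -
  have "countably_additive (sets M) (\<lambda>E. ennreal (qRe (qinner u (Q E u))))"
  proof (rule countably_additiveI)
    fix A :: "nat \<Rightarrow> quat set"
    assume A: "range A \<subseteq> sets M" "disjoint_family A" "(\<Union>i. A i) \<in> sets M"
    have "(\<lambda>n. inner u (Q (A n) u)) sums inner u (Q (\<Union>n. A n) u)"
      by (intro bounded_linear.sums [OF bounded_linear_inner_right] Q_sums A)
    then show "(\<Sum>i. ennreal (qRe (qinner u (Q (A i) u)))) = ennreal (qRe (qinner u (Q (\<Union>i. A i) u)))"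
      using A by (intro suminf_ennreal_eq) (auto simp: inner_Q_self range_subsetD simp flip: inner_eq_qinner)
  qed
  then have "emeasure (\<mu> u) E = ennreal (qRe (qinner u (Q E u)))"
    unfolding spectral_measure_def using assms sets.sigma_algebra_axioms [of M]
    by (intro emeasure_measure_of_sigma) (auto simp: positive_def)
  then show ?thesis
    using assms by (simp add: inner_Q_self flip: inner_eq_qinner)
qed

lemma measure_mu: "E \<in> sets M \<Longrightarrow> measure (\<mu> u) E = (norm (Q E u))\<^sup>2"
  by (simp add: measure_def emeasure_mu)

lemma finite_mu: "finite_measure (\<mu> u)"
  by (intro finite_measureI) (simp add: emeasure_mu)

text \<open>Pythagoras for the orthogonal vectors \<open>Q B u\<close> and
  \<open>Q (A - B) u\<close>, read off from the additivity of \<open>\<mu> u\<close>.\<close>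

lemma norm_Q_Diff:
  assumes "A \<in> sets M" "B \<in> sets M" "B \<subseteq> A"
  shows "(norm (Q A u - Q B u))\<^sup>2 = (norm (Q A u))\<^sup>2 - (norm (Q B u))\<^sup>2"
  using finite_measure.finite_measure_Diff [OF finite_mu, of A u B] assms
  by (simp add: measure_mu Q_Diff)

lemma norm_Q_mono: "A \<in> sets M \<Longrightarrow> B \<in> sets M \<Longrightarrow> B \<subseteq> A \<Longrightarrow> norm (Q B u) \<le> norm (Q A u)"
  by (rule power2_le_imp_le) (use norm_Q_Diff [of A B u] zero_le_power2 [of "norm (Q A u - Q B u)"] in simp_all)

lemma norm_Q_le: "E \<in> sets M \<Longrightarrow> norm (Q E u) \<le> norm u"
  using norm_Q_mono [of C E u] sets_subset by simp

text \<open>Continuity from below of \<open>\<mu> u\<close> gives convergence of the squared norms,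
  and \<open>norm_Q_Diff\<close> turns this into convergence of the vectors.\<close>

lemma Q_incseq:
  assumes A: "range A \<subseteq> sets M" "incseq A"
  shows "(\<lambda>n. Q (A n) u) \<longlonglongrightarrow> Q (\<Union>n. A n) u"
proof -
  have m: "A n \<in> sets M" "(\<Union>n. A n) \<in> sets M" for n
    using A(1) by auto
  have "(\<lambda>n. measure (\<mu> u) (A n)) \<longlonglongrightarrow> measure (\<mu> u) (\<Union>n. A n)"
    using A by (intro finite_measure.finite_Lim_measure_incseq finite_mu) auto
  then have "(\<lambda>n. (norm (Q (A n) u))\<^sup>2) \<longlonglongrightarrow> (norm (Q (\<Union>n. A n) u))\<^sup>2"
    by (simp only: measure_mu m)
  from tendsto_diff [OF tendsto_const this, of "(norm (Q (\<Union>n. A n) u))\<^sup>2"]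
  have "(\<lambda>n. (norm (Q (\<Union>n. A n) u))\<^sup>2 - (norm (Q (A n) u))\<^sup>2) \<longlonglongrightarrow> 0"
    by simp
  moreover have "(norm (Q (\<Union>n. A n) u))\<^sup>2 - (norm (Q (A n) u))\<^sup>2 = (norm (Q (A n) u - Q (\<Union>n. A n) u))\<^sup>2" for n
    using m by (subst norm_minus_commute, subst norm_Q_Diff) auto
  ultimately have "(\<lambda>n. (norm (Q (A n) u - Q (\<Union>n. A n) u))\<^sup>2) \<longlonglongrightarrow> 0"
    by simp
  then have "(\<lambda>n. norm (Q (A n) u - Q (\<Union>n. A n) u)) \<longlonglongrightarrow> 0"
    by simp
  then show ?thesis
    by (simp add: tendsto_norm_zero_iff LIM_zero_iff)
qed

lemma Q_exhaust:
  "range A \<subseteq> sets M \<Longrightarrow> incseq A \<Longrightarrow> (\<Union>n. A n) = C \<Longrightarrow> (\<lambda>n. Q (A n) u) \<longlonglongrightarrow> u"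
  using Q_incseq [of A u] by (metis Q_space)

end

section \<open>Integrals of simple functions\<close>

lemma abs_qcomp_le_norm: "\<bar>qRe x\<bar> \<le> norm x" "\<bar>qI x\<bar> \<le> norm x" "\<bar>qJ x\<bar> \<le> norm x" "\<bar>qK x\<bar> \<le> norm x"
  by (auto simp: norm_quat_def inner_quat_def power2_eq_square intro!: real_le_rsqrt)

lemma quat_expand: "x = qRe x *\<^sub>R 1 + qI x *\<^sub>R Quat 0 1 0 0 + qJ x *\<^sub>R Quat 0 0 1 0 + qK x *\<^sub>R Quat 0 0 0 1"
  by (simp add: quat_eq_iff)

lemma norm_quat_le: "norm (x::quat) \<le> \<bar>qRe x\<bar> + \<bar>qI x\<bar> + \<bar>qJ x\<bar> + \<bar>qK x\<bar>"
proof -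
  have "norm x = norm (qRe x *\<^sub>R (1::quat) + qI x *\<^sub>R Quat 0 1 0 0 + qJ x *\<^sub>R Quat 0 0 1 0 + qK x *\<^sub>R Quat 0 0 0 1)"
    by (simp only: quat_expand [symmetric])
  also have "\<dots> \<le> norm (qRe x *\<^sub>R (1::quat)) + norm (qI x *\<^sub>R Quat 0 1 0 0) + norm (qJ x *\<^sub>R Quat 0 0 1 0)
    + norm (qK x *\<^sub>R Quat 0 0 0 1)"
    by (intro order.trans [OF norm_triangle_ineq] add_mono order_refl)
  also have "\<dots> = \<bar>qRe x\<bar> + \<bar>qI x\<bar> + \<bar>qJ x\<bar> + \<bar>qK x\<bar>"
    by (simp add: norm_quat_def inner_quat_def)
  finally show ?thesis .
qed

lemma borel_measurable_qcomp [measurable]: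
  "qRe \<in> borel_measurable borel" "qI \<in> borel_measurable borel"
  "qJ \<in> borel_measurable borel" "qK \<in> borel_measurable borel"
proof -
  have "(\<lambda>x. inner x (Quat a b c d)) \<in> borel_measurable borel" for a b c d
    by (intro borel_measurable_continuous_onI continuous_intros)
  from this [of 1 0 0 0] this [of 0 1 0 0] this [of 0 0 1 0] this [of 0 0 0 1]
  show "qRe \<in> borel_measurable borel" "qI \<in> borel_measurable borel"
    "qJ \<in> borel_measurable borel" "qK \<in> borel_measurable borel"
    by (simp_all add: inner_quat_def)
qed

lemma borel_measurable_Quat [measurable]:
  assumes [measurable]: "a \<in> borel_measurable M" "b \<in> borel_measurable M" "c \<in> borel_measurable M" "d \<in> borel_measurable M"
  shows "(\<lambda>x. Quat (a x) (b x) (c x) (d x)) \<in> borel_measurable M"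
  by (subst quat_expand) simp

text \<open>Each of the four real coordinates is rounded down to a multiple of 1/(n+1), and the norm
  is at most the sum of the four errors. Boundedness of \<open>\<phi>\<close> leaves finitely many
  rounded values. The explicit rate also yields a bound that is common to all approximants.\<close>

lemma uniform_simple_approximation:
  fixes \<phi> :: "'a \<Rightarrow> quat"
  assumes [measurable]: "\<phi> \<in> borel_measurable M" and bdd: "bounded (\<phi> ` space M)"
  obtains s where "\<And>n. simple_function M (s n)" "\<And>n z. norm (s n z - \<phi> z) \<le> 4 / Suc n"
proof
  define r where "r n x = real_of_int \<lfloor>Suc n * x\<rfloor> / Suc n" for n and x :: real
  define s where "s n z = Quat (r n (qRe (\<phi> z))) (r n (qI (\<phi> z))) (r n (qJ (\<phi> z))) (r n (qK (\<phi> z)))" for n z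
  have r: "\<bar>r n x - x\<bar> \<le> 1 / Suc n" for n x
  proof -
    have "\<bar>r n x - x\<bar> = \<bar>\<lfloor>Suc n * x\<rfloor> - Suc n * x\<bar> / Suc n"
      by (simp add: r_def field_simps flip: abs_divide)
    also have "\<dots> \<le> 1 / Suc n"
      by (intro divide_right_mono) linarith+
    finally show ?thesis .
  qed
  show "norm (s n z - \<phi> z) \<le> 4 / Suc n" for n z
    using norm_quat_le [of "s n z - \<phi> z"] r [of n "qRe (\<phi> z)"] r [of n "qI (\<phi> z)"]
      r [of n "qJ (\<phi> z)"] r [of n "qK (\<phi> z)"]
    by (simp add: s_def)
  obtain B where B: "\<And>z. z \<in> space M \<Longrightarrow> norm (\<phi> z) \<le> B"
    using bdd by (auto simp: bounded_iff)
  show "simple_function M (s n)" for n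
  proof (rule simple_function_borel_measurable)
    show "s n \<in> borel_measurable M"
      unfolding s_def r_def by (intro borel_measurable_Quat) measurable
    define F where "F = (\<lambda>i::int. of_int i / real (Suc n)) ` {\<lfloor>- (Suc n * B)\<rfloor>..\<lfloor>Suc n * B\<rfloor>}"
    have F: "r n x \<in> F" if "\<bar>x\<bar> \<le> B" for x
    proof -
      have "- (Suc n * B) \<le> Suc n * x" "Suc n * x \<le> Suc n * B"
        using that mult_left_mono [of x B "Suc n"] mult_left_mono [of "- B" x "Suc n"] by auto
      then have "\<lfloor>Suc n * x\<rfloor> \<in> {\<lfloor>- (Suc n * B)\<rfloor>..\<lfloor>Suc n * B\<rfloor>}"
        unfolding atLeastAtMost_iff by (intro conjI floor_mono)
      then show ?thesis
        unfolding r_def F_def by (rule imageI)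
    qed
    have "s n ` space M \<subseteq> (\<lambda>(a, b, c, d). Quat a b c d) ` (F \<times> F \<times> F \<times> F)"
    proof
      fix y assume "y \<in> s n ` space M"
      then obtain z where z: "z \<in> space M" "y = s n z" by auto
      have "r n (qRe (\<phi> z)) \<in> F" "r n (qI (\<phi> z)) \<in> F" "r n (qJ (\<phi> z)) \<in> F" "r n (qK (\<phi> z)) \<in> F"
        using abs_qcomp_le_norm [of "\<phi> z"] B [OF z(1)] by (auto intro!: F)
      then show "y \<in> (\<lambda>(a, b, c, d). Quat a b c d) ` (F \<times> F \<times> F \<times> F)"
        unfolding z(2) s_def by force
    qed
    then show "finite (s n ` space M)"
      by (rule finite_subset) (simp add: F_def)
  qed
qed

lemma bounded_qlinear_sum:
  fixes A :: "'i \<Rightarrow> 'h::quat_hilbert_space \<Rightarrow> 'h"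
  assumes "\<And>i. i \<in> I \<Longrightarrow> bounded_qlinear (A i)"
  shows "bounded_qlinear (\<lambda>u. \<Sum>i\<in>I. A i u)"
  using assms unfolding bounded_qlinear_def
  by (auto intro!: bounded_linear_sum sum.cong
      simp: linear_sum [OF bounded_linear.linear [OF bounded_linear_scaleQ]])

context iqpvm
begin

abbreviation "SI \<equiv> simple_qint \<iota> Q L"

lemma simple_function_level [measurable]:
  assumes "simple_function M h"
  shows "{z\<in>C. h z = y} \<in> sets M"
proof (cases "y \<in> h ` C")
  case True
  moreover have "h -` {y} \<inter> C = {z\<in>C. h z = y}" by auto
  ultimately show ?thesis
    using assms by (auto simp: simple_function_def)
next
  case False
  then have "{z\<in>C. h z = y} = {}" by auto
  then show ?thesis by (simp only: sets.empty_sets)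
qed

lemma simple_function_finite: "simple_function M h \<Longrightarrow> finite (h ` C)"
  by (auto simp: simple_function_def)

text \<open>The sum may be indexed by the values of any simple function through which the integrand
  factors. Taking pairs \<open>(s z, t z)\<close> for \<open>h\<close> puts two integrands on a
  common partition, which is how sums and products are treated.\<close>

lemma simple_qint_compose:
  assumes h: "simple_function M h"
  shows "SI (\<lambda>z. g (h z)) u = (\<Sum>y\<in>h ` C. L (g y) (Q {z\<in>C. h z = y} u))"
proof -
  note fin = simple_function_finite [OF h]
  have "(\<Sum>y\<in>h ` C. L (g y) (Q {z\<in>C. h z = y} u)) =
    (\<Sum>c\<in>g ` h ` C. \<Sum>y\<in>{y \<in> h ` C. g y = c}. L (g y) (Q {z\<in>C. h z = y} u))"
    by (rule sum.image_gen [OF fin])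
  also have "\<dots> = (\<Sum>c\<in>g ` h ` C. L c (Q {z\<in>C. g (h z) = c} u))"
  proof (rule sum.cong [OF refl])
    fix c
    have "{z\<in>C. g (h z) = c} = (\<Union>y\<in>{y \<in> h ` C. g y = c}. {z\<in>C. h z = y})"
      by auto
    moreover have "Q (\<Union>y\<in>{y \<in> h ` C. g y = c}. {z\<in>C. h z = y}) u =
        (\<Sum>y\<in>{y \<in> h ` C. g y = c}. Q {z\<in>C. h z = y} u)"
      using fin h by (intro Q_UN) (auto simp: disjoint_family_on_def simple_function_level)
    ultimately show "(\<Sum>y\<in>{y \<in> h ` C. g y = c}. L (g y) (Q {z\<in>C. h z = y} u)) = L c (Q {z\<in>C. g (h z) = c} u)"
      by (simp add: L_sum)
  qed
  finally show ?thesis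
    by (simp add: simple_qint_def image_image)
qed

lemma simple_qint_bounded_qlinear:
  assumes "simple_function M s"
  shows "bounded_qlinear (SI s)"
proof -
  have "bounded_qlinear (\<lambda>u. L c (Q {z\<in>C. s z = c} u))" for c
    using bounded_linear_compose [OF L_bounded_linear Q_bounded_linear [OF simple_function_level [OF assms]]]
    by (simp add: bounded_qlinear_def Q_scaleQ L_scaleQ simple_function_level [OF assms])
  then show ?thesis
    using bounded_qlinear_sum [of "s ` C" "\<lambda>c u. L c (Q {z\<in>C. s z = c} u)"]
    by (simp add: simple_qint_def [abs_def])
qed

lemma simple_qint_add:
  assumes "simple_function M s" "simple_function M t"
  shows "SI (\<lambda>z. s z + t z) u = SI s u + SI t u"
proof -
  let ?h = "\<lambda>z. (s z, t z)"
  have h: "simple_function M ?h" using assms by (rule simple_function_Pair)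
  show ?thesis
    using simple_qint_compose [OF h, of "\<lambda>y. fst y + snd y" u]
      simple_qint_compose [OF h, of fst u] simple_qint_compose [OF h, of snd u]
    by (simp add: L_plus sum.distrib)
qed

lemma simple_qint_minus:
  assumes "simple_function M s"
  shows "SI (\<lambda>z. - s z) u = - SI s u"
  using simple_qint_compose [OF assms, of uminus u] simple_qint_compose [OF assms, of id u]
  by (simp add: L_minus sum_negf)

lemma simple_qint_diff:
  assumes "simple_function M s" "simple_function M t"
  shows "SI (\<lambda>z. s z - t z) u = SI s u - SI t u"
  using simple_qint_add [OF assms(1), of "\<lambda>z. - t z" u] simple_qint_minus [OF assms(2), of u]
    simple_function_compose1 [OF assms(2), of uminus]
  by simp

text \<open>On the common partition, projections of different cells annihilate each other, and each
  of them can be moved past \<open>L (snd y)\<close>. The coefficients then meet in the order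
  \<open>L (fst y) (L (snd y) _)\<close>, so the order of the factors is kept.\<close>

lemma simple_qint_mult:
  assumes "simple_function M s" "simple_function M t"
  shows "SI (\<lambda>z. s z * t z) u = SI s (SI t u)"
proof -
  let ?h = "\<lambda>z. (s z, t z)" and ?A = "\<lambda>y. {z\<in>C. (s z, t z) = y}"
  have h: "simple_function M ?h" using assms by (rule simple_function_Pair)
  note A = simple_function_level [OF h]
  have disj: "Q (?A y) (Q (?A y') u) = (if y' = y then Q (?A y) u else 0)" for y y'
  proof -
    have "?A y \<inter> ?A y' = (if y' = y then ?A y else {})" by auto
    then show ?thesis using A by (simp add: Q_Int)
  qed
  have "SI s (SI t u) = (\<Sum>y\<in>?h ` C. L (fst y) (Q (?A y) (\<Sum>y'\<in>?h ` C. L (snd y') (Q (?A y') u))))"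
    using simple_qint_compose [OF h, of fst] simple_qint_compose [OF h, of snd] by simp
  also have "\<dots> = (\<Sum>y\<in>?h ` C. L (fst y) (\<Sum>y'\<in>?h ` C. L (snd y') (Q (?A y) (Q (?A y') u))))"
    using A by (simp add: Q_sum Q_L)
  also have "\<dots> = (\<Sum>y\<in>?h ` C. L (fst y) (L (snd y) (Q (?A y) u)))"
  proof (rule sum.cong [OF refl])
    fix y assume y: "y \<in> ?h ` C"
    have "(\<Sum>y'\<in>?h ` C. L (snd y') (Q (?A y) (Q (?A y') u))) =
        (\<Sum>y'\<in>?h ` C. if y' = y then L (snd y) (Q (?A y) u) else 0)"
      by (intro sum.cong refl) (simp only: disj, simp)
    then show "L (fst y) (\<Sum>y'\<in>?h ` C. L (snd y') (Q (?A y) (Q (?A y') u))) = L (fst y) (L (snd y) (Q (?A y) u))"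
      using y simple_function_finite [OF h] by simp
  qed
  also have "\<dots> = SI (\<lambda>z. s z * t z) u"
    using simple_qint_compose [OF h, of "\<lambda>y. fst y * snd y" u] by (simp add: L_mult)
  finally show ?thesis by simp
qed

lemma simple_qint_indicator:
  assumes "E \<in> sets M"
  shows "SI (\<lambda>z. if z \<in> E then c else 0) u = L c (Q E u)"
proof -
  have "simple_function M (\<lambda>z. z \<in> E)"
    unfolding simple_function_def
  proof (intro conjI ballI)
    show "finite ((\<lambda>z. z \<in> E) ` space M)"
      by (rule finite_subset [of _ UNIV]) auto
    fix b
    have "(\<lambda>z. z \<in> E) -` {b} \<inter> space M = (if b then E else C - E)"
      using sets_subset [OF assms] by auto
    then show "(\<lambda>z. z \<in> E) -` {b} \<inter> space M \<in> sets M"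
      using assms by (simp add: sets.Diff)
  qed
  from simple_qint_compose [OF this, of "\<lambda>b. if b then c else 0" u]
  have "SI (\<lambda>z. if z \<in> E then c else 0) u = (\<Sum>b\<in>(\<lambda>z. z \<in> E) ` C. if b then L c (Q {z\<in>C. z \<in> E} u) else 0)"
    by (auto intro!: sum.cong)
  also have "\<dots> = L c (Q E u)"
  \<comment> \<open>\<open>True\<close> is a value of the indicator only if \<open>E\<close> is
    non-empty.\<close>
  proof (cases "E = {}")
    case True
    then show ?thesis by (auto intro!: sum.neutral)
  next
    case False
    then have "True \<in> (\<lambda>z. z \<in> E) ` C" using sets_subset [OF assms] by auto
    moreover have "{z\<in>C. z \<in> E} = E" using sets_subset [OF assms] by auto
    moreover have "finite ((\<lambda>z. z \<in> E) ` C)" by (rule finite_subset [of _ UNIV]) auto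
    ultimately show ?thesis
      using sum.delta [of "(\<lambda>z. z \<in> E) ` C" True "\<lambda>_. L c (Q E u)"]
      by (simp cong: if_cong)
  qed
  finally show ?thesis .
qed

text \<open>The summands are pairwise orthogonal: the adjoint relation moves both coefficients to
  one side, where they commute with the projections of disjoint cells.\<close>

lemma norm_simple_qint:
  assumes s: "simple_function M s"
  shows "(norm (SI s u))\<^sup>2 = (\<Sum>c\<in>s ` C. (norm c)\<^sup>2 * (norm (Q {z\<in>C. s z = c} u))\<^sup>2)"
proof -
  have "pairwise (\<lambda>c d. orthogonal (L c (Q {z\<in>C. s z = c} u)) (L d (Q {z\<in>C. s z = d} u))) (s ` C)"
    using simple_function_level [OF s]
    by (auto simp: pairwise_def orthogonal_def inner_L_left simp flip: Q_L L_mult intro!: inner_Q_disjoint)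
  then show ?thesis
    by (simp add: simple_qint_def norm_sum_Pythagorean simple_function_finite [OF s] norm_L power_mult_distrib)
qed

text \<open>This isometry is the origin of the square integrability in the domain of
  \<open>qint\<close>, and it converts pointwise bounds on integrands into operator bounds.\<close>

lemma simple_qint_isometry:
  assumes s: "simple_function M s"
  shows "ennreal ((norm (SI s u))\<^sup>2) = (\<integral>\<^sup>+ z. ennreal ((norm (s z))\<^sup>2) \<partial>\<mu> u)"
proof -
  note A = simple_function_level [OF s] and fin = simple_function_finite [OF s]
  have "(\<integral>\<^sup>+ z. ennreal ((norm (s z))\<^sup>2) \<partial>\<mu> u) =
    (\<integral>\<^sup>+ z. (\<Sum>c\<in>s ` C. ennreal ((norm c)\<^sup>2) * indicator {z\<in>C. s z = c} z) \<partial>\<mu> u)"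
  proof (rule nn_integral_cong)
    fix z assume "z \<in> space (\<mu> u)"
    then have "(\<Sum>c\<in>s ` C. ennreal ((norm c)\<^sup>2) * indicator {z\<in>C. s z = c} z) =
      (\<Sum>c\<in>s ` C. if c = s z then ennreal ((norm (s z))\<^sup>2) else 0)"
      by (auto intro!: sum.cong simp: indicator_def)
    then show "ennreal ((norm (s z))\<^sup>2) = (\<Sum>c\<in>s ` C. ennreal ((norm c)\<^sup>2) * indicator {z\<in>C. s z = c} z)"
      using \<open>z \<in> space (\<mu> u)\<close> fin by simp
  qed
  also have "\<dots> = (\<Sum>c\<in>s ` C. ennreal ((norm c)\<^sup>2) * ennreal ((norm (Q {z\<in>C. s z = c} u))\<^sup>2))"
    using A by (subst nn_integral_sum) (auto simp: nn_integral_cmult_indicator emeasure_mu)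
  also have "\<dots> = ennreal ((norm (SI s u))\<^sup>2)"
    unfolding norm_simple_qint [OF s] by (simp add: sum_ennreal flip: ennreal_mult)
  finally show ?thesis by simp
qed

lemma norm_simple_qint_le:
  assumes s: "simple_function M s" and K: "\<And>z. z \<in> C \<Longrightarrow> norm (s z) \<le> K" "0 \<le> K"
  shows "norm (SI s u) \<le> K * norm u"
proof -
  have "ennreal ((norm (SI s u))\<^sup>2) \<le> (\<integral>\<^sup>+ z. ennreal (K\<^sup>2) \<partial>\<mu> u)"
    unfolding simple_qint_isometry [OF s] using K by (intro nn_integral_mono) (auto intro!: power_mono ennreal_leI)
  also have "\<dots> = ennreal ((K * norm u)\<^sup>2)"
    using emeasure_mu [of C u] by (simp add: ennreal_mult power_mult_distrib)
  finally show ?thesis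
    using K(2) by (simp add: power2_le_iff_abs_le)
qed

end

section \<open>The bounded functional calculus\<close>

text \<open>Turns estimates relative to \<open>norm u\<close> into absolute ones. Adding 1 to the
  divisor covers the case \<open>a = 0\<close>.\<close>

lemma ex_mult_less:
  fixes e a :: real
  assumes "e > 0"
  shows "\<exists>d>0. d * a < e"
proof (intro exI conjI)
  have pos: "0 < \<bar>a\<bar> + 1" by simp
  show "e / (\<bar>a\<bar> + 1) > 0" using assms pos by (rule divide_pos_pos)
  have "e * a \<le> e * \<bar>a\<bar>" using assms by simp
  also have "\<dots> < e * (\<bar>a\<bar> + 1)" using assms by (simp add: distrib_left)
  finally show "e / (\<bar>a\<bar> + 1) * a < e"
    using pos by (simp add: pos_divide_less_eq)
qed

context iqpvm
begin

abbreviation "\<Phi> \<equiv> bounded_qint \<iota> Q L"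

definition approximates :: "(nat \<Rightarrow> quat \<Rightarrow> quat) \<Rightarrow> (quat \<Rightarrow> quat) \<Rightarrow> bool" where
  "approximates s \<phi> \<longleftrightarrow> (\<forall>n. simple_function M (s n)) \<and> uniform_limit C s \<phi> sequentially"

definition bounded_borel :: "(quat \<Rightarrow> quat) \<Rightarrow> bool" where
  "bounded_borel \<phi> \<longleftrightarrow> \<phi> \<in> borel_measurable M \<and> bounded (\<phi> ` C)"

lemma approximatesD: "approximates s \<phi> \<Longrightarrow> simple_function M (s n)"
  by (simp add: approximates_def)

lemma ex_approximates:
  assumes "bounded_borel \<phi>"
  obtains s where "approximates s \<phi>" "\<And>n z. norm (s n z - \<phi> z) \<le> 4 / Suc n"
proof -
  obtain s where s: "\<And>n. simple_function M (s n)" "\<And>n z. norm (s n z - \<phi> z) \<le> 4 / Suc n"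
    using uniform_simple_approximation [of \<phi> M] assms by (auto simp: bounded_borel_def)
  have "(\<lambda>n. 4 / real (Suc n)) \<longlonglongrightarrow> 0"
    by (rule LIMSEQ_Suc [OF lim_const_over_n])
  then have "uniform_limit C s \<phi> sequentially"
    using s(2) unfolding uniform_limit_iff
    by (auto dest!: order_tendstoD(2) elim!: eventually_mono simp: dist_norm intro: le_less_trans)
  then show ?thesis
    by (intro that [OF _ s(2)]) (simp add: approximates_def s(1))
qed

text \<open>Two sequences are compared at once: with \<open>s = t\<close> the estimate shows that
  the integrals are Cauchy, and with different sequences it shows that the limit does not depend on
  the choice.\<close>

lemma approximates_close:
  assumes s: "approximates s \<phi>" and t: "approximates t \<phi>" and "e > 0"
  obtains k where "\<And>m n u. m \<ge> k \<Longrightarrow> n \<ge> k \<Longrightarrow> norm (SI (s m) u - SI (t n) u) \<le> e * norm u"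
proof -
  have "\<forall>\<^sub>F n in sequentially. (\<forall>z\<in>C. dist (s n z) (\<phi> z) < e / 2) \<and> (\<forall>z\<in>C. dist (t n z) (\<phi> z) < e / 2)"
    using s t \<open>e > 0\<close> by (intro eventually_conj uniform_limitD) (auto simp: approximates_def)
  then obtain k where k: "\<And>n z. n \<ge> k \<Longrightarrow> z \<in> C \<Longrightarrow> dist (s n z) (\<phi> z) < e / 2 \<and> dist (t n z) (\<phi> z) < e / 2"
    by (auto simp: eventually_sequentially)
  have "norm (SI (s m) u - SI (t n) u) \<le> e * norm u" if "m \<ge> k" "n \<ge> k" for m n u
  proof -
    have "norm (s m z - t n z) \<le> e" if "z \<in> C" for z
      using k [OF \<open>m \<ge> k\<close> that] k [OF \<open>n \<ge> k\<close> that] dist_triangle_half_l [of "s m z" "\<phi> z" e "t n z"]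
      by (simp add: dist_norm)
    then have "norm (SI (\<lambda>z. s m z - t n z) u) \<le> e * norm u"
      using s t \<open>e > 0\<close> by (intro norm_simple_qint_le simple_function_diff) (auto simp: approximatesD)
    then show ?thesis
      using s t by (simp add: simple_qint_diff approximatesD)
  qed
  then show ?thesis
    using that by blast
qed

lemma ex_bounded_qint:
  assumes s: "approximates s \<phi>"
  obtains A where "bounded_qlinear A" "\<And>u. (\<lambda>n. SI (s n) u) \<longlonglongrightarrow> A u"
    "(\<lambda>n. onorm (\<lambda>u. SI (s n) u - A u)) \<longlonglongrightarrow> 0"
proof -
  note lin = simple_qint_bounded_qlinear [OF approximatesD [OF s], unfolded bounded_qlinear_def]
  have "Cauchy (\<lambda>n. SI (s n) u)" for u
  proof (rule metric_CauchyI)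
    fix e :: real assume "e > 0"
    obtain d where "d > 0" "d * norm u < e"
      using ex_mult_less [OF \<open>e > 0\<close>] by blast
    then show "\<exists>k. \<forall>m\<ge>k. \<forall>n\<ge>k. dist (SI (s m) u) (SI (s n) u) < e"
      using approximates_close [OF s s \<open>d > 0\<close>] unfolding dist_norm by (meson le_less_trans)
  qed
  then have "\<exists>a. (\<lambda>n. SI (s n) u) \<longlonglongrightarrow> a" for u
    using Cauchy_convergent convergent_def by blast
  then obtain A where A: "\<And>u. (\<lambda>n. SI (s n) u) \<longlonglongrightarrow> A u"
    by metis
  \<comment> \<open>The Cauchy estimate is passed to the limit in one of its two indices. Since
    \<open>k\<close> does not depend on \<open>u\<close>, this upgrades pointwise convergence to
    convergence in operator norm.\<close>
  have close: "\<exists>k. \<forall>n\<ge>k. \<forall>u. norm (SI (s n) u - A u) \<le> e * norm u" if "e > 0" for e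
  proof -
    obtain k where k: "\<And>m n u. m \<ge> k \<Longrightarrow> n \<ge> k \<Longrightarrow> norm (SI (s m) u - SI (s n) u) \<le> e * norm u"
      using approximates_close [OF s s \<open>e > 0\<close>] by blast
    have "norm (SI (s n) u - A u) \<le> e * norm u" if "n \<ge> k" for n u
    proof (rule tendsto_upperbound)
      show "(\<lambda>m. norm (SI (s n) u - SI (s m) u)) \<longlonglongrightarrow> norm (SI (s n) u - A u)"
        by (intro tendsto_intros A)
      show "\<forall>\<^sub>F m in sequentially. norm (SI (s n) u - SI (s m) u) \<le> e * norm u"
        using k that by (auto simp: eventually_sequentially)
    qed simp
    then show ?thesis by blast
  qed
  \<comment> \<open>A single approximant at distance at most 1 in operator norm suffices to bound
    \<open>A\<close>.\<close>
  obtain k where k: "\<And>u. norm (SI (s k) u - A u) \<le> norm u"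
    using close [of 1] by auto
  obtain K where K: "\<And>u. norm (SI (s k) u) \<le> norm u * K"
    using bounded_linear.bounded lin by metis
  have bl: "bounded_linear A"
  proof (rule bounded_linear_intro [where K = "K + 1"])
    show "A (u + v) = A u + A v" for u v
      using tendsto_add [OF A [of u] A [of v]] A [of "u + v"] lin
      by (simp add: linear_add [OF bounded_linear.linear] LIMSEQ_unique)
    show "A (r *\<^sub>R u) = r *\<^sub>R A u" for r u
      using tendsto_scaleR [OF tendsto_const A [of u], of r] A [of "r *\<^sub>R u"] lin
      by (simp add: linear_scale [OF bounded_linear.linear] LIMSEQ_unique)
    show "norm (A u) \<le> norm u * (K + 1)" for u
      using k [of u] K [of u] norm_triangle_ineq2 [of "A u" "SI (s k) u"]
      by (simp add: norm_minus_commute algebra_simps)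
  qed
  have "A (u *\<^sub>q q) = A u *\<^sub>q q" for u q
    using bounded_linear.tendsto [OF bounded_linear_scaleQ A [of u], of q] A [of "u *\<^sub>q q"] lin
    by (simp add: LIMSEQ_unique)
  then have bql: "bounded_qlinear A"
    using bl by (simp add: bounded_qlinear_def)
  have bd: "bounded_linear (\<lambda>u. SI (s n) u - A u)" for n
    using lin bl by (intro bounded_linear_sub) auto
  have "(\<lambda>n. onorm (\<lambda>u. SI (s n) u - A u)) \<longlonglongrightarrow> 0"
  proof (rule LIMSEQ_I)
    fix e :: real assume "e > 0"
    then obtain k where "\<And>n u. n \<ge> k \<Longrightarrow> norm (SI (s n) u - A u) \<le> e / 2 * norm u"
      using close [of "e / 2"] by auto
    then have "onorm (\<lambda>u. SI (s n) u - A u) \<le> e / 2" if "n \<ge> k" for n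
      using that \<open>e > 0\<close> by (intro onorm_bound) auto
    then show "\<exists>k. \<forall>n\<ge>k. norm (onorm (\<lambda>u. SI (s n) u - A u) - 0) < e"
      using onorm_pos_le [OF bd] \<open>e > 0\<close> by (intro exI [of _ k]) fastforce
  qed
  then show ?thesis
    using that bql A by blast
qed

lemma approximates_tendsto_unique:
  assumes s: "approximates s \<phi>" and t: "approximates t \<phi>"
    and A: "(\<lambda>n. SI (s n) u) \<longlonglongrightarrow> a"
  shows "(\<lambda>n. SI (t n) u) \<longlonglongrightarrow> a"
proof -
  have "(\<lambda>n. SI (t n) u - SI (s n) u) \<longlonglongrightarrow> 0"
  proof (rule LIMSEQ_I)
    fix e :: real assume "e > 0"
    obtain d where "d > 0" "d * norm u < e"
      using ex_mult_less [OF \<open>e > 0\<close>] by blast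
    then show "\<exists>k. \<forall>n\<ge>k. norm (SI (t n) u - SI (s n) u - 0) < e"
      using approximates_close [OF t s \<open>d > 0\<close>] unfolding diff_zero by (meson le_less_trans)
  qed
  from tendsto_add [OF this A] show ?thesis by simp
qed

text \<open>The definite description in \<open>bounded_qint\<close> has a unique solution:
  convergence in operator norm implies pointwise convergence, and the pointwise limits agree for all
  approximating sequences. From here on any such sequence may be used.\<close>

lemma bounded_qint_props:
  assumes "bounded_borel \<phi>"
  shows bounded_qint_bounded_qlinear: "bounded_qlinear (\<Phi> \<phi>)"
    and bounded_qint_tendsto: "approximates s \<phi> \<Longrightarrow> (\<lambda>n. SI (s n) u) \<longlonglongrightarrow> \<Phi> \<phi> u"
proof -
  obtain t where t: "approximates t \<phi>"
    using ex_approximates [OF assms] by blast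
  obtain A where A: "bounded_qlinear A" "\<And>u. (\<lambda>n. SI (t n) u) \<longlonglongrightarrow> A u"
    "(\<lambda>n. onorm (\<lambda>u. SI (t n) u - A u)) \<longlonglongrightarrow> 0"
    using ex_bounded_qint [OF t] by blast
  have "\<Phi> \<phi> = A"
    unfolding bounded_qint_def
  proof (rule the_equality)
    show "bounded_qlinear A \<and> (\<exists>s. (\<forall>n. simple_function M (s n)) \<and> uniform_limit C s \<phi> sequentially \<and>
        (\<lambda>n. onorm (\<lambda>u. SI (s n) u - A u)) \<longlonglongrightarrow> 0)"
      using A t by (auto simp: approximates_def)
    fix B
    assume "bounded_qlinear B \<and> (\<exists>s. (\<forall>n. simple_function M (s n)) \<and> uniform_limit C s \<phi> sequentially \<and>
        (\<lambda>n. onorm (\<lambda>u. SI (s n) u - B u)) \<longlonglongrightarrow> 0)"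
    then obtain s where B: "bounded_linear B" and s: "approximates s \<phi>"
      and lim: "(\<lambda>n. onorm (\<lambda>u. SI (s n) u - B u)) \<longlonglongrightarrow> 0"
      by (auto simp: approximates_def bounded_qlinear_def)
    have "(\<lambda>n. SI (s n) u) \<longlonglongrightarrow> B u" for u
    proof -
      have "bounded_linear (\<lambda>u. SI (s n) u - B u)" for n
        using simple_qint_bounded_qlinear [OF approximatesD [OF s]] B
        by (intro bounded_linear_sub) (auto simp: bounded_qlinear_def)
      then have "norm (SI (s n) u - B u) \<le> onorm (\<lambda>u. SI (s n) u - B u) * norm u" for n
        by (rule onorm)
      then have "(\<lambda>n. SI (s n) u - B u) \<longlonglongrightarrow> 0"
        by (intro Lim_null_comparison [OF _ tendsto_mult_left_zero [OF lim]] always_eventually) auto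
      then show ?thesis by (simp add: LIM_zero_iff)
    qed
    then show "B = A"
      using approximates_tendsto_unique [OF s t] A(2) LIMSEQ_unique by (intro ext) blast
  qed
  then show "bounded_qlinear (\<Phi> \<phi>)" "approximates s \<phi> \<Longrightarrow> (\<lambda>n. SI (s n) u) \<longlonglongrightarrow> \<Phi> \<phi> u"
    using A approximates_tendsto_unique [OF t] by auto
qed

lemma bounded_qint_cong:
  assumes "\<And>z. z \<in> C \<Longrightarrow> \<phi> z = \<psi> z"
  shows "\<Phi> \<phi> = \<Phi> \<psi>"
proof -
  have "uniform_limit C s \<phi> sequentially \<longleftrightarrow> uniform_limit C s \<psi> sequentially" for s
    using assms by (intro uniform_limit_cong') auto
  then show ?thesis
    unfolding bounded_qint_def by simp
qed

lemma bounded_borel_add: "bounded_borel \<phi> \<Longrightarrow> bounded_borel \<psi> \<Longrightarrow> bounded_borel (\<lambda>z. \<phi> z + \<psi> z)"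
  by (auto simp: bounded_borel_def intro!: bounded_plus_comp)

lemma bounded_borel_mult:
  assumes "bounded_borel \<phi>" "bounded_borel \<psi>"
  shows "bounded_borel (\<lambda>z. \<phi> z * \<psi> z)"
proof -
  obtain K1 K2 where "\<And>z. z \<in> C \<Longrightarrow> norm (\<phi> z) \<le> K1" "\<And>z. z \<in> C \<Longrightarrow> norm (\<psi> z) \<le> K2"
    using assms by (auto simp: bounded_borel_def bounded_iff)
  then have "norm (\<phi> z * \<psi> z) \<le> K1 * K2" if "z \<in> C" for z
    using that unfolding norm_mult by (intro mult_mono) (auto intro: order.trans [OF norm_ge_zero])
  then show ?thesis
    using assms by (auto simp: bounded_borel_def bounded_iff intro!: borel_measurable_times)
qed

lemma bounded_qint_add:
  assumes "bounded_borel \<phi>" "bounded_borel \<psi>"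
  shows "\<Phi> (\<lambda>z. \<phi> z + \<psi> z) u = \<Phi> \<phi> u + \<Phi> \<psi> u"
proof -
  obtain s t where s: "approximates s \<phi>" and t: "approximates t \<psi>"
    using ex_approximates [OF assms(1)] ex_approximates [OF assms(2)] by metis
  then have "approximates (\<lambda>n z. s n z + t n z) (\<lambda>z. \<phi> z + \<psi> z)"
    by (auto simp: approximates_def intro: uniform_limit_add)
  from bounded_qint_tendsto [OF bounded_borel_add [OF assms] this]
  have "(\<lambda>n. SI (s n) u + SI (t n) u) \<longlonglongrightarrow> \<Phi> (\<lambda>z. \<phi> z + \<psi> z) u"
    using s t by (simp add: simple_qint_add approximatesD)
  moreover have "(\<lambda>n. SI (s n) u + SI (t n) u) \<longlonglongrightarrow> \<Phi> \<phi> u + \<Phi> \<psi> u"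
    using assms s t by (intro tendsto_add bounded_qint_tendsto)
  ultimately show ?thesis
    by (rule LIMSEQ_unique)
qed

lemma bounded_qint_mult:
  assumes \<phi>: "bounded_borel \<phi>" and \<psi>: "bounded_borel \<psi>"
  shows "\<Phi> (\<lambda>z. \<phi> z * \<psi> z) u = \<Phi> \<phi> (\<Phi> \<psi> u)"
proof -
  obtain s where s: "approximates s \<phi>" and s4: "\<And>n z. norm (s n z - \<phi> z) \<le> 4 / Suc n"
    using ex_approximates [OF \<phi>] by metis
  obtain t where t: "approximates t \<psi>"
    using ex_approximates [OF \<psi>] by metis
  obtain B where B: "B \<ge> 0" "\<And>z. z \<in> C \<Longrightarrow> norm (\<phi> z) \<le> B"
    using \<phi> by (auto simp: bounded_borel_def bounded_pos intro: less_imp_le)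
  have sB: "norm (s n z) \<le> B + 4" if "z \<in> C" for n z
  proof -
    have "4 / real (Suc n) \<le> 4" by (simp add: field_simps)
    then show ?thesis
      using s4 [of n z] B(2) [OF that] norm_triangle_ineq2 [of "s n z" "\<phi> z"] by linarith
  qed
  have "approximates (\<lambda>n z. s n z * t n z) (\<lambda>z. \<phi> z * \<psi> z)"
    using s t \<phi> \<psi> by (auto simp: approximates_def bounded_borel_def intro: uniform_lim_mult)
  from bounded_qint_tendsto [OF bounded_borel_mult [OF \<phi> \<psi>] this]
  have 1: "(\<lambda>n. SI (s n) (SI (t n) u)) \<longlonglongrightarrow> \<Phi> (\<lambda>z. \<phi> z * \<psi> z) u"
    using s t by (simp add: simple_qint_mult approximatesD)
  \<comment> \<open>Both factors vary with \<open>n\<close>. Replacing the inner one by its limit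
    \<open>?x\<close> costs an error that tends to 0, because all \<open>SI (s n)\<close> are
    bounded by the same constant \<open>B + 4\<close>.\<close>
  let ?x = "\<Phi> \<psi> u"
  have "(\<lambda>n. SI (t n) u - ?x) \<longlonglongrightarrow> 0"
    using bounded_qint_tendsto [OF \<psi> t] by (simp add: LIM_zero)
  then have lim: "(\<lambda>n. (B + 4) * norm (SI (t n) u - ?x)) \<longlonglongrightarrow> 0"
    by (intro tendsto_mult_right_zero tendsto_norm_zero)
  have le: "norm (SI (s n) (SI (t n) u - ?x)) \<le> (B + 4) * norm (SI (t n) u - ?x)" for n
    using s sB B(1) by (intro norm_simple_qint_le) (auto simp: approximatesD)
  have "(\<lambda>n. SI (s n) (SI (t n) u - ?x)) \<longlonglongrightarrow> 0"
    by (rule Lim_null_comparison [OF always_eventually [OF allI [OF le]] lim])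
  from tendsto_add [OF this bounded_qint_tendsto [OF \<phi> s, of ?x]]
  have "(\<lambda>n. SI (s n) (SI (t n) u - ?x) + SI (s n) ?x) \<longlonglongrightarrow> \<Phi> \<phi> ?x"
    by simp
  moreover have "SI (s n) (SI (t n) u - ?x) + SI (s n) ?x = SI (s n) (SI (t n) u)" for n
    using simple_qint_bounded_qlinear [OF approximatesD [OF s]]
    by (simp add: bounded_qlinear_def linear_diff [OF bounded_linear.linear])
  ultimately show ?thesis
    using LIMSEQ_unique [OF 1] by simp
qed

lemma bounded_qint_isometry:
  assumes \<phi>: "bounded_borel \<phi>"
  shows "ennreal ((norm (\<Phi> \<phi> u))\<^sup>2) = (\<integral>\<^sup>+ z. ennreal ((norm (\<phi> z))\<^sup>2) \<partial>\<mu> u)"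
proof -
  obtain s where s: "approximates s \<phi>" and s4: "\<And>n z. norm (s n z - \<phi> z) \<le> 4 / Suc n"
    using ex_approximates [OF \<phi>] by metis
  obtain B where B: "B \<ge> 0" "\<And>z. z \<in> C \<Longrightarrow> norm (\<phi> z) \<le> B"
    using \<phi> by (auto simp: bounded_borel_def bounded_pos intro: less_imp_le)
  have sB: "norm (s n z) \<le> B + 4" if "z \<in> C" for n z
  proof -
    have "4 / real (Suc n) \<le> 4" by (simp add: field_simps)
    then show ?thesis
      using s4 [of n z] B(2) [OF that] norm_triangle_ineq2 [of "s n z" "\<phi> z"] by linarith
  qed
  have [measurable]: "\<phi> \<in> borel_measurable M" "s n \<in> borel_measurable M" for n
    using \<phi> approximatesD [OF s] by (auto simp: bounded_borel_def borel_measurable_simple_function)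
  \<comment> \<open>Dominated convergence applies because the common bound \<open>B + 4\<close> is a
    constant and \<open>\<mu> u\<close> is finite.\<close>
  have "(\<lambda>n. \<integral>\<^sup>+ z. ennreal ((norm (s n z))\<^sup>2) \<partial>\<mu> u) \<longlonglongrightarrow> (\<integral>\<^sup>+ z. ennreal ((norm (\<phi> z))\<^sup>2) \<partial>\<mu> u)"
  proof (rule nn_integral_dominated_convergence [where w = "\<lambda>_. ennreal ((B + 4)\<^sup>2)"])
    show "AE z in \<mu> u. ennreal ((norm (s n z))\<^sup>2) \<le> ennreal ((B + 4)\<^sup>2)" for n
      using sB by (intro AE_I2 ennreal_leI power_mono) auto
    show "(\<integral>\<^sup>+ z. ennreal ((B + 4)\<^sup>2) \<partial>\<mu> u) < \<infinity>"
      by (simp add: emeasure_mu ennreal_mult_less_top)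
    have "(\<lambda>n. s n z) \<longlonglongrightarrow> \<phi> z" if "z \<in> C" for z
      using s that tendsto_uniform_limitI by (auto simp: approximates_def)
    then show "AE z in \<mu> u. (\<lambda>n. ennreal ((norm (s n z))\<^sup>2)) \<longlonglongrightarrow> ennreal ((norm (\<phi> z))\<^sup>2)"
      by (intro AE_I2 tendsto_ennrealI tendsto_intros) auto
  qed measurable
  then have "(\<lambda>n. ennreal ((norm (SI (s n) u))\<^sup>2)) \<longlonglongrightarrow> (\<integral>\<^sup>+ z. ennreal ((norm (\<phi> z))\<^sup>2) \<partial>\<mu> u)"
    using s by (simp add: simple_qint_isometry approximatesD)
  moreover have "(\<lambda>n. ennreal ((norm (SI (s n) u))\<^sup>2)) \<longlonglongrightarrow> ennreal ((norm (\<Phi> \<phi> u))\<^sup>2)"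
    using \<phi> s by (intro tendsto_ennrealI tendsto_intros bounded_qint_tendsto)
  ultimately show ?thesis
    using LIMSEQ_unique by blast
qed

lemma norm_bounded_qint_le:
  assumes \<phi>: "bounded_borel \<phi>" and K: "\<And>z. z \<in> C \<Longrightarrow> norm (\<phi> z) \<le> K" "0 \<le> K"
  shows "norm (\<Phi> \<phi> u) \<le> K * norm u"
proof -
  have "ennreal ((norm (\<Phi> \<phi> u))\<^sup>2) \<le> (\<integral>\<^sup>+ z. ennreal (K\<^sup>2) \<partial>\<mu> u)"
    unfolding bounded_qint_isometry [OF \<phi>] using K by (intro nn_integral_mono) (auto intro!: power_mono ennreal_leI)
  also have "\<dots> = ennreal ((K * norm u)\<^sup>2)"
    by (simp add: emeasure_mu ennreal_mult power_mult_distrib)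
  finally show ?thesis
    using K(2) by (simp add: power2_le_iff_abs_le)
qed

lemma bounded_qint_simple:
  assumes "simple_function M s"
  shows "\<Phi> s u = SI s u"
proof -
  have "bounded_borel s"
    using assms simple_function_finite [OF assms]
    by (simp add: bounded_borel_def borel_measurable_simple_function finite_imp_bounded)
  moreover have "approximates (\<lambda>_. s) s"
    using assms by (simp add: approximates_def uniform_limit_const)
  ultimately show ?thesis
    by (rule LIMSEQ_unique [OF bounded_qint_tendsto tendsto_const])
qed

end

section \<open>Unbounded integrals\<close>

definition cutoff :: "quat set \<Rightarrow> (quat \<Rightarrow> quat) \<Rightarrow> quat \<Rightarrow> quat" where
  "cutoff E f = (\<lambda>z. if z \<in> E then f z else 0)"

lemma option_eqI: "(\<And>w. a = Some w \<longleftrightarrow> b = Some w) \<Longrightarrow> a = b"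
  by (cases a; cases b) auto

context iqpvm
begin

definition bounded_on :: "(quat \<Rightarrow> quat) \<Rightarrow> quat set \<Rightarrow> bool" where
  "bounded_on f E \<longleftrightarrow> E \<in> sets M \<and> bounded (f ` E)"

lemma bounded_onD: "bounded_on f E \<Longrightarrow> E \<in> sets M"
  by (simp add: bounded_on_def)

lemma bounded_onI: "E \<in> sets M \<Longrightarrow> (\<And>z. z \<in> E \<Longrightarrow> norm (f z) \<le> K) \<Longrightarrow> bounded_on f E"
  by (auto simp: bounded_on_def bounded_iff)

lemma bounded_on_subset: "bounded_on f E \<Longrightarrow> F \<in> sets M \<Longrightarrow> F \<subseteq> E \<Longrightarrow> bounded_on f F"
  by (auto simp: bounded_on_def intro: bounded_subset)

lemma bounded_on_const [simp]: "bounded_on (\<lambda>_. c) E \<longleftrightarrow> E \<in> sets M"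
  by (auto simp: bounded_on_def bounded_iff)

lemma cutoff_bounded_borel:
  assumes "f \<in> borel_measurable M" "bounded_on f E"
  shows "bounded_borel (cutoff E f)"
proof -
  have [measurable]: "f \<in> borel_measurable M" "E \<in> sets M"
    using assms by (auto simp: bounded_onD)
  have "cutoff E f \<in> borel_measurable M"
    unfolding cutoff_def by (intro measurable_If_set) (simp_all add: sets.Int)
  moreover obtain K where "\<And>z. z \<in> E \<Longrightarrow> norm (f z) \<le> K"
    using assms(2) by (auto simp: bounded_on_def bounded_iff)
  then have "norm (cutoff E f z) \<le> \<bar>K\<bar>" for z
    by (cases "z \<in> E") (fastforce simp: cutoff_def)+
  ultimately show ?thesis
    by (auto simp: bounded_borel_def bounded_iff)
qed

lemma cutoff_apply [simp]: "z \<in> E \<Longrightarrow> cutoff E f z = f z" "z \<notin> E \<Longrightarrow> cutoff E f z = 0"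
  by (simp_all add: cutoff_def)

lemma cutoff_bounded_qlinear:
  "f \<in> borel_measurable M \<Longrightarrow> bounded_on f E \<Longrightarrow> bounded_qlinear (\<Phi> (cutoff E f))"
  by (intro bounded_qint_bounded_qlinear cutoff_bounded_borel)

text \<open>The constant integrand 1 on \<open>E\<close> integrates to \<open>Q E\<close>, and the
  constant \<open>c\<close> on \<open>C\<close> integrates to \<open>L c\<close>. This rule
  therefore also governs all products of integrals with \<open>Q E\<close> and
  \<open>L c\<close>.\<close>

lemma cutoff_mult:
  assumes "f \<in> borel_measurable M" "bounded_on f E" "g \<in> borel_measurable M" "bounded_on g F"
  shows "\<Phi> (cutoff E f) (\<Phi> (cutoff F g) u) = \<Phi> (cutoff (E \<inter> F) (\<lambda>z. f z * g z)) u"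
proof -
  have "cutoff (E \<inter> F) (\<lambda>z. f z * g z) = (\<lambda>z. cutoff E f z * cutoff F g z)"
    by (auto simp: cutoff_def)
  then show ?thesis
    using assms by (simp add: bounded_qint_mult cutoff_bounded_borel)
qed

lemma cutoff_add:
  assumes "f \<in> borel_measurable M" "bounded_on f E" "g \<in> borel_measurable M" "bounded_on g E"
  shows "\<Phi> (cutoff E (\<lambda>z. f z + g z)) u = \<Phi> (cutoff E f) u + \<Phi> (cutoff E g) u"
proof -
  have "cutoff E (\<lambda>z. f z + g z) = (\<lambda>z. cutoff E f z + cutoff E g z)"
    by (auto simp: cutoff_def)
  then show ?thesis
    using assms by (simp add: bounded_qint_add cutoff_bounded_borel)
qed

lemma cutoff_const:
  assumes "E \<in> sets M"
  shows "\<Phi> (cutoff E (\<lambda>_. c)) u = L c (Q E u)"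
proof -
  have "simple_function M (cutoff E (\<lambda>_. c))"
    using assms unfolding cutoff_def
    by (intro simple_function_If_set simple_function_const) (simp add: sets_subset Int_absorb2)
  then show ?thesis
    using simple_qint_indicator [OF assms] by (simp add: bounded_qint_simple cutoff_def)
qed

lemma cutoff_one: "E \<in> sets M \<Longrightarrow> \<Phi> (cutoff E (\<lambda>_. 1)) u = Q E u"
  by (simp add: cutoff_const)

lemma Q_cutoff:
  assumes "f \<in> borel_measurable M" "bounded_on f F" "E \<in> sets M"
  shows "Q E (\<Phi> (cutoff F f) u) = \<Phi> (cutoff (E \<inter> F) f) u"
  using cutoff_mult [of "\<lambda>_. 1" E f F u] assms by (simp add: cutoff_one)

lemma cutoff_Q:
  assumes "f \<in> borel_measurable M" "bounded_on f F" "E \<in> sets M"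
  shows "\<Phi> (cutoff F f) (Q E u) = \<Phi> (cutoff (E \<inter> F) f) u"
  using cutoff_mult [of f F "\<lambda>_. 1" E u] assms by (simp add: cutoff_one Int_commute)

lemma cutoff_L:
  assumes "f \<in> borel_measurable M" "bounded_on f F"
  shows "\<Phi> (cutoff F f) (L c u) = \<Phi> (cutoff F (\<lambda>z. f z * c)) u"
  using cutoff_mult [of f F "\<lambda>_. c" C u] assms cutoff_const [of C c u] sets_subset [OF bounded_onD [OF assms(2)]]
  by (simp add: Int_absorb2)

lemma cutoff_empty: "\<Phi> (cutoff {} f) u = 0"
proof -
  have "cutoff {} f = cutoff {} (\<lambda>_. 1)"
    by (simp add: cutoff_def)
  then show ?thesis
    by (simp add: cutoff_one)
qed

section \<open>Exhaustion by sublevel sets and the graph of an unbounded integral\<close>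

definition level :: "(quat \<Rightarrow> quat) \<Rightarrow> nat \<Rightarrow> quat set" where
  "level f n = {z\<in>C. norm (f z) \<le> real n}"

lemma measurable_sublevel:
  assumes "f \<in> borel_measurable M"
  shows "{z\<in>C. norm (f z) \<le> a} \<in> sets M" "{z\<in>C. norm (f z) < a} \<in> sets M"
    "{z\<in>C. a \<le> norm (f z)} \<in> sets M" "{z\<in>C. f z = b} \<in> sets M"
proof -
  have [measurable]: "f \<in> borel_measurable M" by fact
  have "{z\<in>space M. norm (f z) \<le> a} \<in> sets M" "{z\<in>space M. norm (f z) < a} \<in> sets M"
    "{z\<in>space M. a \<le> norm (f z)} \<in> sets M" "{z\<in>space M. f z = b} \<in> sets M"
    by measurable
  then show "{z\<in>C. norm (f z) \<le> a} \<in> sets M" "{z\<in>C. norm (f z) < a} \<in> sets M"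
    "{z\<in>C. a \<le> norm (f z)} \<in> sets M" "{z\<in>C. f z = b} \<in> sets M"
    by simp_all
qed

lemma level_sets: "f \<in> borel_measurable M \<Longrightarrow> level f n \<in> sets M"
  unfolding level_def by (rule measurable_sublevel(1))

lemma level_bounded: "f \<in> borel_measurable M \<Longrightarrow> bounded_on f (level f n)"
  by (rule bounded_onI [OF level_sets, where K = "real n"]) (auto simp: level_def)

lemma level_mono: "m \<le> n \<Longrightarrow> level f m \<subseteq> level f n"
  by (auto simp: level_def)

lemma level_exhaust: "(\<Union>n. level f n) = C"
  by (auto simp: level_def intro: real_arch_simple)

lemma Q_level_tendsto: "f \<in> borel_measurable M \<Longrightarrow> (\<lambda>n. Q (level f n) u) \<longlonglongrightarrow> u"
  by (rule Q_exhaust) (auto simp: level_sets incseq_def level_exhaust dest: level_mono)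

lemma bounded_on_level:
  assumes "bounded_on f E"
  obtains k where "\<And>n. n \<ge> k \<Longrightarrow> E \<subseteq> level f n"
proof -
  obtain K where K: "\<And>z. z \<in> E \<Longrightarrow> norm (f z) \<le> K"
    using assms by (auto simp: bounded_on_def bounded_iff)
  obtain k :: nat where "K \<le> k"
    using real_arch_simple by blast
  then show ?thesis
    using that [of k] K sets_subset [OF bounded_onD [OF assms]]
    by (force simp: level_def)
qed

lemma qint_trunc: "\<Phi> (\<lambda>z. if norm (f z) \<le> real n then f z else 0) = \<Phi> (cutoff (level f n) f)"
  by (rule bounded_qint_cong) (simp add: cutoff_def level_def)

lemma nn_integral_trunc:
  assumes f: "f \<in> borel_measurable M"
  shows "(\<integral>\<^sup>+ z. (if norm (f z) \<le> real n then ennreal ((norm (f z))\<^sup>2) else 0) \<partial>\<mu> u) =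
    ennreal ((norm (\<Phi> (cutoff (level f n) f) u))\<^sup>2)"
  unfolding bounded_qint_isometry [OF cutoff_bounded_borel [OF f level_bounded [OF f]]]
  by (intro nn_integral_cong) (auto simp: cutoff_def level_def)

text \<open>The increments of \<open>x\<close> are orthogonal, so \<open>\<parallel>x n - x m\<parallel>\<^sup>2 = \<parallel>x n\<parallel>\<^sup>2 - \<parallel>x m\<parallel>\<^sup>2\<close>.\<close>

lemma convergent_martingale:
  assumes A: "\<And>n. A n \<in> sets M" and x: "\<And>m n. m \<le> n \<Longrightarrow> Q (A m) (x n) = x m"
    and K: "\<And>n. (norm (x n))\<^sup>2 \<le> K"
  shows "convergent x"
proof (rule Cauchy_convergent, rule metric_CauchyI)
  fix e :: real assume "e > 0"
  have eq: "(norm (x n - x m))\<^sup>2 = (norm (x n))\<^sup>2 - (norm (x m))\<^sup>2" if "m \<le> n" for m n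
    using norm_Q_Diff [of C "A m" "x n"] x [OF that] A sets_subset [OF A] by simp
  then have "(norm (x m))\<^sup>2 \<le> (norm (x n))\<^sup>2" if "m \<le> n" for m n
    using that zero_le_power2 [of "norm (x n - x m)"] by fastforce
  then have "incseq (\<lambda>n. (norm (x n))\<^sup>2)"
    by (simp add: incseq_def)
  then obtain l where "(\<lambda>n. (norm (x n))\<^sup>2) \<longlonglongrightarrow> l"
    by (rule incseq_convergent [where B = K]) (use K in auto)
  then have "Cauchy (\<lambda>n. (norm (x n))\<^sup>2)"
    by (rule LIMSEQ_imp_Cauchy)
  then obtain k where k: "\<And>m n. m \<ge> k \<Longrightarrow> n \<ge> k \<Longrightarrow> dist ((norm (x m))\<^sup>2) ((norm (x n))\<^sup>2) < e\<^sup>2"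
    using \<open>e > 0\<close> by (auto simp: Cauchy_def) (metis zero_less_power)
  have le: "dist (x m) (x n) < e" if "k \<le> m" "m \<le> n" for m n
  proof -
    have "(norm (x n - x m))\<^sup>2 < e\<^sup>2"
      using k [of m n] that eq [of m n] by (simp add: dist_real_def)
    then show ?thesis
      using \<open>e > 0\<close> power_less_imp_less_base [of "norm (x n - x m)" 2 e]
      by (simp add: dist_norm norm_minus_commute)
  qed
  then show "\<exists>k. \<forall>m\<ge>k. \<forall>n\<ge>k. dist (x m) (x n) < e"
    by (metis dist_commute nle_le)
qed

text \<open>Testing an unbounded integral on all sets on which the integrand is bounded reduces statements
  about unbounded operators to the bounded functional calculus.\<close>

definition qint_graph :: "(quat \<Rightarrow> quat) \<Rightarrow> 'h \<Rightarrow> 'h \<Rightarrow> bool" where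
  "qint_graph f u v \<longleftrightarrow> (\<forall>E. bounded_on f E \<longrightarrow> \<Phi> (cutoff E f) u = Q E v)"

text \<open>\<open>\<Phi> (cutoff E f) u\<close> and \<open>Q E v\<close> have the same image under
  each \<open>Q (A n)\<close>, and these projections converge strongly to the identity. The sets
  \<open>A n\<close> are left open because different ones are needed: bands for inverses, levels of
  the identity for polynomials.\<close>

lemma qint_graphI:
  assumes f: "f \<in> borel_measurable M"
    and A: "\<And>n. bounded_on f (A n)" "incseq A" "(\<Union>n. A n) = C"
    and eq: "\<And>n::nat. \<Phi> (cutoff (A n) f) u = Q (A n) v"
  shows "qint_graph f u v"
  unfolding qint_graph_def
proof (intro allI impI)
  fix E assume E: "bounded_on f E"
  have "Q (A n) (\<Phi> (cutoff E f) u) = Q (A n) (Q E v)" for n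
  proof -
    have "Q (A n) (\<Phi> (cutoff E f) u) = Q E (\<Phi> (cutoff (A n) f) u)"
      using f A(1) E by (simp add: Q_cutoff bounded_onD [OF A(1)] bounded_onD [OF E] Int_commute)
    then show ?thesis
      by (simp add: eq Q_Int bounded_onD [OF A(1)] bounded_onD [OF E] Int_commute)
  qed
  moreover have "(\<lambda>n. Q (A n) w) \<longlonglongrightarrow> w" for w
    using A by (intro Q_exhaust) (auto intro: bounded_onD)
  ultimately show "\<Phi> (cutoff E f) u = Q E v"
    by (metis (no_types, lifting) LIMSEQ_unique ext)
qed

text \<open>The graph condition contains the domain condition. If it holds, the truncated integrals
  of \<open>(norm (f z))\<^sup>2\<close> equal the squared norms of \<open>Q (level f n) v\<close>,
  which are bounded by that of \<open>v\<close>, and monotone convergence applies. In the other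
  direction, square integrability bounds the norms of the truncations, so that they form a
  convergent martingale.\<close>

lemma qint_iff:
  assumes f: "f \<in> borel_measurable M"
  shows "qint \<iota> Q L f u = Some v \<longleftrightarrow> qint_graph f u v"
proof
  assume "qint \<iota> Q L f u = Some v"
  then have fin: "(\<integral>\<^sup>+ z. ennreal ((norm (f z))\<^sup>2) \<partial>\<mu> u) < \<infinity>"
    and v: "v = lim (\<lambda>n. \<Phi> (cutoff (level f n) f) u)"
    by (auto simp: qint_def qint_trunc split: if_splits)
  define x where "x n = \<Phi> (cutoff (level f n) f) u" for n
  obtain K where K: "(\<integral>\<^sup>+ z. ennreal ((norm (f z))\<^sup>2) \<partial>\<mu> u) = ennreal K" "K \<ge> 0"
    using fin by (auto simp: less_top_ennreal)
  have "convergent x"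
  proof (rule convergent_martingale [where A = "level f"])
    show "Q (level f m) (x n) = x m" if "m \<le> n" for m n
      using f level_mono [OF that, of f] by (simp add: x_def Q_cutoff level_bounded level_sets Int_absorb2)
    show "(norm (x n))\<^sup>2 \<le> K" for n
    proof -
      have "ennreal ((norm (x n))\<^sup>2) \<le> ennreal K"
        unfolding x_def nn_integral_trunc [OF f, symmetric] K(1) [symmetric]
        by (intro nn_integral_mono) auto
      then show ?thesis using K(2) by simp
    qed
  qed (simp add: level_sets f)
  then have x: "x \<longlonglongrightarrow> v"
    unfolding v x_def [symmetric] by (simp add: convergent_LIMSEQ_iff)
  show "qint_graph f u v"
    unfolding qint_graph_def
  proof (intro allI impI)
    fix E assume E: "bounded_on f E"
    obtain k where k: "\<And>n. n \<ge> k \<Longrightarrow> E \<subseteq> level f n"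
      using bounded_on_level [OF E] by blast
    have "Q E (x n) = \<Phi> (cutoff E f) u" if "n \<ge> k" for n
      using f E k [OF that] by (simp add: x_def Q_cutoff level_bounded bounded_onD Int_absorb2)
    then have "(\<lambda>n. Q E (x n)) \<longlonglongrightarrow> \<Phi> (cutoff E f) u"
      by (intro tendsto_eventually) (auto simp: eventually_sequentially)
    moreover have "(\<lambda>n. Q E (x n)) \<longlonglongrightarrow> Q E v"
      by (intro bounded_linear.tendsto [OF Q_bounded_linear] x bounded_onD [OF E])
    ultimately show "\<Phi> (cutoff E f) u = Q E v"
      by (rule LIMSEQ_unique)
  qed
next
  assume g: "qint_graph f u v"
  then have eq: "\<Phi> (cutoff (level f n) f) u = Q (level f n) v" for n
    using level_bounded [OF f] by (simp add: qint_graph_def)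
  have [measurable]: "f \<in> borel_measurable M" by fact
  let ?g = "\<lambda>n z. if norm (f z) \<le> real n then ennreal ((norm (f z))\<^sup>2) else 0"
  have "(\<lambda>n. \<integral>\<^sup>+ z. ?g n z \<partial>\<mu> u) \<longlonglongrightarrow> (\<integral>\<^sup>+ z. ennreal ((norm (f z))\<^sup>2) \<partial>\<mu> u)"
  proof (rule nn_integral_LIMSEQ)
    show "incseq ?g"
      by (auto simp: incseq_def le_fun_def)
    show "?g n \<in> borel_measurable (\<mu> u)" for n
      by measurable
    show "(\<lambda>n. ?g n z) \<longlonglongrightarrow> ennreal ((norm (f z))\<^sup>2)" for z
    proof (rule tendsto_eventually)
      obtain k :: nat where "norm (f z) \<le> k"
        using real_arch_simple by blast
      then show "\<forall>\<^sub>F n in sequentially. ?g n z = ennreal ((norm (f z))\<^sup>2)"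
        by (auto simp: eventually_sequentially intro!: exI [of _ k])
    qed
  qed
  moreover have "(\<integral>\<^sup>+ z. ?g n z \<partial>\<mu> u) \<le> ennreal ((norm v)\<^sup>2)" for n
    unfolding nn_integral_trunc [OF f] eq
    by (intro ennreal_leI power_mono norm_Q_le level_sets f) simp
  ultimately have "(\<integral>\<^sup>+ z. ennreal ((norm (f z))\<^sup>2) \<partial>\<mu> u) \<le> ennreal ((norm v)\<^sup>2)"
    by (intro LIMSEQ_le_const2) auto
  then have "(\<integral>\<^sup>+ z. ennreal ((norm (f z))\<^sup>2) \<partial>\<mu> u) < \<infinity>"
    using ennreal_less_top le_less_trans by (metis infinity_ennreal_def)
  moreover have "lim (\<lambda>n. \<Phi> (cutoff (level f n) f) u) = v"
    unfolding eq by (rule limI [OF Q_level_tendsto [OF f]])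
  ultimately show "qint \<iota> Q L f u = Some v"
    by (simp add: qint_def qint_trunc)
qed

text \<open>Since \<open>\<mu> u\<close> is finite, additive constants are integrable, so a
  comparison of integrands up to a constant compares domains.\<close>

lemma qint_domain_mono:
  assumes f: "f \<in> borel_measurable M" and b: "b \<ge> 0"
    and le: "\<And>z. z \<in> C \<Longrightarrow> (norm (g z))\<^sup>2 \<le> a + b * (norm (f z))\<^sup>2"
    and u: "u \<in> dom (qint \<iota> Q L f)"
  shows "u \<in> dom (qint \<iota> Q L g)"
proof -
  have [measurable]: "f \<in> borel_measurable M" by fact
  have "(\<integral>\<^sup>+ z. ennreal ((norm (g z))\<^sup>2) \<partial>\<mu> u) \<le>
      (\<integral>\<^sup>+ z. ennreal \<bar>a\<bar> + ennreal b * ennreal ((norm (f z))\<^sup>2) \<partial>\<mu> u)"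
  proof (rule nn_integral_mono)
    fix z assume "z \<in> space (\<mu> u)"
    \<comment> \<open>\<open>a\<close> may be negative, and \<open>ennreal\<close> is additive only
      on non-negative reals.\<close>
    then have "(norm (g z))\<^sup>2 \<le> \<bar>a\<bar> + b * (norm (f z))\<^sup>2"
      using le [of z] by simp
    then show "ennreal ((norm (g z))\<^sup>2) \<le> ennreal \<bar>a\<bar> + ennreal b * ennreal ((norm (f z))\<^sup>2)"
      using b by (simp add: ennreal_leI flip: ennreal_mult ennreal_plus)
  qed
  also have "\<dots> = ennreal \<bar>a\<bar> * ennreal ((norm u)\<^sup>2) + ennreal b * (\<integral>\<^sup>+ z. ennreal ((norm (f z))\<^sup>2) \<partial>\<mu> u)"
    by (simp add: nn_integral_add nn_integral_cmult emeasure_mu)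
  also have "\<dots> < \<infinity>"
    using u by (auto simp: qint_def ennreal_mult_less_top less_top ennreal_add_eq_top ennreal_mult_eq_top_iff split: if_splits)
  finally show ?thesis
    by (simp add: qint_def dom_def)
qed

end

section \<open>Spectra of unbounded integrals\<close>

context iqpvm
begin

text \<open>Source of all explicit vectors in domains: for every test set \<open>E\<close> both
  sides of the graph condition are the integral over \<open>E \<inter> F\<close>.\<close>

lemma qint_cutoff:
  assumes f: "f \<in> borel_measurable M" and F: "bounded_on f F"
  shows "qint \<iota> Q L f (Q F u) = Some (\<Phi> (cutoff F f) u)"
  unfolding qint_iff [OF f] qint_graph_def
  using f F by (auto simp: cutoff_Q [OF f _ bounded_onD [OF F]] Q_cutoff bounded_onD Int_commute)

section \<open>Zeros, kernels and inverses of integrals\<close>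

definition null_set :: "quat set \<Rightarrow> bool" where
  "null_set E \<longleftrightarrow> (\<forall>u. Q E u = 0)"

lemma null_set_subset: "null_set E \<Longrightarrow> E \<in> sets M \<Longrightarrow> F \<in> sets M \<Longrightarrow> F \<subseteq> E \<Longrightarrow> null_set F"
  using norm_Q_mono [of E F] by (auto simp: null_set_def)

lemma Q_Diff_null:
  assumes "null_set F" "E \<in> sets M" "F \<in> sets M"
  shows "Q (E - F) u = Q E u"
proof -
  have "Q (E \<inter> F) u = 0"
    using assms by (metis null_set_def Q_Int Q_zero)
  moreover have "E - F = E - E \<inter> F" by auto
  ultimately show ?thesis
    using assms Q_Diff [of E "E \<inter> F" u] by (simp add: sets.Int)
qed

definition zeros :: "(quat \<Rightarrow> quat) \<Rightarrow> quat set" where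
  "zeros f = {z\<in>C. f z = 0}"

lemma zeros_sets: "f \<in> borel_measurable M \<Longrightarrow> zeros f \<in> sets M"
  unfolding zeros_def by (rule measurable_sublevel(4))

text \<open>For positive \<open>n\<close> these are the points with \<open>f z = 0\<close> or
  \<open>1 / n \<le> norm (f z) \<le> n\<close>. Because of \<open>inverse 0 = 0\<close> the zeros
  of \<open>f\<close> lie in every band, so the bands exhaust all of \<open>C\<close> and not only
  the complement of the zeros.\<close>

definition band :: "(quat \<Rightarrow> quat) \<Rightarrow> nat \<Rightarrow> quat set" where
  "band f n = level f n \<inter> level (\<lambda>z. inverse (f z)) n"

lemma band_sets: "f \<in> borel_measurable M \<Longrightarrow> band f n \<in> sets M"
  unfolding band_def by (intro sets.Int level_sets borel_measurable_inverse)

lemma band_bounded: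
  assumes "f \<in> borel_measurable M"
  shows "bounded_on f (band f n)" "bounded_on (\<lambda>z. inverse (f z)) (band f n)"
  using assms
  by (auto intro!: bounded_on_subset [OF level_bounded [of f n]] band_sets borel_measurable_inverse
      bounded_on_subset [OF level_bounded [of "\<lambda>z. inverse (f z)" n]]) (auto simp: band_def)

lemma band_mono: "incseq (band f)"
  unfolding incseq_def band_def using level_mono by (metis Int_mono)

lemma band_exhaust: "(\<Union>n. band f n) = C"
proof -
  have "z \<in> band f (max m n)" if "z \<in> level f m" "z \<in> level (\<lambda>z. inverse (f z)) n" for z m n
    using that level_mono [of m "max m n" f] level_mono [of n "max m n" "\<lambda>z. inverse (f z)"]
    by (auto simp: band_def)
  then show ?thesis
    using level_exhaust [of f] level_exhaust [of "\<lambda>z. inverse (f z)"] by (fastforce simp: band_def)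
qed

lemma Q_band_tendsto: "f \<in> borel_measurable M \<Longrightarrow> (\<lambda>n. Q (band f n) u) \<longlonglongrightarrow> u"
  by (rule Q_exhaust) (auto intro: band_sets band_mono simp: band_exhaust)

text \<open>\<open>inverse (f z) * f z\<close> is 1 off the zeros and 0 on them, so the product of
  the two integrals is a projection.\<close>

lemma band_inverse:
  assumes f: "f \<in> borel_measurable M"
  shows "\<Phi> (cutoff (band f n) (\<lambda>z. inverse (f z))) (\<Phi> (cutoff (band f n) f) u) = Q (band f n - zeros f) u"
proof -
  have "cutoff (band f n) (\<lambda>z. inverse (f z) * f z) = cutoff (band f n - zeros f) (\<lambda>_. 1)"
    by (auto simp: cutoff_def zeros_def fun_eq_iff band_def level_def)
  then show ?thesis
    using f by (simp add: cutoff_mult band_bounded borel_measurable_inverse cutoff_one band_sets zeros_sets sets.Diff)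
qed

text \<open>On each band the graph condition for \<open>f\<close> can be multiplied by the bounded
  integral of the inverse. This returns \<open>u\<close> on the band without the zeros, and these
  may be put back since they form a null set.\<close>

lemma qint_inverse:
  assumes f: "f \<in> borel_measurable M" and null: "null_set (zeros f)"
    and "qint \<iota> Q L f u = Some v"
  shows "qint \<iota> Q L (\<lambda>z. inverse (f z)) v = Some u"
proof -
  let ?g = "\<lambda>z. inverse (f z)"
  have g: "?g \<in> borel_measurable M"
    using f by (rule borel_measurable_inverse)
  have v: "\<Phi> (cutoff (band f n) f) u = Q (band f n) v" for n
    using assms(3) band_bounded(1) [OF f] by (simp add: qint_iff [OF f] qint_graph_def)
  have "\<Phi> (cutoff (band f n) ?g) v = Q (band f n) u" for n
  proof -
    have "\<Phi> (cutoff (band f n) ?g) v = \<Phi> (cutoff (band f n) ?g) (Q (band f n) v)"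
      by (simp add: cutoff_Q [OF g band_bounded(2) [OF f] band_sets [OF f]])
    also have "\<dots> = Q (band f n - zeros f) u"
      unfolding v [symmetric] by (rule band_inverse [OF f])
    finally show ?thesis
      by (simp add: Q_Diff_null null band_sets zeros_sets f)
  qed
  then show ?thesis
    unfolding qint_iff [OF g]
    by (intro qint_graphI [OF g band_bounded(2) [OF f] band_mono band_exhaust])
qed

text \<open>Inversion is an involution that preserves zeros, so the converse is the previous
  implication applied to the inverse.\<close>

lemma qint_inverse_iff:
  assumes f: "f \<in> borel_measurable M" and null: "null_set (zeros f)"
  shows "qint \<iota> Q L (\<lambda>z. inverse (f z)) v = Some u \<longleftrightarrow> qint \<iota> Q L f u = Some v"
proof -
  have "zeros (\<lambda>z. inverse (f z)) = zeros f"
    by (auto simp: zeros_def)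
  then show ?thesis
    using qint_inverse [OF f null] qint_inverse [of "\<lambda>z. inverse (f z)" v u] f null
    by (auto simp: borel_measurable_inverse)
qed

lemma ker_qint:
  assumes f: "f \<in> borel_measurable M"
  shows "op_ker (qint \<iota> Q L f) = range (Q (zeros f))"
proof (intro equalityI subsetI)
  note Z = zeros_sets [OF f]
  fix u assume "u \<in> op_ker (qint \<iota> Q L f)"
  then have 0: "\<Phi> (cutoff (band f n) f) u = 0" for n
    using band_bounded(1) [OF f] by (simp add: op_ker_def qint_iff [OF f] qint_graph_def Q_zero bounded_onD [of f])
  \<comment> \<open>Multiplying by the integral of the inverse shows that \<open>u\<close> has no
    component in the band outside the zeros. The bands exhaust \<open>C\<close>, so only the
    component in \<open>zeros f\<close> remains.\<close>
  have "Q (band f n) u = Q (band f n) (Q (zeros f) u)" for n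
  proof -
    have "bounded_linear (\<Phi> (cutoff (band f n) (\<lambda>z. inverse (f z))))"
      using cutoff_bounded_qlinear [OF borel_measurable_inverse [OF f] band_bounded(2) [OF f]]
      by (simp add: bounded_qlinear_def)
    from linear_0 [OF bounded_linear.linear [OF this]]
    have "Q (band f n - zeros f) u = 0"
      using band_inverse [OF f, of n u] by (simp add: 0)
    moreover have "band f n - zeros f = band f n - band f n \<inter> zeros f" by auto
    ultimately show ?thesis
      using Q_Diff [of "band f n" "band f n \<inter> zeros f" u] Z band_sets [OF f, of n]
      by (simp add: sets.Int Q_Int)
  qed
  then have "Q (zeros f) u = u"
    using Q_band_tendsto [OF f, of u] Q_band_tendsto [OF f, of "Q (zeros f) u"] LIMSEQ_unique
    by (metis (no_types, lifting) ext)
  then show "u \<in> range (Q (zeros f))"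
    by (metis rangeI)
next
  fix u assume "u \<in> range (Q (zeros f))"
  then obtain w where "u = Q (zeros f) w" by auto
  moreover have "bounded_on f (zeros f)"
    by (rule bounded_onI [OF zeros_sets [OF f], where K = 0]) (simp add: zeros_def)
  moreover have "cutoff (zeros f) f = cutoff {} f"
    by (auto simp: cutoff_def zeros_def)
  ultimately show "u \<in> op_ker (qint \<iota> Q L f)"
    using qint_cutoff [OF f] by (simp add: op_ker_def cutoff_empty)
qed

lemma ker_qint_trivial_iff:
  assumes f: "f \<in> borel_measurable M"
  shows "op_ker (qint \<iota> Q L f) = {0} \<longleftrightarrow> null_set (zeros f)"
  unfolding ker_qint [OF f] null_set_def by auto

text \<open>Every vector \<open>Q (band f n) v\<close> is in the domain of the integral of the
  inverse, hence in the range of that of \<open>f\<close>, and these vectors converge to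
  \<open>v\<close>. This is what makes both residual spectra empty.\<close>

lemma range_qint_dense:
  assumes f: "f \<in> borel_measurable M" and null: "null_set (zeros f)"
  shows "closure (ran (qint \<iota> Q L f)) = UNIV"
proof -
  have "v \<in> closure (ran (qint \<iota> Q L f))" for v
  proof -
    let ?g = "\<lambda>z. inverse (f z)"
    have "qint \<iota> Q L ?g (Q (band f n) v) = Some (\<Phi> (cutoff (band f n) ?g) v)" for n
      by (intro qint_cutoff borel_measurable_inverse f band_bounded)
    then have "Q (band f n) v \<in> ran (qint \<iota> Q L f)" for n
      by (auto simp: qint_inverse_iff [OF f null] ran_def)
    then show ?thesis
      unfolding closure_sequential using Q_band_tendsto [OF f, of v]
      by (intro exI [of _ "\<lambda>n. Q (band f n) v"]) simp
  qed
  then show ?thesis by blast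
qed

lemma inv_qint:
  assumes f: "f \<in> borel_measurable M" and null: "null_set (zeros f)"
  shows "op_inv (qint \<iota> Q L f) = qint \<iota> Q L (\<lambda>z. inverse (f z))"
proof (rule ext, rule option_eqI)
  fix v w
  note eq = qint_inverse_iff [OF f null, symmetric]
  have "v \<in> ran (qint \<iota> Q L f) \<longleftrightarrow> (\<exists>u. qint \<iota> Q L (\<lambda>z. inverse (f z)) v = Some u)"
    by (simp add: ran_def eq)
  then show "op_inv (qint \<iota> Q L f) v = Some w \<longleftrightarrow> qint \<iota> Q L (\<lambda>z. inverse (f z)) v = Some w"
    by (auto simp: op_inv_def eq)
qed

text \<open>The condition that 0 lies outside the essential range of \<open>f\<close> with respect
  to \<open>Q\<close>.\<close>

definition bounded_below :: "(quat \<Rightarrow> quat) \<Rightarrow> bool" where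
  "bounded_below f \<longleftrightarrow> (\<exists>c>0. null_set {z\<in>C. norm (f z) < c})"

lemma bounded_below_zeros:
  assumes f: "f \<in> borel_measurable M" and "bounded_below f"
  shows "null_set (zeros f)"
  using assms(2) unfolding bounded_below_def
  by (auto intro!: null_set_subset [OF _ measurable_sublevel(2) [OF f] zeros_sets [OF f]]) (auto simp: zeros_def)

lemma norm_cutoff_sublevel:
  assumes f: "f \<in> borel_measurable M" and "c > 0"
  shows "bounded_on f {z\<in>C. norm (f z) < c}"
    and "norm (\<Phi> (cutoff {z\<in>C. norm (f z) < c} f) u) \<le> c * norm (Q {z\<in>C. norm (f z) < c} u)"
proof -
  let ?F = "{z\<in>C. norm (f z) < c}"
  have F: "?F \<in> sets M" by (rule measurable_sublevel [OF f])
  show bdd: "bounded_on f ?F"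
    by (rule bounded_onI [OF F, where K = c]) simp
  have "\<Phi> (cutoff ?F f) u = \<Phi> (cutoff ?F f) (Q ?F u)"
    by (simp add: cutoff_Q [OF f bdd F])
  also have "norm \<dots> \<le> c * norm (Q ?F u)"
    using \<open>c > 0\<close> by (intro norm_bounded_qint_le cutoff_bounded_borel f bdd) (auto simp: cutoff_def)
  finally show "norm (\<Phi> (cutoff ?F f) u) \<le> c * norm (Q ?F u)" .
qed

text \<open>Cutting away the null set where \<open>norm (f z) < c\<close> leaves a set
  \<open>F\<close> with \<open>Q F v = v\<close> for all \<open>v\<close>, on which the inverse is
  bounded by \<open>1 / c\<close>. The integral of the inverse is thus a bounded one.\<close>

lemma bounded_inverse_qint:
  assumes f: "f \<in> borel_measurable M" and "bounded_below f"
  shows "dom (qint \<iota> Q L (\<lambda>z. inverse (f z))) = UNIV" "op_bounded (qint \<iota> Q L (\<lambda>z. inverse (f z)))"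
proof -
  let ?g = "\<lambda>z. inverse (f z)"
  have g: "?g \<in> borel_measurable M"
    using f by (rule borel_measurable_inverse)
  obtain c where c: "c > 0" and null: "null_set {z\<in>C. norm (f z) < c}"
    using assms(2) by (auto simp: bounded_below_def)
  define F where "F = C - {z\<in>C. norm (f z) < c}"
  have F: "F \<in> sets M"
    unfolding F_def by (intro sets.Diff space_in_sets measurable_sublevel f)
  have F_le: "norm (?g z) \<le> 1 / c" if "z \<in> F" for z
    using le_imp_inverse_le [of c "norm (f z)"] that c
    by (simp add: F_def norm_inverse not_less inverse_eq_divide [of c])
  then have bdd: "bounded_on ?g F"
    by (intro bounded_onI [OF F])
  have Q: "Q F v = v" for v
    unfolding F_def using Q_Diff_null [OF null space_in_sets measurable_sublevel(2) [OF f]] by simp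
  have eq: "qint \<iota> Q L ?g v = Some (\<Phi> (cutoff F ?g) v)" for v
    using qint_cutoff [OF g bdd, of v] by (simp add: Q)
  then show "dom (qint \<iota> Q L ?g) = UNIV"
    by auto
  have "norm (\<Phi> (cutoff F ?g) v) \<le> 1 / c * norm v" for v
  proof (rule norm_bounded_qint_le [OF cutoff_bounded_borel [OF g bdd]])
    show "norm (cutoff F ?g z) \<le> 1 / c" for z
      using F_le [of z] c by (cases "z \<in> F") auto
  qed (use c in simp)
  then show "op_bounded (qint \<iota> Q L ?g)"
    unfolding op_bounded_def eq option.sel by blast
qed

lemma bounded_below_qint:
  assumes f: "f \<in> borel_measurable M" and null: "null_set (zeros f)"
    and bdd: "op_bounded (qint \<iota> Q L (\<lambda>z. inverse (f z)))"
  shows "bounded_below f"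
proof -
  let ?g = "\<lambda>z. inverse (f z)"
  obtain K where K: "\<And>v u. qint \<iota> Q L ?g v = Some u \<Longrightarrow> norm u \<le> K * norm v"
    using bdd unfolding op_bounded_def by force
  \<comment> \<open>Chosen so that \<open>\<bar>K\<bar> * c < 1\<close>. Vectors in the range of
    \<open>Q ?F\<close> shrink by the factor \<open>c\<close> under the integral of \<open>f\<close>
    and grow at most by \<open>\<bar>K\<bar>\<close> on the way back, so they vanish.\<close>
  define c where "c = 1 / (\<bar>K\<bar> + 1)"
  have c: "c > 0" "\<bar>K\<bar> * c < 1"
    by (auto simp: c_def pos_divide_less_eq add_nonneg_pos intro!: divide_pos_pos)
  let ?F = "{z\<in>C. norm (f z) < c}"
  have "Q ?F u = 0" for u
  proof -
    let ?y = "\<Phi> (cutoff ?F f) u"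
    have "qint \<iota> Q L ?g ?y = Some (Q ?F u)"
      by (intro qint_inverse f null qint_cutoff norm_cutoff_sublevel c)
    then have "norm (Q ?F u) \<le> K * norm ?y"
      by (rule K)
    also have "\<dots> \<le> \<bar>K\<bar> * norm ?y"
      by (intro mult_right_mono) auto
    also have "\<dots> \<le> \<bar>K\<bar> * (c * norm (Q ?F u))"
      using norm_cutoff_sublevel(2) [OF f c(1), of u] by (intro mult_left_mono) auto
    finally have "(1 - \<bar>K\<bar> * c) * norm (Q ?F u) \<le> 0"
      by (simp add: algebra_simps)
    then show ?thesis
      using c(2) by (simp add: mult_le_0_iff)
  qed
  then show ?thesis
    using c(1) by (auto simp: bounded_below_def null_set_def)
qed

lemma spectra_qint:
  assumes A: "\<And>q. A q = qint \<iota> Q L (f q)" and f: "\<And>q. f q \<in> borel_measurable M"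
  shows resolvent_set_qint: "q \<in> resolvent_set A \<longleftrightarrow> bounded_below (f q)"
    and point_spectrum_qint: "q \<in> point_spectrum A \<longleftrightarrow> \<not> null_set (zeros (f q))"
    and residual_spectrum_qint: "residual_spectrum A = {}"
    and continuous_spectrum_qint: "q \<in> continuous_spectrum A \<longleftrightarrow> null_set (zeros (f q)) \<and> \<not> bounded_below (f q)"
proof -
  note ker = ker_qint_trivial_iff [OF f] and dense = range_qint_dense [OF f]
  have inv: "op_bounded (op_inv (A q)) \<longleftrightarrow> bounded_below (f q)" if "null_set (zeros (f q))" for q
    unfolding A inv_qint [OF f that]
    using bounded_inverse_qint(2) [OF f, of q] bounded_below_qint [OF f that] by blast
  show "residual_spectrum A = {}"
    unfolding residual_spectrum_def A ker using dense by blast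
  show "q \<in> resolvent_set A \<longleftrightarrow> bounded_below (f q)"
    unfolding resolvent_set_def mem_Collect_eq using inv [of q] dense [of q] bounded_below_zeros [OF f, of q]
    by (auto simp: A ker)
  show "q \<in> point_spectrum A \<longleftrightarrow> \<not> null_set (zeros (f q))"
    unfolding point_spectrum_def mem_Collect_eq A ker ..
  show "q \<in> continuous_spectrum A \<longleftrightarrow> null_set (zeros (f q)) \<and> \<not> bounded_below (f q)"
    unfolding continuous_spectrum_def mem_Collect_eq using inv [of q] dense [of q]
    by (auto simp: A ker)
qed

lemma bounded_below_bij:
  assumes f: "f \<in> borel_measurable M" and bb: "bounded_below f"
  shows "bij_betw (\<lambda>u. the (qint \<iota> Q L f u)) (dom (qint \<iota> Q L f)) UNIV"
proof -
  note null = bounded_below_zeros [OF f bb]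
  show ?thesis
    unfolding bij_betw_def
  proof (intro conjI inj_onI set_eqI iffI UNIV_I)
    fix u v assume "u \<in> dom (qint \<iota> Q L f)" "v \<in> dom (qint \<iota> Q L f)"
      "the (qint \<iota> Q L f u) = the (qint \<iota> Q L f v)"
    then obtain w where "qint \<iota> Q L f u = Some w" "qint \<iota> Q L f v = Some w"
      by auto
    from this [THEN qint_inverse [OF f null]] show "u = v"
      by simp
  next
    fix v
    obtain u where "qint \<iota> Q L (\<lambda>z. inverse (f z)) v = Some u"
      using bounded_inverse_qint(1) [OF f bb] by blast
    then have "qint \<iota> Q L f u = Some v"
      using qint_inverse_iff [OF f null] by blast
    then show "v \<in> (\<lambda>u. the (qint \<iota> Q L f u)) ` dom (qint \<iota> Q L f)"
      by force
  qed
qed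

end

section \<open>Slices and spheres in the quaternions\<close>

lemma quat_numeral_sel [simp]:
  "qRe (numeral n) = numeral n" "qI (numeral n) = 0" "qJ (numeral n) = 0" "qK (numeral n) = 0"
  using qRe_of_real [of "numeral n"] by simp_all

lemma qS_iff: "\<kappa> \<in> qS \<longleftrightarrow> qRe \<kappa> = 0 \<and> norm \<kappa> = 1"
proof
  assume "\<kappa> \<in> qS"
  then have eq: "qRe \<kappa> * qRe \<kappa> - qI \<kappa> * qI \<kappa> - qJ \<kappa> * qJ \<kappa> - qK \<kappa> * qK \<kappa> = - 1"
    "qRe \<kappa> * qI \<kappa> = 0" "qRe \<kappa> * qJ \<kappa> = 0" "qRe \<kappa> * qK \<kappa> = 0"
    by (auto simp: qS_def power2_eq_square quat_eq_iff)
  \<comment> \<open>A non-zero real part would make the imaginary coordinates vanish and leave a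
    real square equal to -1.\<close>
  have "qRe \<kappa> = 0"
  proof (rule ccontr)
    assume "qRe \<kappa> \<noteq> 0"
    with eq have "qRe \<kappa> * qRe \<kappa> = - 1" by simp
    then show False using zero_le_square [of "qRe \<kappa>"] by simp
  qed
  then show "qRe \<kappa> = 0 \<and> norm \<kappa> = 1"
    using eq(1) by (simp add: norm_quat_def inner_quat_def)
next
  assume *: "qRe \<kappa> = 0 \<and> norm \<kappa> = 1"
  then have "inner \<kappa> \<kappa> = 1"
    by (simp flip: power2_norm_eq_inner)
  then show "\<kappa> \<in> qS"
    using * by (simp add: qS_def power2_eq_square quat_eq_iff inner_quat_def)
qed

lemma norm_quat_sq: "(norm (x::quat))\<^sup>2 = (qRe x)\<^sup>2 + (qI x)\<^sup>2 + (qJ x)\<^sup>2 + (qK x)\<^sup>2"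
  unfolding power2_norm_eq_inner inner_quat_def by (simp add: power2_eq_square)

lemma qRe_slice: "\<kappa> \<in> qS \<Longrightarrow> qRe (of_real a + \<kappa> * of_real b) = a"
  by (simp add: qS_iff)

lemma norm_slice:
  assumes "\<kappa> \<in> qS"
  shows "(norm (of_real a + \<kappa> * of_real b))\<^sup>2 = a\<^sup>2 + b\<^sup>2"
proof -
  have "qRe \<kappa> = 0" "(norm \<kappa>)\<^sup>2 = 1"
    using assms by (auto simp: qS_iff)
  then have 1: "(qI \<kappa>)\<^sup>2 + (qJ \<kappa>)\<^sup>2 + (qK \<kappa>)\<^sup>2 = 1"
    by (simp add: norm_quat_sq)
  have "(norm (of_real a + \<kappa> * of_real b))\<^sup>2 = a\<^sup>2 + ((qI \<kappa>)\<^sup>2 + (qJ \<kappa>)\<^sup>2 + (qK \<kappa>)\<^sup>2) * b\<^sup>2"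
    unfolding norm_quat_sq using \<open>qRe \<kappa> = 0\<close> by (simp add: power_mult_distrib algebra_simps)
  then show ?thesis by (simp add: 1)
qed

lemma slice_diff: "(of_real a + \<kappa> * of_real b) - (of_real c + \<kappa> * of_real d) = of_real (a - c) + \<kappa> * of_real (b - d)"
  for \<kappa> :: quat
  by (simp add: quat_eq_iff algebra_simps)

lemma slice_eq_iff:
  assumes "\<kappa> \<in> qS"
  shows "of_real a + \<kappa> * of_real b = of_real c + \<kappa> * of_real d \<longleftrightarrow> a = c \<and> b = d"
proof
  assume "of_real a + \<kappa> * of_real b = of_real c + \<kappa> * of_real d"
  then have "(a - c)\<^sup>2 + (b - d)\<^sup>2 = 0"
    using norm_slice [OF assms, of "a - c" "b - d"] slice_diff [of a \<kappa> b c d] by simp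
  then show "a = c \<and> b = d"
    by (simp add: sum_power2_eq_zero_iff)
qed simp

lemma qcnj_slice: "\<kappa> \<in> qS \<Longrightarrow> qcnj (of_real a + \<kappa> * of_real b) = of_real a + \<kappa> * of_real (- b)"
  by (simp add: quat_eq_iff qS_iff)

lemma slice_iso_slice: "\<kappa> \<in> qS \<Longrightarrow> slice_iso \<kappa> (of_real a + \<kappa> * of_real b) = Complex a b"
  unfolding slice_iso_def by (rule the_equality) (auto simp: slice_eq_iff complex_eq_iff)

lemma Cslice_posE:
  assumes "z \<in> Cslice_pos \<kappa>"
  obtains a b where "z = of_real a + \<kappa> * of_real b" "b \<ge> 0"
  using assms by (auto simp: Cslice_pos_def)

text \<open>The two real coordinates of a point of the slice are its inner products with 1 and
  \<open>\<kappa>\<close>, so the half slice is described by continuous conditions.\<close>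

lemma closed_Cslice_pos:
  assumes "\<kappa> \<in> qS"
  shows "closed (Cslice_pos \<kappa>)"
proof -
  have "inner \<kappa> \<kappa> = 1" "qRe \<kappa> = 0"
    using assms by (auto simp: qS_iff simp flip: power2_norm_eq_inner)
  then have 1: "qI \<kappa> * qI \<kappa> + qJ \<kappa> * qJ \<kappa> + qK \<kappa> * qK \<kappa> = 1"
    by (simp add: inner_quat_def)
  have "inner \<kappa> (of_real a + \<kappa> * of_real b) = (qI \<kappa> * qI \<kappa> + qJ \<kappa> * qJ \<kappa> + qK \<kappa> * qK \<kappa>) * b" for a b
    using \<open>qRe \<kappa> = 0\<close> by (simp add: inner_quat_def algebra_simps)
  then have "inner \<kappa> (of_real a + \<kappa> * of_real b) = b" for a b
    by (simp add: 1)
  then have "Cslice_pos \<kappa> = {z. z = of_real (inner 1 z) + \<kappa> * of_real (inner \<kappa> z) \<and> inner \<kappa> z \<ge> 0}"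
    using qRe_slice [OF assms] by (auto simp: Cslice_pos_def inner_quat_def [of 1])
  also have "closed \<dots>"
    by (intro closed_Collect_conj closed_Collect_eq closed_Collect_le continuous_intros)
  finally show ?thesis .
qed

text \<open>The point in which the sphere of \<open>q\<close> meets the closed half slice of
  \<open>\<kappa>\<close>: the imaginary part is turned into the direction of
  \<open>\<kappa>\<close>.\<close>

definition sphere_rep :: "quat \<Rightarrow> quat \<Rightarrow> quat" where
  "sphere_rep \<kappa> q = of_real (qRe q) + \<kappa> * of_real (norm (q - of_real (qRe q)))"

lemma norm_quat_split: "(norm q)\<^sup>2 = (qRe q)\<^sup>2 + (norm (q - of_real (qRe q)))\<^sup>2"
  by (simp add: norm_quat_sq)

lemma sphere_rep_in: "sphere_rep \<kappa> q \<in> Cslice_pos \<kappa>"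
  unfolding sphere_rep_def Cslice_pos_def by (rule CollectI, intro exI conjI, rule refl, rule norm_ge_zero)

lemma qRe_sphere_rep: "\<kappa> \<in> qS \<Longrightarrow> qRe (sphere_rep \<kappa> q) = qRe q"
  unfolding sphere_rep_def by (rule qRe_slice)

lemma norm_sphere_rep:
  assumes "\<kappa> \<in> qS"
  shows "norm (sphere_rep \<kappa> q) = norm q"
proof -
  have "(norm (sphere_rep \<kappa> q))\<^sup>2 = (norm q)\<^sup>2"
    unfolding sphere_rep_def norm_slice [OF assms] by (rule norm_quat_split [symmetric])
  then show ?thesis by simp
qed

lemma sphere_rep_slice:
  assumes "\<kappa> \<in> qS" "\<kappa>' \<in> qS" "b \<ge> 0"
  shows "sphere_rep \<kappa> (of_real a + \<kappa>' * of_real b) = of_real a + \<kappa> * of_real b"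
  using assms by (simp add: sphere_rep_def qS_iff norm_mult)

lemma quat_polar:
  assumes "\<kappa> \<in> qS"
  obtains \<kappa>' where "\<kappa>' \<in> qS" "q = of_real (qRe q) + \<kappa>' * of_real (norm (q - of_real (qRe q)))"
proof (cases "q = of_real (qRe q)")
  \<comment> \<open>A real \<open>q\<close> determines no direction, so the given unit
    \<open>\<kappa>\<close> serves.\<close>
  case True
  then show ?thesis using that [OF assms] by simp
next
  case False
  define v where "v = q - of_real (qRe q)"
  have v: "v \<noteq> 0" "qRe v = 0" using False by (auto simp: v_def)
  have "v /\<^sub>R norm v \<in> qS"
    using v by (simp add: qS_iff)
  moreover have "(v /\<^sub>R norm v) * of_real (norm v) = v"
    using v(1) by (simp add: of_real_def)
  ultimately show ?thesis
    using that [of "v /\<^sub>R norm v"] by (simp add: v_def)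
qed

text \<open>A sphere meets the closed half slice in exactly one point, which decides membership. The
  inclusion of \<open>X\<close> in the half slice provides the sign \<open>b \<ge> 0\<close> under
  which \<open>sphere_rep\<close> returns the given point.\<close>

lemma circularization_slice_iff:
  assumes \<kappa>: "\<kappa> \<in> qS" and X: "X \<subseteq> Cslice_pos \<kappa>"
  shows "q \<in> circularization (slice_iso \<kappa> ` X) \<longleftrightarrow> sphere_rep \<kappa> q \<in> X"
proof
  assume "q \<in> circularization (slice_iso \<kappa> ` X)"
  then obtain c d \<kappa>' x where q: "q = of_real c + \<kappa>' * of_real d" "\<kappa>' \<in> qS" "x \<in> X" "Complex c d = slice_iso \<kappa> x"
    by (auto simp: circularization_def)
  moreover obtain a b where "x = of_real a + \<kappa> * of_real b" "b \<ge> 0"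
    using q(3) X by (meson Cslice_posE subsetD)
  ultimately show "sphere_rep \<kappa> q \<in> X"
    using \<kappa> by (simp add: slice_iso_slice sphere_rep_slice)
next
  assume *: "sphere_rep \<kappa> q \<in> X"
  obtain \<kappa>' where \<kappa>': "\<kappa>' \<in> qS" "q = of_real (qRe q) + \<kappa>' * of_real (norm (q - of_real (qRe q)))"
    using quat_polar [OF \<kappa>] by blast
  have "slice_iso \<kappa> (sphere_rep \<kappa> q) = Complex (qRe q) (norm (q - of_real (qRe q)))"
    unfolding sphere_rep_def by (rule slice_iso_slice [OF \<kappa>])
  then have "Complex (qRe q) (norm (q - of_real (qRe q))) \<in> slice_iso \<kappa> ` X"
    using * by (metis imageI)
  then show "q \<in> circularization (slice_iso \<kappa> ` X)"
    unfolding circularization_def using \<kappa>' by blast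
qed

definition sph :: "quat \<Rightarrow> quat \<Rightarrow> quat" where
  "sph q z = z * z - z * of_real (2 * qRe q) + of_real ((norm q)\<^sup>2)"

lemma sph_sphere_rep: "\<kappa> \<in> qS \<Longrightarrow> sph (sphere_rep \<kappa> q) = sph q"
  by (simp add: sph_def fun_eq_iff qRe_sphere_rep norm_sphere_rep)

lemma sph_self: "sph q q = 0"
  by (simp add: sph_def quat_eq_iff power2_norm_eq_inner inner_quat_def algebra_simps)

lemma slice_commute:
  assumes "z \<in> Cslice_pos \<kappa>" "q \<in> Cslice_pos \<kappa>"
  shows "z * q = q * z"
  using assms by (elim Cslice_posE) (simp add: quat_eq_iff algebra_simps)

lemma norm_sph:
  assumes "z \<in> Cslice_pos \<kappa>" "q \<in> Cslice_pos \<kappa>"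
  shows "norm (sph q z) = norm (z - q) * norm (z - qcnj q)"
proof -
  have "q + qcnj q = of_real (2 * qRe q)" "q * qcnj q = of_real ((norm q)\<^sup>2)"
    by (simp_all add: quat_eq_iff power2_norm_eq_inner inner_quat_def)
  then have "sph q z = z * z - z * (q + qcnj q) + q * qcnj q"
    by (simp add: sph_def)
  \<comment> \<open>The product contains the term \<open>q * z\<close>, which equals
    \<open>z * q\<close> because both points lie in one slice.\<close>
  also have "\<dots> = (z - q) * (z - qcnj q)"
    by (simp add: algebra_simps slice_commute [OF assms])
  finally show ?thesis by (simp add: norm_mult)
qed

text \<open>\<open>z\<close> and \<open>q\<close> lie on the same side of the real axis and
  \<open>qcnj q\<close> on the other one: the imaginary coordinates satisfy
  \<open>b, d \<ge> 0\<close>.\<close>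

lemma norm_diff_le_qcnj:
  assumes "\<kappa> \<in> qS" "z \<in> Cslice_pos \<kappa>" "q \<in> Cslice_pos \<kappa>"
  shows "norm (z - q) \<le> norm (z - qcnj q)"
proof -
  obtain a b c d where z: "z = of_real a + \<kappa> * of_real b" "b \<ge> 0" and q: "q = of_real c + \<kappa> * of_real d" "d \<ge> 0"
    using assms(2,3) by (elim Cslice_posE)
  have "(norm (z - q))\<^sup>2 = (a - c)\<^sup>2 + (b - d)\<^sup>2" "(norm (z - qcnj q))\<^sup>2 = (a - c)\<^sup>2 + (b + d)\<^sup>2"
    unfolding z(1) q(1) qcnj_slice [OF assms(1)] slice_diff norm_slice [OF assms(1)] by simp_all
  moreover have "(b - d)\<^sup>2 \<le> (b + d)\<^sup>2"
    using z(2) q(2) by (simp add: power2_eq_square algebra_simps)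
  ultimately show ?thesis
    by (intro power2_le_imp_le [OF _ norm_ge_zero]) linarith
qed

lemma norm_power2_le_sph: "(norm z)\<^sup>2 \<le> 2 * norm (sph q z) + 6 * (norm q)\<^sup>2"
proof -
  let ?n = "norm z" and ?r = "norm q"
  have "z * z = sph q z + z * of_real (2 * qRe q) - of_real (?r\<^sup>2)"
    by (simp add: sph_def)
  then have "?n * ?n = norm (sph q z + z * of_real (2 * qRe q) - of_real (?r\<^sup>2))"
    by (metis norm_mult)
  also have "\<dots> \<le> norm (sph q z) + norm (z * of_real (2 * qRe q)) + norm (of_real (?r\<^sup>2) :: quat)"
    by (intro order.trans [OF norm_triangle_ineq4] add_mono norm_triangle_ineq order_refl)
  also have "\<dots> = norm (sph q z) + ?n * (2 * \<bar>qRe q\<bar>) + ?r\<^sup>2"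
    by (simp add: norm_mult norm_power abs_mult)
  also have "\<dots> \<le> norm (sph q z) + ?n * (2 * ?r) + ?r\<^sup>2"
    by (intro add_mono mult_left_mono order_refl abs_qcomp_le_norm) auto
  finally have "?n\<^sup>2 \<le> norm (sph q z) + 2 * (?n * ?r) + ?r\<^sup>2"
    by (simp add: power2_eq_square)
  \<comment> \<open>The mixed term is split so that only half of \<open>?n\<^sup>2\<close> is used
    up. The other half stays on the left, and doubling produces the constants 2 and 6.\<close>
  moreover have "2 * (?n * ?r) \<le> ?n\<^sup>2 / 2 + 2 * ?r\<^sup>2"
    using zero_le_power2 [of "?n - 2 * ?r"] by (simp add: power2_eq_square algebra_simps)
  ultimately show ?thesis by linarith
qed

section \<open>Both operator families as integrals\<close>

context iqpvm
begin

abbreviation "T\<^sub>Q \<equiv> qint \<iota> Q L (\<lambda>z. z)"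

lemma measurable_id [simp]: "(\<lambda>z. z) \<in> borel_measurable M"
  unfolding borel_slice_def by (rule measurable_restrict_space1) simp

lemma measurable_translate [simp]: "(\<lambda>z. z - q) \<in> borel_measurable M"
  by (intro borel_measurable_diff measurable_id) simp

lemma measurable_square [simp]: "(\<lambda>z. z * z) \<in> borel_measurable M"
  by (intro borel_measurable_times measurable_id)

lemma measurable_sph [simp]: "sph q \<in> borel_measurable M"
  unfolding sph_def by (intro borel_measurable_diff borel_measurable_add borel_measurable_times measurable_id) simp_all

text \<open>\<open>z\<close> and \<open>z - q\<close> are bounded on the same sets, so both graphs
  are tested on the same sets, where the integrals differ by \<open>L q (Q E u)\<close>.\<close>

lemma left_op_qint: "left_op L T\<^sub>Q q = qint \<iota> Q L (\<lambda>z. z - q)"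
proof (rule ext, rule option_eqI)
  fix u w
  have bdd: "bounded_on (\<lambda>z. z - q) E \<longleftrightarrow> bounded_on (\<lambda>z. z) E" for E
    unfolding bounded_on_def using bounded_translation [of "E" "- q"] bounded_translation [of "(\<lambda>z. z - q) ` E" q]
    by (auto simp: image_image)
  have "left_op L T\<^sub>Q q u = Some w \<longleftrightarrow> T\<^sub>Q u = Some (w + L q u)"
    by (auto simp: left_op_def op_diff_def)
  also have "\<dots> \<longleftrightarrow> qint_graph (\<lambda>z. z - q) u w"
    unfolding qint_iff [OF measurable_id] qint_graph_def bdd
  proof (intro all_cong1 imp_cong refl)
    fix E assume E: "bounded_on (\<lambda>z. z) E"
    have "\<Phi> (cutoff E (\<lambda>z. (z - q) + q)) u = \<Phi> (cutoff E (\<lambda>z. z - q)) u + \<Phi> (cutoff E (\<lambda>_. q)) u"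
      using E by (intro cutoff_add) (simp_all add: bdd bounded_onD)
    then show "\<Phi> (cutoff E (\<lambda>z. z)) u = Q E (w + L q u) \<longleftrightarrow> \<Phi> (cutoff E (\<lambda>z. z - q)) u = Q E w"
      by (simp add: cutoff_const bounded_onD [OF E] Q_add Q_L)
  qed
  also have "\<dots> \<longleftrightarrow> qint \<iota> Q L (\<lambda>z. z - q) u = Some w"
    by (simp add: qint_iff)
  finally show "left_op L T\<^sub>Q q u = Some w \<longleftrightarrow> qint \<iota> Q L (\<lambda>z. z - q) u = Some w" .
qed

lemma qint_scaleQ:
  assumes f: "f \<in> borel_measurable M" and "qint \<iota> Q L f u = Some v"
  shows "qint \<iota> Q L f (u *\<^sub>q p) = Some (v *\<^sub>q p)"
  using assms(2) cutoff_bounded_qlinear [OF f] Q_scaleQ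
  unfolding qint_iff [OF f] qint_graph_def bounded_qlinear_def by (simp add: bounded_onD [of f])

text \<open>Turns integrability of \<open>z\<close> and \<open>z * z\<close> into membership in the
  domain of the composition. On the levels of the identity both integrands are bounded, and one
  bounded integral is the square of the other.\<close>

lemma qint_square:
  assumes "T\<^sub>Q u = Some v" "qint \<iota> Q L (\<lambda>z. z * z) u = Some y"
  shows "T\<^sub>Q v = Some y"
  unfolding qint_iff [OF measurable_id]
proof (rule qint_graphI [where A = "level (\<lambda>z. z)"])
  fix n
  let ?E = "level (\<lambda>z. z) n"
  have E: "bounded_on (\<lambda>z. z) ?E" by (rule level_bounded) simp
  have E2: "bounded_on (\<lambda>z. z * z) ?E"
    by (rule bounded_onI [OF bounded_onD [OF E], where K = "real n * real n"])
      (auto simp: level_def norm_mult intro!: mult_mono)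
  have "\<Phi> (cutoff ?E (\<lambda>z. z)) v = \<Phi> (cutoff ?E (\<lambda>z. z)) (Q ?E v)"
    by (simp add: cutoff_Q E bounded_onD [OF E])
  also have "Q ?E v = \<Phi> (cutoff ?E (\<lambda>z. z)) u"
    using assms(1) E by (simp add: qint_iff qint_graph_def)
  also have "\<Phi> (cutoff ?E (\<lambda>z. z)) \<dots> = \<Phi> (cutoff ?E (\<lambda>z. z * z)) u"
    using cutoff_mult [OF measurable_id E measurable_id E] by simp
  also have "\<dots> = Q ?E y"
    using assms(2) E2 by (subst (asm) qint_iff) (auto simp: qint_graph_def intro!: borel_measurable_times)
  finally show "\<Phi> (cutoff ?E (\<lambda>z. z)) v = Q ?E y" .
qed (auto simp: level_bounded level_exhaust incseq_def dest: level_mono)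

lemma qint_sph:
  assumes v: "T\<^sub>Q u = Some v" and y: "T\<^sub>Q v = Some y"
  shows "qint \<iota> Q L (sph q) u = Some (y - v *\<^sub>q of_real (2 * qRe q) + u *\<^sub>q of_real ((norm q)\<^sup>2))"
  unfolding qint_iff [OF measurable_sph]
proof (rule qint_graphI [where A = "level (\<lambda>z. z)"])
  fix n
  let ?E = "level (\<lambda>z. z) n"
  define r where "r = 2 * qRe q"
  define s where "s = (norm q)\<^sup>2"
  have E: "bounded_on (\<lambda>z. z) ?E" by (rule level_bounded) simp
  note ES = bounded_onD [OF E]
  have le: "norm z \<le> real n" if "z \<in> ?E" for z
    using that by (simp add: level_def)
  have E2: "bounded_on (\<lambda>z. z * z) ?E"
    by (rule bounded_onI [OF ES, where K = "real n * real n"])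
      (auto simp: le norm_mult intro!: mult_mono)
  have Er: "bounded_on (\<lambda>z. z * of_real (- r)) ?E"
    by (rule bounded_onI [OF ES, where K = "real n * \<bar>r\<bar>"])
      (auto simp: le norm_mult intro!: mult_right_mono)
  have E3: "bounded_on (\<lambda>z. z * z + z * of_real (- r)) ?E"
    by (rule bounded_onI [OF ES, where K = "real n * real n + real n * \<bar>r\<bar>"])
      (auto simp: le norm_mult intro!: order.trans [OF norm_triangle_ineq] order.trans [OF norm_triangle_ineq4] add_mono mult_mono)
  have sph: "sph q = (\<lambda>z. (z * z + z * of_real (- r)) + of_real s)"
    by (simp add: sph_def r_def s_def fun_eq_iff)
  show "bounded_on (sph q) ?E"
    unfolding sph
    by (rule bounded_onI [OF ES, where K = "real n * real n + real n * \<bar>r\<bar> + \<bar>s\<bar>"])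
      (auto simp: le norm_mult intro!: order.trans [OF norm_triangle_ineq] order.trans [OF norm_triangle_ineq4] add_mono mult_mono)
  have zu: "\<Phi> (cutoff ?E (\<lambda>z. z)) u = Q ?E v" and zv: "\<Phi> (cutoff ?E (\<lambda>z. z)) v = Q ?E y"
    using v y E by (simp_all add: qint_iff qint_graph_def)
  have "\<Phi> (cutoff ?E (\<lambda>z. z * z)) u = \<Phi> (cutoff ?E (\<lambda>z. z)) (\<Phi> (cutoff ?E (\<lambda>z. z)) u)"
    using cutoff_mult [OF measurable_id E measurable_id E] by simp
  also have "\<dots> = Q ?E y"
    using zv by (simp add: zu cutoff_Q E ES)
  finally have 1: "\<Phi> (cutoff ?E (\<lambda>z. z * z)) u = Q ?E y" .
  \<comment> \<open>Real scalars act on vectors as \<open>L (of_real _)\<close>, so they can be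
    absorbed into the integrand.\<close>
  have "\<Phi> (cutoff ?E (\<lambda>z. z * of_real (- r))) u = \<Phi> (cutoff ?E (\<lambda>z. z)) ((- r) *\<^sub>R u)"
    unfolding L_of_real [symmetric] by (rule cutoff_L [symmetric]) (simp_all add: E)
  also have "\<dots> = (- r) *\<^sub>R Q ?E v"
    using cutoff_bounded_qlinear [OF measurable_id E]
    by (simp add: bounded_qlinear_def linear_scale [OF bounded_linear.linear] linear_neg [OF bounded_linear.linear] zu)
  finally have 2: "\<Phi> (cutoff ?E (\<lambda>z. z * of_real (- r))) u = (- r) *\<^sub>R Q ?E v" .
  have 3: "\<Phi> (cutoff ?E (\<lambda>z. of_real s)) u = s *\<^sub>R Q ?E u"
    by (simp add: cutoff_const ES L_of_real)
  have m: "(\<lambda>z. z * z) \<in> borel_measurable M" "(\<lambda>z. z * of_real (- r)) \<in> borel_measurable M"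
    by (intro borel_measurable_times measurable_id, simp)+
  have "\<Phi> (cutoff ?E (sph q)) u =
      \<Phi> (cutoff ?E (\<lambda>z. z * z + z * of_real (- r))) u + \<Phi> (cutoff ?E (\<lambda>z. of_real s)) u"
    unfolding sph by (rule cutoff_add) (intro borel_measurable_add m E3, simp_all add: ES E3 del: of_real_minus)
  also have "\<Phi> (cutoff ?E (\<lambda>z. z * z + z * of_real (- r))) u =
      \<Phi> (cutoff ?E (\<lambda>z. z * z)) u + \<Phi> (cutoff ?E (\<lambda>z. z * of_real (- r))) u"
    by (rule cutoff_add [OF m(1) E2 m(2) Er])
  finally have "\<Phi> (cutoff ?E (sph q)) u = Q ?E y + (- r) *\<^sub>R Q ?E v + s *\<^sub>R Q ?E u"
    unfolding 1 2 3 .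
  also have "\<dots> = Q ?E (y - v *\<^sub>q of_real r + u *\<^sub>q of_real s)"
    by (simp add: Q_add Q_diff Q_scaleR ES flip: scaleR_eq_scaleQ)
  finally show "\<Phi> (cutoff ?E (sph q)) u =
      Q ?E (y - v *\<^sub>q of_real (2 * qRe q) + u *\<^sub>q of_real ((norm q)\<^sup>2))"
    by (simp add: r_def s_def)
qed (auto simp: level_bounded level_exhaust incseq_def dest: level_mono)

lemma spherical_op_eq_Some_iff:
  "spherical_op T\<^sub>Q q u = Some w \<longleftrightarrow> (\<exists>v y. T\<^sub>Q u = Some v \<and> T\<^sub>Q v = Some y \<and>
     w = y - v *\<^sub>q of_real (2 * qRe q) + u *\<^sub>q of_real ((norm q)\<^sup>2))"
  using qint_scaleQ [OF measurable_id, of u _ "of_real (2 * qRe q)"]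
  by (auto simp: spherical_op_def op_add_def op_diff_def op_scalar_def map_comp_def dom_def
      split: option.splits if_splits)

text \<open>One inclusion of graphs is \<open>qint_sph\<close>. The other one must place
  \<open>u\<close> in the domain of the square of the operator, which is obtained by comparing
  integrands: \<open>sph q\<close> controls \<open>z * z\<close>, and this controls
  \<open>z\<close>.\<close>

lemma spherical_op_qint: "spherical_op T\<^sub>Q q = qint \<iota> Q L (sph q)"
proof (rule ext, rule option_eqI)
  fix u w
  show "spherical_op T\<^sub>Q q u = Some w \<longleftrightarrow> qint \<iota> Q L (sph q) u = Some w"
  proof
    assume "spherical_op T\<^sub>Q q u = Some w"
    then show "qint \<iota> Q L (sph q) u = Some w"
      using qint_sph by (auto simp: spherical_op_eq_Some_iff)
  next
    assume w: "qint \<iota> Q L (sph q) u = Some w"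
    then have u: "u \<in> dom (qint \<iota> Q L (sph q))" by auto
    \<comment> \<open>The square of \<open>norm_power2_le_sph\<close>, expanded with the inequality
      (x + y)^2 <= 2 x^2 + 2 y^2.\<close>
    have "(norm (z * z))\<^sup>2 \<le> 72 * (norm q) ^ 4 + 8 * (norm (sph q z))\<^sup>2" for z
    proof -
      have "(norm (z * z))\<^sup>2 = ((norm z)\<^sup>2)\<^sup>2"
        by (simp only: norm_mult power2_eq_square)
      also have "\<dots> \<le> (2 * norm (sph q z) + 6 * (norm q)\<^sup>2)\<^sup>2"
        by (intro power_mono norm_power2_le_sph) simp
      also have "\<dots> \<le> 2 * (2 * norm (sph q z))\<^sup>2 + 2 * (6 * (norm q)\<^sup>2)\<^sup>2"
        using zero_le_power2 [of "2 * norm (sph q z) - 6 * (norm q)\<^sup>2"] by (simp add: power2_eq_square algebra_simps)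
      also have "\<dots> = 72 * (norm q) ^ 4 + 8 * (norm (sph q z))\<^sup>2"
        by (simp add: power_mult_distrib)
      finally show ?thesis .
    qed
    from qint_domain_mono [OF measurable_sph _ this u]
    obtain y where y: "qint \<iota> Q L (\<lambda>z. z * z) u = Some y"
      by auto
    have "(norm z)\<^sup>2 \<le> 1 + 1 * (norm (z * z))\<^sup>2" for z :: quat
    proof -
      have "(norm (z * z))\<^sup>2 = ((norm z)\<^sup>2)\<^sup>2"
        by (simp only: norm_mult power2_eq_square)
      moreover have "2 * (norm z)\<^sup>2 \<le> 1 + ((norm z)\<^sup>2)\<^sup>2"
        using zero_le_power2 [of "(norm z)\<^sup>2 - 1"] unfolding power2_diff by simp
      ultimately show ?thesis
        using zero_le_power2 [of "norm z"] by linarith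
    qed
    then have "u \<in> dom T\<^sub>Q"
      using qint_domain_mono [of "\<lambda>z. z * z" 1 "\<lambda>z. z" 1 u] y
      by (simp add: domI)
    then obtain v where v: "T\<^sub>Q u = Some v" by auto
    note vy = qint_square [OF v y]
    show "spherical_op T\<^sub>Q q u = Some w"
      using qint_sph [OF v vy, of q] w v vy by (auto simp: spherical_op_eq_Some_iff)
  qed
qed

end

section \<open>The spectra of the integral of the identity\<close>

locale iqpvm_slice = iqpvm L \<iota> Q for L :: "quat \<Rightarrow> 'h::quat_hilbert_space \<Rightarrow> 'h" and \<iota> Q +
  assumes \<iota>: "\<iota> \<in> qS"
begin

lemma zeros_translate: "zeros (\<lambda>z. z - q) = (if q \<in> C then {q} else {})"
  by (auto simp: zeros_def)

lemma zeros_sph: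
  assumes "q \<in> C"
  shows "zeros (sph q) = {q}"
proof -
  have "z = q" if "z \<in> C" "sph q z = 0" for z
    using norm_sph [OF that(1) assms] norm_diff_le_qcnj [OF \<iota> that(1) assms] that(2) by auto
  then show ?thesis
    using assms sph_self by (auto simp: zeros_def)
qed

lemma bounded_below_translate_outside:
  assumes "q \<notin> C"
  shows "bounded_below (\<lambda>z. z - q)"
proof -
  have "open (- C)"
    using closed_Cslice_pos [OF \<iota>] by (simp add: open_Compl)
  then obtain e where "e > 0" "ball q e \<subseteq> - C"
    using assms by (meson ComplI open_contains_ball)
  then have "{z\<in>C. norm (z - q) < e} = {}"
    by (fastforce simp: subset_eq dist_norm norm_minus_commute)
  then show ?thesis
    using \<open>e > 0\<close> unfolding bounded_below_def null_set_def by (metis Q_empty)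
qed

lemma bounded_below_sph_iff:
  assumes q: "q \<in> C"
  shows "bounded_below (sph q) \<longleftrightarrow> bounded_below (\<lambda>z. z - q)"
proof
  assume "bounded_below (\<lambda>z. z - q)"
  then obtain c where c: "c > 0" "null_set {z\<in>C. norm (z - q) < c}"
    by (auto simp: bounded_below_def)
  \<comment> \<open>Where the distance to \<open>q\<close> is at least \<open>c\<close>, so is the
    distance to \<open>qcnj q\<close>; hence the threshold \<open>c * c\<close> for the
    product.\<close>
  have "norm (z - q) < c" if z: "z \<in> C" "norm (sph q z) < c * c" for z
  proof (rule ccontr)
    assume "\<not> norm (z - q) < c"
    then have "c * c \<le> norm (z - q) * norm (z - qcnj q)"
      using c(1) norm_diff_le_qcnj [OF \<iota> z(1) q] by (intro mult_mono) auto
    then show False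
      using z norm_sph [OF z(1) q] by simp
  qed
  then have "null_set {z\<in>C. norm (sph q z) < c * c}"
    by (intro null_set_subset [OF c(2)] measurable_sublevel measurable_sph measurable_translate) auto
  then show "bounded_below (sph q)"
    unfolding bounded_below_def using c(1) by (intro exI [of _ "c * c"]) simp
next
  assume "bounded_below (sph q)"
  then obtain c where c: "c > 0" "null_set {z\<in>C. norm (sph q z) < c}"
    by (auto simp: bounded_below_def)
  \<comment> \<open>\<open>a\<close> bounds the factor \<open>norm (z - qcnj q)\<close> on the unit
    ball around \<open>q\<close>. The minimum in \<open>d\<close> keeps \<open>z\<close> in that
    ball and makes the product smaller than \<open>c\<close>.\<close>
  define a where "a = 1 + norm (q - qcnj q)"
  have a: "a > 0" by (simp add: a_def add_pos_nonneg)
  define d where "d = min 1 (c / a)"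
  have d: "d > 0" "d \<le> 1" "d * a \<le> c"
    using a c(1) by (auto simp: d_def min_def field_simps)
  have "norm (sph q z) < c" if z: "z \<in> C" "norm (z - q) < d" for z
  proof -
    have "norm (z - qcnj q) \<le> norm (z - q) + norm (q - qcnj q)"
      using norm_triangle_ineq [of "z - q" "q - qcnj q"] by simp
    then have "norm (z - qcnj q) \<le> a"
      using z(2) d(2) by (simp add: a_def)
    then have "norm (z - q) * norm (z - qcnj q) \<le> norm (z - q) * a"
      by (intro mult_left_mono) auto
    also have "\<dots> < d * a"
      using z(2) a by simp
    finally show ?thesis
      using norm_sph [OF z(1) q] d(3) by simp
  qed
  then have "null_set {z\<in>C. norm (z - q) < d}"
    by (intro null_set_subset [OF c(2)] measurable_sublevel measurable_sph measurable_translate) auto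
  then show "bounded_below (\<lambda>z. z - q)"
    unfolding bounded_below_def using d(1) by blast
qed

lemma null_zeros_translate_outside: "q \<notin> C \<Longrightarrow> null_set (zeros (\<lambda>z. z - q))"
  by (simp add: zeros_translate null_set_def)

lemmas left_spectra = spectra_qint [of "left_op L T\<^sub>Q" "\<lambda>q z. z - q", OF left_op_qint measurable_translate]
lemmas spherical_spectra = spectra_qint [of "spherical_op T\<^sub>Q" sph, OF spherical_op_qint measurable_sph]

lemma spectra_eq:
  assumes "q \<in> C"
  shows "q \<in> sigma_L L T\<^sub>Q \<longleftrightarrow> q \<in> sigma_S T\<^sub>Q" "q \<in> sigma_pL L T\<^sub>Q \<longleftrightarrow> q \<in> sigma_pS T\<^sub>Q"
    "q \<in> sigma_cL L T\<^sub>Q \<longleftrightarrow> q \<in> sigma_cS T\<^sub>Q"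
  using assms by (simp_all add: spectrum_set_def left_spectra spherical_spectra bounded_below_sph_iff
      zeros_sph zeros_translate)

lemma left_spectra_subset: "sigma_L L T\<^sub>Q \<subseteq> C" "sigma_pL L T\<^sub>Q \<subseteq> C" "sigma_cL L T\<^sub>Q \<subseteq> C"
proof -
  have "\<not> bounded_below (\<lambda>z. z - q) \<Longrightarrow> q \<in> C" "\<not> null_set (zeros (\<lambda>z. z - q)) \<Longrightarrow> q \<in> C" for q
    using bounded_below_translate_outside [of q] null_zeros_translate_outside [of q] by blast+
  then show "sigma_L L T\<^sub>Q \<subseteq> C" "sigma_pL L T\<^sub>Q \<subseteq> C" "sigma_cL L T\<^sub>Q \<subseteq> C"
    by (simp_all add: subset_iff spectrum_set_def left_spectra)
qed

lemma spherical_spectra_rep: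
  "q \<in> sigma_S T\<^sub>Q \<longleftrightarrow> sphere_rep \<iota> q \<in> sigma_S T\<^sub>Q" "q \<in> sigma_pS T\<^sub>Q \<longleftrightarrow> sphere_rep \<iota> q \<in> sigma_pS T\<^sub>Q"
  "q \<in> sigma_cS T\<^sub>Q \<longleftrightarrow> sphere_rep \<iota> q \<in> sigma_cS T\<^sub>Q"
  by (simp_all add: spectrum_set_def spherical_spectra sph_sphere_rep [OF \<iota>])

lemma spherical_spectra_circularization:
  "sigma_S T\<^sub>Q = circularization (slice_iso \<iota> ` sigma_L L T\<^sub>Q)"
  "sigma_pS T\<^sub>Q = circularization (slice_iso \<iota> ` sigma_pL L T\<^sub>Q)"
  "sigma_cS T\<^sub>Q = circularization (slice_iso \<iota> ` sigma_cL L T\<^sub>Q)"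
  by (auto simp only: circularization_slice_iff [OF \<iota>] left_spectra_subset spectra_eq [OF sphere_rep_in]
      spherical_spectra_rep [symmetric])

lemma rho_L_eq:
  "rho_L L T\<^sub>Q = {q. bij_betw (\<lambda>u. the (left_op L T\<^sub>Q q u)) (dom (left_op L T\<^sub>Q q)) UNIV \<and>
     op_bounded (op_inv (left_op L T\<^sub>Q q))}"
proof (intro set_eqI iffI)
  fix q assume q: "q \<in> rho_L L T\<^sub>Q"
  then have "bounded_below (\<lambda>z. z - q)"
    by (simp add: left_spectra)
  from bounded_below_bij [OF measurable_translate this] q
  show "q \<in> {q. bij_betw (\<lambda>u. the (left_op L T\<^sub>Q q u)) (dom (left_op L T\<^sub>Q q)) UNIV \<and>
     op_bounded (op_inv (left_op L T\<^sub>Q q))}"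
    by (simp add: left_op_qint resolvent_set_def)
next
  fix q assume "q \<in> {q. bij_betw (\<lambda>u. the (left_op L T\<^sub>Q q u)) (dom (left_op L T\<^sub>Q q)) UNIV \<and>
     op_bounded (op_inv (left_op L T\<^sub>Q q))}"
  then have inj: "inj_on (\<lambda>u. the (left_op L T\<^sub>Q q u)) (dom (left_op L T\<^sub>Q q))"
    and surj: "(\<lambda>u. the (left_op L T\<^sub>Q q u)) ` dom (left_op L T\<^sub>Q q) = UNIV"
    and bdd: "op_bounded (op_inv (left_op L T\<^sub>Q q))"
    by (auto simp: bij_betw_def)
  \<comment> \<open>Shows that the operator is defined at 0 with value 0, which is what injectivity
    has to be compared with.\<close>
  have "0 \<in> range (Q (zeros (\<lambda>z. z - q)))"
    using Q_zero [OF zeros_sets [OF measurable_translate]] by (metis rangeI)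
  then have "left_op L T\<^sub>Q q 0 = Some 0"
    by (simp add: left_op_qint op_ker_def flip: ker_qint)
  then have "op_ker (left_op L T\<^sub>Q q) = {0}"
    using inj by (auto simp: op_ker_def inj_on_def dom_def)
  moreover have "ran (left_op L T\<^sub>Q q) = UNIV"
    using surj by (force simp: ran_def image_def dom_def)
  ultimately show "q \<in> rho_L L T\<^sub>Q"
    using bdd by (simp add: resolvent_set_def)
qed

lemma inv_left_op:
  assumes "q \<in> rho_L L T\<^sub>Q"
  shows "op_inv (left_op L T\<^sub>Q q) = qint \<iota> Q L (\<lambda>z. inverse (z - q))"
proof -
  have "bounded_below (\<lambda>z. z - q)"
    using assms by (simp add: left_spectra)
  then show ?thesis
    unfolding left_op_qint
    by (rule inv_qint [OF measurable_translate bounded_below_zeros [OF measurable_translate]])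
qed

lemma ker_left_op: "op_ker (left_op L T\<^sub>Q q) = (if q \<in> C then range (Q {q}) else {0})"
  unfolding left_op_qint ker_qint [OF measurable_translate] by (simp add: zeros_translate)

lemma ker_spherical_op: "q \<in> C \<Longrightarrow> op_ker (spherical_op T\<^sub>Q q) = range (Q {q})"
  unfolding spherical_op_qint ker_qint [OF measurable_sph] by (simp add: zeros_sph)

lemma ker_left_op_iff: "u \<in> op_ker (left_op L T\<^sub>Q q) \<longleftrightarrow> T\<^sub>Q u = Some (L q u)"
  by (auto simp: op_ker_def left_op_def op_diff_def)

section \<open>Eigenspaces and approximate eigenvectors\<close>

lemma singleton_sets: "q \<in> C \<Longrightarrow> {q} \<in> sets M"
  using zeros_sets [OF measurable_translate, of q] by (simp add: zeros_translate)

lemma range_Q_iff: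
  assumes "E \<in> sets M"
  shows "u \<in> range (Q E) \<longleftrightarrow> Q E u = u"
proof
  show "Q E u = u" if "u \<in> range (Q E)"
    using that assms by (auto simp: Q_Int)
qed (metis rangeI)

text \<open>On the two summands \<open>L \<iota>\<close> is right multiplication by
  \<open>\<iota>\<close> and by \<open>- \<iota>\<close>. By real linearity \<open>L q\<close>
  becomes right multiplication by \<open>q\<close> and by its conjugate.\<close>

lemma L_slice_eigenspace:
  assumes q: "q \<in> C"
  shows L_Hplus: "u \<in> Hplus L \<iota> \<Longrightarrow> L q u = u *\<^sub>q q" and L_Hminus: "u \<in> Hminus L \<iota> \<Longrightarrow> L q u = u *\<^sub>q qcnj q"
proof -
  obtain a b where ab: "q = of_real a + \<iota> * of_real b"
    using q by (elim Cslice_posE)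
  have L: "L q u = a *\<^sub>R u + b *\<^sub>R L \<iota> u"
    by (simp add: ab L_plus L_mult L_of_real L_scaleR)
  have R: "u *\<^sub>q (of_real a + \<iota> * of_real c) = a *\<^sub>R u + c *\<^sub>R (u *\<^sub>q \<iota>)" for c
    by (simp add: scaleQ_add_right scaleQ_mult scaleR_eq_scaleQ)
  show "L q u = u *\<^sub>q q" if "u \<in> Hplus L \<iota>"
    using that L R [of b] by (simp add: Hplus_def ab)
  show "L q u = u *\<^sub>q qcnj q" if "u \<in> Hminus L \<iota>"
    using that L R [of "- b"] unfolding ab qcnj_slice [OF \<iota>] by (simp add: Hminus_def)
qed

lemma comp_parts:
  "comp_plus L \<iota> u \<in> Hplus L \<iota>" "comp_minus L \<iota> u \<in> Hminus L \<iota>" "u = comp_plus L \<iota> u + comp_minus L \<iota> u"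
  using slice_decomposition [OF lsm \<iota>, of "comp_plus L \<iota> u" "comp_minus L \<iota> u" u] by auto

lemma T_add:
  assumes "T\<^sub>Q u = Some v" "T\<^sub>Q w = Some y"
  shows "T\<^sub>Q (u + w) = Some (v + y)"
proof -
  have "\<Phi> (cutoff E (\<lambda>z. z)) (u + w) = \<Phi> (cutoff E (\<lambda>z. z)) u + \<Phi> (cutoff E (\<lambda>z. z)) w"
    if "bounded_on (\<lambda>z. z) E" for E
    using cutoff_bounded_qlinear [OF measurable_id that]
    by (simp add: bounded_qlinear_def linear_add [OF bounded_linear.linear])
  then show ?thesis
    using assms by (simp add: qint_iff qint_graph_def Q_add bounded_onD [of "\<lambda>z. z"])
qed

lemma range_Q_singleton:
  assumes q: "q \<in> C"
  shows "range (Q {q}) = {u \<in> dom T\<^sub>Q. T\<^sub>Q (comp_plus L \<iota> u) = Some (comp_plus L \<iota> u *\<^sub>q q) \<and>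
    T\<^sub>Q (comp_minus L \<iota> u) = Some (comp_minus L \<iota> u *\<^sub>q qcnj q)}"
proof (intro equalityI subsetI)
  note E = singleton_sets [OF q]
  fix u assume u: "u \<in> range (Q {q})"
  then have Qu: "Q {q} u = u"
    by (simp add: range_Q_iff E)
  \<comment> \<open>\<open>Q {q}\<close> commutes with \<open>L \<iota>\<close> and with right
    scalars, so it fixes both components of a vector that it fixes.\<close>
  have "Q {q} (comp_plus L \<iota> u) = comp_plus L \<iota> u" "Q {q} (comp_minus L \<iota> u) = comp_minus L \<iota> u"
    unfolding comp_plus_def comp_minus_def
    by (simp_all add: Q_scaleR Q_add Q_diff Q_scaleQ Q_L E Qu)
  then have "T\<^sub>Q (comp_plus L \<iota> u) = Some (L q (comp_plus L \<iota> u))" "T\<^sub>Q (comp_minus L \<iota> u) = Some (L q (comp_minus L \<iota> u))"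
    "T\<^sub>Q u = Some (L q u)"
    using u q by (simp_all add: ker_left_op range_Q_iff E flip: ker_left_op_iff)
  then show "u \<in> {u \<in> dom T\<^sub>Q. T\<^sub>Q (comp_plus L \<iota> u) = Some (comp_plus L \<iota> u *\<^sub>q q) \<and>
      T\<^sub>Q (comp_minus L \<iota> u) = Some (comp_minus L \<iota> u *\<^sub>q qcnj q)}"
    using L_Hplus [OF q comp_parts(1)] L_Hminus [OF q comp_parts(2)] by auto
next
  fix u
  assume "u \<in> {u \<in> dom T\<^sub>Q. T\<^sub>Q (comp_plus L \<iota> u) = Some (comp_plus L \<iota> u *\<^sub>q q) \<and>
    T\<^sub>Q (comp_minus L \<iota> u) = Some (comp_minus L \<iota> u *\<^sub>q qcnj q)}"
  then have "T\<^sub>Q (comp_plus L \<iota> u) = Some (L q (comp_plus L \<iota> u))" "T\<^sub>Q (comp_minus L \<iota> u) = Some (L q (comp_minus L \<iota> u))"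
    using L_Hplus [OF q comp_parts(1)] L_Hminus [OF q comp_parts(2)] by auto
  from T_add [OF this] have "T\<^sub>Q u = Some (L q u)"
    by (metis comp_parts(3) L_add)
  then show "u \<in> range (Q {q})"
    using q by (simp add: ker_left_op flip: ker_left_op_iff)
qed

text \<open>For a right eigenvector all scalars collect on the right, so the spherical operator maps
  \<open>u\<close> to \<open>u *\<^sub>q sph q q = 0\<close>, and its kernel is that of the left
  operator.\<close>

lemma eigenvector_in_ker:
  assumes q: "q \<in> C" and u: "T\<^sub>Q u = Some (u *\<^sub>q q)"
  shows "u \<in> op_ker (left_op L T\<^sub>Q q)"
proof -
  have "u *\<^sub>q q *\<^sub>q q - u *\<^sub>q q *\<^sub>q of_real (2 * qRe q) + u *\<^sub>q of_real ((norm q)\<^sup>2) = u *\<^sub>q sph q q"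
    by (simp add: sph_def scaleQ_add_right scaleQ_diff_right scaleQ_mult)
  then have "u \<in> op_ker (spherical_op T\<^sub>Q q)"
    unfolding op_ker_def
    using u qint_scaleQ [OF measurable_id u, of q] by (auto simp: spherical_op_eq_Some_iff sph_self)
  then show ?thesis
    using ker_spherical_op [OF q] q by (simp add: ker_left_op)
qed

text \<open>The kernel is invariant under right multiplication by every \<open>p\<close>, whereas
  \<open>u *\<^sub>q p\<close> is again an eigenvector for \<open>q\<close> only if \<open>p\<close>
  and \<open>q\<close> commute, provided \<open>u \<noteq> 0\<close>. Equality thus forces
  \<open>q\<close> to commute with all quaternions, and commuting with two of the standard units
  already makes it real.\<close>

lemma eigenspace_eq_ker_iff:
  assumes "q \<in> sigma_pL L T\<^sub>Q"
  shows "{u \<in> dom T\<^sub>Q. T\<^sub>Q u = Some (u *\<^sub>q q)} = op_ker (left_op L T\<^sub>Q q) \<longleftrightarrow> q \<in> \<real>"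
proof
  have q: "q \<in> C"
    using assms left_spectra_subset by blast
  assume eq: "{u \<in> dom T\<^sub>Q. T\<^sub>Q u = Some (u *\<^sub>q q)} = op_ker (left_op L T\<^sub>Q q)"
  have "0 \<in> range (Q {q})"
    by (simp add: range_Q_iff singleton_sets q)
  then obtain u where u: "u \<in> op_ker (left_op L T\<^sub>Q q)" "u \<noteq> 0"
    using assms q by (auto simp: point_spectrum_def ker_left_op)
  have comm: "p * q = q * p" for p
  proof -
    have "u *\<^sub>q p \<in> op_ker (left_op L T\<^sub>Q q)"
      using u(1) q by (simp add: ker_left_op range_Q_iff singleton_sets Q_scaleQ)
    then have 1: "T\<^sub>Q (u *\<^sub>q p) = Some (u *\<^sub>q p *\<^sub>q q)"
      unfolding eq [symmetric] by simp
    have "T\<^sub>Q u = Some (u *\<^sub>q q)"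
      using u(1) unfolding eq [symmetric] by simp
    then have "T\<^sub>Q (u *\<^sub>q p) = Some (u *\<^sub>q q *\<^sub>q p)"
      by (rule qint_scaleQ [OF measurable_id])
    with 1 have "u *\<^sub>q (p * q - q * p) = 0"
      by (simp add: scaleQ_diff_right scaleQ_mult)
    then have "norm u * norm (p * q - q * p) = 0"
      unfolding norm_scaleQ [symmetric] by simp
    then show ?thesis
      using u(2) by simp
  qed
  have "q = of_real (qRe q)"
    using comm [of "Quat 0 1 0 0"] comm [of "Quat 0 0 1 0"] by (simp add: quat_eq_iff)
  then show "q \<in> \<real>"
    by (metis Reals_of_real)
next
  assume "q \<in> \<real>"
  then have "L q u = u *\<^sub>q q" for u
    by (auto elim!: Reals_cases simp: L_of_real scaleR_eq_scaleQ)
  then show "{u \<in> dom T\<^sub>Q. T\<^sub>Q u = Some (u *\<^sub>q q)} = op_ker (left_op L T\<^sub>Q q)"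
    by (auto simp: ker_left_op_iff)
qed

text \<open>Any unit vector in the range of \<open>Q F\<close> works. That range is non-zero because
  the integrand is not bounded below, and the radius \<open>\<epsilon> / 2\<close> turns the weak
  estimate into a strict one.\<close>

lemma approximate_eigenvector:
  assumes q: "q \<in> sigma_cL L T\<^sub>Q" and "\<epsilon> > 0"
  shows "\<exists>u\<in>dom T\<^sub>Q. norm u = 1 \<and> norm (the (T\<^sub>Q u) - L q u) < \<epsilon>"
proof -
  define F where "F = {z\<in>C. norm (z - q) < \<epsilon> / 2}"
  have pos: "\<epsilon> / 2 > 0" using \<open>\<epsilon> > 0\<close> by simp
  have F: "F \<in> sets M"
    unfolding F_def by (rule measurable_sublevel(2) [OF measurable_translate])
  have "\<not> null_set F"
    using q pos unfolding left_spectra bounded_below_def F_def by blast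
  then obtain x where x: "Q F x \<noteq> 0"
    by (auto simp: null_set_def)
  define w where "w = x /\<^sub>R norm (Q F x)"
  define u where "u = Q F w"
  have norm: "norm u = 1"
    using x by (simp add: u_def w_def Q_scaleR [OF F])
  let ?y = "\<Phi> (cutoff F (\<lambda>z. z - q)) w"
  have "left_op L T\<^sub>Q q u = Some ?y"
    unfolding left_op_qint u_def F_def
    by (intro qint_cutoff norm_cutoff_sublevel(1) [OF measurable_translate pos] measurable_translate)
  then have "u \<in> dom T\<^sub>Q" "the (T\<^sub>Q u) - L q u = ?y"
    by (auto simp: left_op_def op_diff_def split: if_splits)
  moreover have "norm ?y \<le> \<epsilon> / 2 * norm u"
    using norm_cutoff_sublevel(2) [OF measurable_translate pos] by (simp only: F_def u_def)
  ultimately show ?thesis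
    using norm \<open>\<epsilon> > 0\<close> by auto
qed

end

theorem theorem7p2:
  fixes T :: "'h::quat_hilbert_space op"
    and \<iota> :: quat
    and Q :: "quat set \<Rightarrow> 'h \<Rightarrow> 'h"
    and L :: "quat \<Rightarrow> 'h \<Rightarrow> 'h"
  assumes "operator T" and "op_closed T" and "op_normal T" and "closure (dom T) = UNIV"
    and "\<iota> \<in> qS"
    and "iqPVM \<iota> Q L"
    and "T = qint \<iota> Q L (\<lambda>z. z)"
  shows
    "rho_L L T = {q. bij_betw (\<lambda>u. the (left_op L T q u)) (dom (left_op L T q)) UNIV \<and>
                     op_bounded (op_inv (left_op L T q))} \<and>
     (\<forall>q\<in>rho_L L T. op_inv (left_op L T q) = qint \<iota> Q L (\<lambda>z. inverse (z - q))) \<and>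
     sigma_L L T = sigma_S T \<inter> Cslice_pos \<iota> \<and>
     sigma_pL L T = sigma_pS T \<inter> Cslice_pos \<iota> \<and>
     sigma_rL L T = {} \<and> sigma_rS T = {} \<and>
     sigma_cL L T = sigma_cS T \<inter> Cslice_pos \<iota> \<and>
     sigma_S T = circularization (slice_iso \<iota> ` sigma_L L T) \<and>
     sigma_pS T = circularization (slice_iso \<iota> ` sigma_pL L T) \<and>
     sigma_cS T = circularization (slice_iso \<iota> ` sigma_cL L T) \<and>
     \<comment> \<open>(a)\<close>
     (\<forall>q\<in>Cslice_pos \<iota>. range (Q {q}) = op_ker (left_op L T q) \<and>
                     op_ker (left_op L T q) = op_ker (spherical_op T q)) \<and>
     (\<forall>q. q \<notin> Cslice_pos \<iota> \<longrightarrow> op_ker (left_op L T q) = {0}) \<and>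
     \<comment> \<open>(b)\<close>
     (\<forall>q\<in>Cslice_pos \<iota>. range (Q {q}) =
        {u \<in> dom T. T (comp_plus L \<iota> u) = Some (comp_plus L \<iota> u *\<^sub>q q) \<and>
                    T (comp_minus L \<iota> u) = Some (comp_minus L \<iota> u *\<^sub>q qcnj q)}) \<and>
     \<comment> \<open>(c)\<close>
     (\<forall>q\<in>sigma_pL L T. {u \<in> dom T. T u = Some (u *\<^sub>q q)} \<subseteq> op_ker (left_op L T q)) \<and>
     (\<forall>q\<in>Cslice_pos \<iota>. \<forall>u. u \<noteq> 0 \<and> T u = Some (u *\<^sub>q q) \<longrightarrow> u *\<^sub>q q = L q u) \<and>
     (\<forall>q\<in>sigma_pL L T. {u \<in> dom T. T u = Some (u *\<^sub>q q)} = op_ker (left_op L T q) \<longleftrightarrow> q \<in> \<real>) \<and>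
     \<comment> \<open>(d)\<close>
     (\<forall>q\<in>sigma_cL L T. \<forall>\<epsilon>>0. \<exists>u\<in>dom T. norm u = 1 \<and> norm (the (T u) - L q u) < \<epsilon>)"
proof -
  interpret iqpvm_slice L \<iota> Q
    using assms(5,6) by unfold_locales (auto simp: iqPVM_def)
  have T: "T = T\<^sub>Q" by fact
  show ?thesis
    unfolding T
  proof (intro conjI ballI allI impI)
    show "sigma_L L T\<^sub>Q = sigma_S T\<^sub>Q \<inter> C" "sigma_pL L T\<^sub>Q = sigma_pS T\<^sub>Q \<inter> C"
      "sigma_cL L T\<^sub>Q = sigma_cS T\<^sub>Q \<inter> C"
      using left_spectra_subset spectra_eq by blast+
    show "u *\<^sub>q q = L q u" if "q \<in> C" "u \<noteq> 0 \<and> T\<^sub>Q u = Some (u *\<^sub>q q)" for q u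
      using eigenvector_in_ker [of q u] that by (simp add: ker_left_op_iff)
    show "{u \<in> dom T\<^sub>Q. T\<^sub>Q u = Some (u *\<^sub>q q)} \<subseteq> op_ker (left_op L T\<^sub>Q q)" if "q \<in> sigma_pL L T\<^sub>Q" for q
      using that left_spectra_subset eigenvector_in_ker [of q] by blast
  qed (fact rho_L_eq inv_left_op left_spectra(3) spherical_spectra(3) spherical_spectra_circularization
      range_Q_singleton eigenspace_eq_ker_iff approximate_eigenvector
    | simp add: ker_left_op ker_spherical_op)+
qed

end
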